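(* Let $(M,\nabla,h)$ be a generalized pseudo-Hessian manifold of dimension $n$ and let $x\in M$ be such that the rank of $h_\#$ is constant, equal to $r$, in a neighborhood of $x$. Then there exist a chart $(x_1,\ldots,x_r,y_1,\ldots,y_{n-r})$ around $x$ and a function $f(x,y)$ such that $$h=\sum_{i,j=1}^rh_{ij}\,\partial_{x_i}\otimes\partial_{x_j},\qquad \nabla_{\partial_{x_i}}\partial_{x_j}=0,\quad i,j=1,\ldots,r,$$ and the matrix $(h_{ij})_{1\le i,j\le r}$ is invertible with inverse the matrix $\left(\frac{\partial^2f}{\partial x_i\partial x_j}\right)_{1\le i,j\le r}$.
   Context: All objects are smooth and real. A generalized pseudo-Hessian manifold is a triple $(M,\nabla,h)$ where $\nabla$ is a torsion-free flat linear connection on $M$ and $h$ is a symmetric bivector field (a symmetric section of $TM\otimes TM$, possibly degenerate, viewed as a bilinear form on $T^*M$) such that $(\nabla_{h_\#(\alpha)}h)(\beta,\gamma)=(\nabla_{h_\#(\beta)}h)(\alpha,\gamma)$ for all $\alpha,\beta,\gamma\in\Omega^1(M)$, where $h_\#:T^*M\to TM$ is defined by $\beta(h_\#(\alpha))=h(\alpha,\beta)$. *)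

theory Defs
  imports "HOL-Analysis.Analysis"
begin

(* Smooth maps between open subsets of normed spaces: all iterated directional derivatives
   exist and are continuous.  Only used for open S. *)

primrec times_differentiable_on ::
  "nat \<Rightarrow> ('a::real_normed_vector) set \<Rightarrow> ('a \<Rightarrow> 'b::real_normed_vector) \<Rightarrow> bool" where
  "times_differentiable_on 0 S f \<longleftrightarrow> continuous_on S f"
| "times_differentiable_on (Suc k) S f \<longleftrightarrow>
     (\<forall>u\<in>S. f differentiable (at u)) \<and>
     (\<forall>v. times_differentiable_on k S (\<lambda>u. frechet_derivative f (at u) v))"

definition smooth_on :: "('a::real_normed_vector) set \<Rightarrow> ('a \<Rightarrow> 'b::real_normed_vector) \<Rightarrow> bool" where
  "smooth_on S f \<longleftrightarrow> (\<forall>k. times_differentiable_on k S f)"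

(* A chart is a pair (U, phi); the values of phi outside U are irrelevant. *)

type_synonym ('m, 'n) chart = "'m set \<times> ('m \<Rightarrow> real ^ 'n)"

definition cinv :: "('m, 'n::finite) chart \<Rightarrow> real ^ 'n \<Rightarrow> 'm" where
  "cinv c = inv_into (fst c) (snd c)"

definition cimage :: "('m, 'n::finite) chart \<Rightarrow> 'm set \<Rightarrow> (real ^ 'n) set" where
  "cimage c W = snd c ` (fst c \<inter> W)"

definition transition :: "('m, 'n::finite) chart \<Rightarrow> ('m, 'n) chart \<Rightarrow> real ^ 'n \<Rightarrow> real ^ 'n" where
  "transition c d = snd d \<circ> cinv c"

definition dtransition ::
  "('m, 'n::finite) chart \<Rightarrow> ('m, 'n) chart \<Rightarrow> 'm \<Rightarrow> real ^ 'n \<Rightarrow> real ^ 'n" where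
  "dtransition c d p = frechet_derivative (transition c d) (at (snd c p))"

definition is_chart :: "'m topology \<Rightarrow> ('m, 'n::finite) chart \<Rightarrow> bool" where
  "is_chart X c \<longleftrightarrow>
     openin X (fst c) \<and> open (snd c ` fst c) \<and>
     homeomorphic_map (subtopology X (fst c)) (top_of_set (snd c ` fst c)) (snd c)"

definition compatible :: "('m, 'n::finite) chart \<Rightarrow> ('m, 'n) chart \<Rightarrow> bool" where
  "compatible c d \<longleftrightarrow>
     smooth_on (cimage c (fst d)) (transition c d) \<and>
     smooth_on (cimage d (fst c)) (transition d c)"

(* A is the full differentiable structure (maximal atlas), so that "a chart around x"
   simply means an element of A whose domain contains x. *)

definition smooth_manifold :: "'m topology \<Rightarrow> ('m, 'n::finite) chart set \<Rightarrow> bool" where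
  "smooth_manifold X A \<longleftrightarrow>
     Hausdorff_space X \<and> second_countable X \<and>
     (\<forall>c\<in>A. is_chart X c) \<and>
     (\<Union>c\<in>A. fst c) = topspace X \<and>
     (\<forall>c\<in>A. \<forall>d\<in>A. compatible c d) \<and>
     (\<forall>c. is_chart X c \<and> (\<forall>d\<in>A. compatible c d) \<longrightarrow> c \<in> A)"

definition smooth_fun :: "('m, 'n::finite) chart set \<Rightarrow> 'm set \<Rightarrow> ('m \<Rightarrow> real) \<Rightarrow> bool" where
  "smooth_fun A W g \<longleftrightarrow> (\<forall>c\<in>A. smooth_on (cimage c W) (g \<circ> cinv c))"

(* A tensor field T is a family of components: T c p are the components at the point p with
   respect to the chart c, meaningful only if p lies in the domain of c. *)

type_synonym ('m, 'n, 'v) field = "('m, 'n) chart \<Rightarrow> 'm \<Rightarrow> 'v"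
type_synonym ('m, 'n) vfield = "('m, 'n, real ^ 'n) field"
type_synonym ('m, 'n) form = "('m, 'n, real ^ 'n) field"
type_synonym ('m, 'n) bifield = "('m, 'n, real ^ 'n ^ 'n) field"

definition field_eq_on ::
  "('m, 'n::finite) chart set \<Rightarrow> 'm set \<Rightarrow> ('m, 'n, 'v) field \<Rightarrow> ('m, 'n, 'v) field \<Rightarrow> bool" where
  "field_eq_on A W S T \<longleftrightarrow> (\<forall>c\<in>A. \<forall>p\<in>fst c \<inter> W. S c p = T c p)"

definition smooth_components ::
  "('m, 'n::finite) chart set \<Rightarrow> 'm set \<Rightarrow> ('m, 'n, 'v::real_normed_vector) field \<Rightarrow> bool" where
  "smooth_components A W T \<longleftrightarrow> (\<forall>c\<in>A. smooth_on (cimage c W) (\<lambda>u. T c (cinv c u)))"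

definition vector_field_on ::
  "('m, 'n::finite) chart set \<Rightarrow> 'm set \<Rightarrow> ('m, 'n) vfield \<Rightarrow> bool" where
  "vector_field_on A W V \<longleftrightarrow>
     smooth_components A W V \<and>
     (\<forall>c\<in>A. \<forall>d\<in>A. \<forall>p\<in>fst c \<inter> fst d \<inter> W. V d p = dtransition c d p (V c p))"

definition one_form_on ::
  "('m, 'n::finite) chart set \<Rightarrow> 'm set \<Rightarrow> ('m, 'n) form \<Rightarrow> bool" where
  "one_form_on A W \<alpha> \<longleftrightarrow>
     smooth_components A W \<alpha> \<and>
     (\<forall>c\<in>A. \<forall>d\<in>A. \<forall>p\<in>fst c \<inter> fst d \<inter> W. \<forall>v. \<alpha> c p \<bullet> v = \<alpha> d p \<bullet> dtransition c d p v)"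

definition bivector_field_on ::
  "('m, 'n::finite) chart set \<Rightarrow> 'm set \<Rightarrow> ('m, 'n) bifield \<Rightarrow> bool" where
  "bivector_field_on A W h \<longleftrightarrow>
     smooth_components A W h \<and>
     (\<forall>c\<in>A. \<forall>d\<in>A. \<forall>p\<in>fst c \<inter> fst d \<inter> W.
        h d p = matrix (dtransition c d p) ** h c p ** transpose (matrix (dtransition c d p)))"

definition symmetric_on ::
  "('m, 'n::finite) chart set \<Rightarrow> 'm set \<Rightarrow> ('m, 'n) bifield \<Rightarrow> bool" where
  "symmetric_on A W h \<longleftrightarrow> (\<forall>c\<in>A. \<forall>p\<in>fst c \<inter> W. transpose (h c p) = h c p)"

(* Scalars built from tensor fields do not depend on the chart used to compute them, by the
   transformation laws; some_chart picks one containing p. *)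

definition some_chart :: "('m, 'n::finite) chart set \<Rightarrow> 'm \<Rightarrow> ('m, 'n) chart" where
  "some_chart A p = (SOME c. c \<in> A \<and> p \<in> fst c)"

definition pairing ::
  "('m, 'n::finite) chart set \<Rightarrow> ('m, 'n) form \<Rightarrow> ('m, 'n) vfield \<Rightarrow> 'm \<Rightarrow> real" where
  "pairing A \<alpha> V p = \<alpha> (some_chart A p) p \<bullet> V (some_chart A p) p"

definition bieval ::
  "('m, 'n::finite) chart set \<Rightarrow> ('m, 'n) bifield \<Rightarrow> ('m, 'n) form \<Rightarrow> ('m, 'n) form \<Rightarrow> 'm \<Rightarrow> real" where
  "bieval A h \<alpha> \<beta> p =
     (let c = some_chart A p in \<Sum>i\<in>UNIV. \<Sum>j\<in>UNIV. h c p $ i $ j * \<alpha> c p $ i * \<beta> c p $ j)"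

definition dir_deriv ::
  "('m, 'n::finite) chart set \<Rightarrow> ('m, 'n) vfield \<Rightarrow> ('m \<Rightarrow> real) \<Rightarrow> 'm \<Rightarrow> real" where
  "dir_deriv A V g p =
     (let c = some_chart A p in frechet_derivative (g \<circ> cinv c) (at (snd c p)) (V c p))"

definition coord_deriv :: "('m, 'n::finite) chart \<Rightarrow> 'n \<Rightarrow> ('m \<Rightarrow> real) \<Rightarrow> 'm \<Rightarrow> real" where
  "coord_deriv c i g p = frechet_derivative (g \<circ> cinv c) (at (snd c p)) (axis i 1)"

(* The i-th coordinate vector field of c, a vector field on the domain of c. *)

definition coord_field :: "('m, 'n::finite) chart \<Rightarrow> 'n \<Rightarrow> ('m, 'n) vfield" where
  "coord_field c i = (\<lambda>d p. dtransition c d p (axis i 1))"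

definition tensor :: "('m, 'n::finite) vfield \<Rightarrow> ('m, 'n) vfield \<Rightarrow> ('m, 'n) bifield" where
  "tensor V Y = (\<lambda>c p. \<chi> k l. V c p $ k * Y c p $ l)"

definition lie_bracket :: "('m, 'n::finite) vfield \<Rightarrow> ('m, 'n) vfield \<Rightarrow> ('m, 'n) vfield" where
  "lie_bracket V Y = (\<lambda>c p.
     frechet_derivative (\<lambda>u. Y c (cinv c u)) (at (snd c p)) (V c p) -
     frechet_derivative (\<lambda>u. V c (cinv c u)) (at (snd c p)) (Y c p))"

(* h_sharp is determined by beta (h_sharp alpha) = h (alpha, beta), whence the row-vector
   product. *)

definition sharp :: "('m, 'n::finite) bifield \<Rightarrow> ('m, 'n) form \<Rightarrow> ('m, 'n) vfield" where
  "sharp h \<alpha> = (\<lambda>c p. \<alpha> c p v* h c p)"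

definition sharp_rank :: "('m, 'n::finite) chart set \<Rightarrow> ('m, 'n) bifield \<Rightarrow> 'm \<Rightarrow> nat" where
  "sharp_rank A h p = dim (range (\<lambda>a. a v* h (some_chart A p) p))"

(* A linear connection in the sense of Koszul, acting on the sheaf of vector fields, i.e. on
   vector fields defined on arbitrary open sets W, compatibly with restriction (the second
   clause, which also says that the result depends on the values on W only).
   Additivity and the Leibniz rule give linearity over the reals in the second argument. *)

definition linear_connection ::
  "'m topology \<Rightarrow> ('m, 'n::finite) chart set \<Rightarrow>
   (('m, 'n) vfield \<Rightarrow> ('m, 'n) vfield \<Rightarrow> ('m, 'n) vfield) \<Rightarrow> bool" where
  "linear_connection X A nabla \<longleftrightarrow>
    (\<forall>W. openin X W \<longrightarrow>
      (\<forall>V Y. vector_field_on A W V \<and> vector_field_on A W Y \<longrightarrow>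
         vector_field_on A W (nabla V Y)) \<and>
      (\<forall>V V' Y Y'. vector_field_on A W V \<and> vector_field_on A W V' \<and>
         vector_field_on A W Y \<and> vector_field_on A W Y' \<and>
         field_eq_on A W V V' \<and> field_eq_on A W Y Y' \<longrightarrow>
         field_eq_on A W (nabla V Y) (nabla V' Y')) \<and>
      (\<forall>V V' Y. vector_field_on A W V \<and> vector_field_on A W V' \<and> vector_field_on A W Y \<longrightarrow>
         field_eq_on A W (nabla (\<lambda>c p. V c p + V' c p) Y)
           (\<lambda>c p. nabla V Y c p + nabla V' Y c p)) \<and>
      (\<forall>V Y Y'. vector_field_on A W V \<and> vector_field_on A W Y \<and> vector_field_on A W Y' \<longrightarrow>
         field_eq_on A W (nabla V (\<lambda>c p. Y c p + Y' c p))
           (\<lambda>c p. nabla V Y c p + nabla V Y' c p)) \<and>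
      (\<forall>g V Y. smooth_fun A W g \<and> vector_field_on A W V \<and> vector_field_on A W Y \<longrightarrow>
         field_eq_on A W (nabla (\<lambda>c p. g p *\<^sub>R V c p) Y) (\<lambda>c p. g p *\<^sub>R nabla V Y c p)) \<and>
      (\<forall>g V Y. smooth_fun A W g \<and> vector_field_on A W V \<and> vector_field_on A W Y \<longrightarrow>
         field_eq_on A W (nabla V (\<lambda>c p. g p *\<^sub>R Y c p))
           (\<lambda>c p. dir_deriv A V g p *\<^sub>R Y c p + g p *\<^sub>R nabla V Y c p)))"

definition torsion_free ::
  "'m topology \<Rightarrow> ('m, 'n::finite) chart set \<Rightarrow>
   (('m, 'n) vfield \<Rightarrow> ('m, 'n) vfield \<Rightarrow> ('m, 'n) vfield) \<Rightarrow> bool" where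
  "torsion_free X A nabla \<longleftrightarrow>
    (\<forall>W V Y. openin X W \<and> vector_field_on A W V \<and> vector_field_on A W Y \<longrightarrow>
       field_eq_on A W (\<lambda>c p. nabla V Y c p - nabla Y V c p) (lie_bracket V Y))"

definition flat ::
  "'m topology \<Rightarrow> ('m, 'n::finite) chart set \<Rightarrow>
   (('m, 'n) vfield \<Rightarrow> ('m, 'n) vfield \<Rightarrow> ('m, 'n) vfield) \<Rightarrow> bool" where
  "flat X A nabla \<longleftrightarrow>
    (\<forall>W V Y Z. openin X W \<and> vector_field_on A W V \<and> vector_field_on A W Y \<and>
       vector_field_on A W Z \<longrightarrow>
       field_eq_on A W
         (\<lambda>c p. nabla V (nabla Y Z) c p - nabla Y (nabla V Z) c p - nabla (lie_bracket V Y) Z c p)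
         (\<lambda>c p. 0))"

(* (nabla_V beta)(Y) = V (beta Y) - beta (nabla_V Y); the components of nabla_V beta in the
   chart c are its values on the coordinate fields of c. *)

definition covd_form ::
  "('m, 'n::finite) chart set \<Rightarrow> (('m, 'n) vfield \<Rightarrow> ('m, 'n) vfield \<Rightarrow> ('m, 'n) vfield) \<Rightarrow>
   ('m, 'n) vfield \<Rightarrow> ('m, 'n) form \<Rightarrow> ('m, 'n) form" where
  "covd_form A nabla V \<beta> = (\<lambda>c p. \<chi> i.
     dir_deriv A V (pairing A \<beta> (coord_field c i)) p - pairing A \<beta> (nabla V (coord_field c i)) p)"

definition covd_bivector ::
  "('m, 'n::finite) chart set \<Rightarrow> (('m, 'n) vfield \<Rightarrow> ('m, 'n) vfield \<Rightarrow> ('m, 'n) vfield) \<Rightarrow>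
   ('m, 'n) vfield \<Rightarrow> ('m, 'n) bifield \<Rightarrow> ('m, 'n) form \<Rightarrow> ('m, 'n) form \<Rightarrow> 'm \<Rightarrow> real" where
  "covd_bivector A nabla V h \<beta> \<gamma> p =
     dir_deriv A V (bieval A h \<beta> \<gamma>) p
     - bieval A h (covd_form A nabla V \<beta>) \<gamma> p
     - bieval A h \<beta> (covd_form A nabla V \<gamma>) p"

definition generalized_pseudo_Hessian ::
  "'m topology \<Rightarrow> ('m, 'n::finite) chart set \<Rightarrow>
   (('m, 'n) vfield \<Rightarrow> ('m, 'n) vfield \<Rightarrow> ('m, 'n) vfield) \<Rightarrow> ('m, 'n) bifield \<Rightarrow> bool" where
  "generalized_pseudo_Hessian X A nabla h \<longleftrightarrow>
     smooth_manifold X A \<and>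
     linear_connection X A nabla \<and> torsion_free X A nabla \<and> flat X A nabla \<and>
     bivector_field_on A (topspace X) h \<and> symmetric_on A (topspace X) h \<and>
     (\<forall>\<alpha> \<beta> \<gamma>. one_form_on A (topspace X) \<alpha> \<and> one_form_on A (topspace X) \<beta> \<and>
        one_form_on A (topspace X) \<gamma> \<longrightarrow>
        (\<forall>p\<in>topspace X.
           covd_bivector A nabla (sharp h \<alpha>) h \<beta> \<gamma> p = covd_bivector A nabla (sharp h \<beta>) h \<alpha> \<gamma> p))"

(* B is the two-sided inverse of the square matrix (G i j) with rows and columns in I. *)

definition inverse_matrices :: "'n set \<Rightarrow> ('n \<Rightarrow> 'n \<Rightarrow> real) \<Rightarrow> ('n \<Rightarrow> 'n \<Rightarrow> real) \<Rightarrow> bool" where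
  "inverse_matrices I G B \<longleftrightarrow>
     (\<forall>i\<in>I. \<forall>j\<in>I.
        (\<Sum>k\<in>I. G i k * B k j) = (if i = j then 1 else 0) \<and>
        (\<Sum>k\<in>I. B i k * G k j) = (if i = j then 1 else 0))"

end

theory Submission
  imports Defs
begin

text \<open>
  A flat torsion-free connection has affine coordinates, and in affine coordinates the Hessian condition says
  that \<open>T i j k = (\<Sum>l. h i l * \<partial>\<^sub>l h j k)\<close> is totally symmetric. If \<open>\<gamma>\<close> lies in the kernel of \<open>h\<close>, then the
  contraction of \<open>T\<close> with \<open>\<gamma>\<close> vanishes, so derivatives of sections of the range of \<open>h\<close> along the range stay in
  the range. Where the rank is constant, the range is a graph over the coordinate plane of a set \<open>I\<close> of \<open>r\<close>
  indices for which the principal block of \<open>h\<close> is invertible, and the projection \<open>Q\<close> onto it along the other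
  coordinates satisfies the Burgers-type equation \<open>dQ (Q v) = 0\<close>. Hence \<open>Q\<close> is constant along the affine
  subspaces \<open>y + Q(y) x\<close>, which are the leaves, and \<open>(x, y)\<close> are the required coordinates: their \<open>x\<close>-fields are
  the columns of \<open>Q\<close>. The coefficient matrix of \<open>h\<close> is its principal block, the inverse of that block has totally
  symmetric \<open>x\<close>-derivatives, and the Poincare lemma with \<open>y\<close> as a parameter, applied twice, makes it a Hessian.
\<close>

section \<open>Smooth maps\<close>

text \<open>A general theorem on integrable distributions would give some coordinates adapted to the
  leaves, with no control of their \<open>x\<close>-fields. Here the parametrization is explicit,
  and its \<open>x\<close>-derivatives are columns of \<open>Q\<close>, which do not change along a
  leaf. They may change from leaf to leaf, so the new chart is in general not affine; the conclusion
  asks for parallelism only along the leaves. That \<open>Q\<close> is constant on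
  \<open>y + Q(y) x\<close> is not immediate: the segment has the direction of the range of
  \<open>Q\<close> at its starting point, not at the moving point. The discrepancy is linear in the
  difference of the two projections, and a Gronwall estimate with zero inhomogeneity removes it. The
  same estimate, with an inhomogeneity of second order, gives differentiability of parallel covector
  fields, which are constructed from an integral equation along rays. The Hessian condition is
  stated for global one-forms. Reading it in coordinates at a point requires global forms with
  prescribed values there, hence bump functions. Submatrices are padded to full size, so that all
  matrices are indexed by \<open>'n\<close> whatever \<open>r\<close> is.\<close>

abbreviation fd :: "('a::real_normed_vector \<Rightarrow> 'b::real_normed_vector) \<Rightarrow> 'a \<Rightarrow> 'a \<Rightarrow> 'b" where
  "fd f u \<equiv> frechet_derivative f (at u)"

lemma fd_eq: "(f has_derivative f') (at u) \<Longrightarrow> fd f u = f'"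
  using frechet_derivative_at by metis

lemma differentiable_fd: "f differentiable at u \<Longrightarrow> (f has_derivative fd f u) (at u)"
  by (simp add: frechet_derivative_works)

lemma fd_linear: "f differentiable at u \<Longrightarrow> linear (fd f u)"
  by (rule linear_frechet_derivative)

text \<open>\<open>frechet_derivative\<close> is a choice from the predicate of being a derivative
  at \<open>u\<close>. Local agreement makes the two predicates equal, so the chosen values coincide
  even where neither function is differentiable.\<close>

lemma fd_cong_open:
  assumes "open S" "u \<in> S" "\<And>x. x \<in> S \<Longrightarrow> f x = g x"
  shows "fd f u = fd g u"
proof -
  have "(f has_derivative F) (at u) \<longleftrightarrow> (g has_derivative F) (at u)" for F
    using assms by (metis has_derivative_transform_within_open)
  then show ?thesis unfolding frechet_derivative_def by simp
qed

lemma differentiable_cong_open: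
  assumes "open S" "u \<in> S" "\<And>x. x \<in> S \<Longrightarrow> f x = g x" "f differentiable at u"
  shows "g differentiable at u"
  using assms unfolding differentiable_def by (metis has_derivative_transform_within_open)

lemma times_differentiable_on_subset:
  "times_differentiable_on k S f \<Longrightarrow> T \<subseteq> S \<Longrightarrow> times_differentiable_on k T f"
  by (induction k arbitrary: f) (auto intro: continuous_on_subset)

lemma times_differentiable_on_Suc_lower:
  "times_differentiable_on (Suc k) S f \<Longrightarrow> times_differentiable_on k S f"
proof (induction k arbitrary: f)
  case 0
  then show ?case
    by (auto intro!: continuous_at_imp_continuous_on differentiable_imp_continuous_within)
next
  case (Suc k)
  then show ?case by auto
qed

lemma times_differentiable_on_cong:
  assumes "open S" "\<And>x. x \<in> S \<Longrightarrow> f x = g x" "times_differentiable_on k S f"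
  shows "times_differentiable_on k S g"
  using assms(2,3)
proof (induction k arbitrary: f g)
  case 0
  then show ?case using continuous_on_cong by (metis times_differentiable_on.simps(1))
next
  case (Suc k)
  have "times_differentiable_on k S (\<lambda>u. fd g u v)" for v
  proof (rule Suc.IH)
    show "times_differentiable_on k S (\<lambda>u. fd f u v)" using Suc.prems by simp
    show "fd f u v = fd g u v" if "u \<in> S" for u
      using fd_cong_open[OF assms(1) that, of f g] Suc.prems by simp
  qed
  then show ?case using Suc.prems differentiable_cong_open[OF assms(1), of _ f g] by auto
qed

lemma times_differentiable_on_local:
  assumes "\<And>x. x \<in> S \<Longrightarrow> \<exists>T. open T \<and> x \<in> T \<and> times_differentiable_on k T f"
  shows "times_differentiable_on k S f"
  using assms
proof (induction k arbitrary: f)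
  case 0
  have "continuous_on S f"
  proof (rule continuous_at_imp_continuous_on, rule ballI)
    fix x assume "x \<in> S"
    then obtain T where "open T" "x \<in> T" "continuous_on T f" using 0 by auto
    then show "isCont f x" by (simp add: continuous_on_eq_continuous_at)
  qed
  then show ?case by simp
next
  case (Suc k)
  have "times_differentiable_on k S (\<lambda>u. fd f u v)" for v
    by (rule Suc.IH) (use Suc.prems in fastforce)
  moreover have "f differentiable at u" if "u \<in> S" for u
    using Suc.prems[OF that] by auto
  ultimately show ?case by simp
qed

lemma times_differentiable_on_const: "times_differentiable_on k S (\<lambda>x. c)"
  by (induction k arbitrary: c) auto

lemma times_differentiable_on_add:
  assumes "open S" "times_differentiable_on k S f" "times_differentiable_on k S g"
  shows "times_differentiable_on k S (\<lambda>x. f x + g x)"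
  using assms(2,3)
proof (induction k arbitrary: f g)
  case 0
  then show ?case by (auto intro: continuous_on_add)
next
  case (Suc k)
  have "times_differentiable_on k S (\<lambda>u. fd (\<lambda>x. f x + g x) u v)" for v
  proof (rule times_differentiable_on_cong[OF assms(1)])
    show "times_differentiable_on k S (\<lambda>u. fd f u v + fd g u v)" using Suc by auto
    show "fd f u v + fd g u v = fd (\<lambda>x. f x + g x) u v" if "u \<in> S" for u
      using Suc.prems that frechet_derivative_works
      by (subst fd_eq[OF has_derivative_add[of f "fd f u" _ g "fd g u"]]) auto
  qed
  then show ?case using Suc.prems by auto
qed

lemma times_differentiable_on_sum:
  assumes "open S" "\<And>i. i \<in> I \<Longrightarrow> times_differentiable_on k S (f i)"
  shows "times_differentiable_on k S (\<lambda>x. \<Sum>i\<in>I. f i x)"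
  using assms(2)
  by (induction I rule: infinite_finite_induct)
     (auto intro!: times_differentiable_on_const times_differentiable_on_add[OF assms(1)])

lemma (in bounded_bilinear) times_differentiable_on_bilinear:
  assumes "open S" "times_differentiable_on k S f" "times_differentiable_on k S g"
  shows "times_differentiable_on k S (\<lambda>x. prod (f x) (g x))"
  using assms(2,3)
proof (induction k arbitrary: f g)
  case 0
  then show ?case by (auto intro: continuous_on)
next
  case (Suc k)
  have d: "((\<lambda>x. prod (f x) (g x)) has_derivative (\<lambda>v. prod (f u) (fd g u v) + prod (fd f u v) (g u))) (at u)"
    if "u \<in> S" for u
    using Suc.prems that by (intro FDERIV differentiable_fd) auto
  have "times_differentiable_on k S (\<lambda>u. fd (\<lambda>x. prod (f x) (g x)) u v)" for v
  proof (rule times_differentiable_on_cong[OF assms(1)])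
    have "times_differentiable_on k S f" "times_differentiable_on k S g"
      using Suc.prems times_differentiable_on_Suc_lower by auto
    then show "times_differentiable_on k S (\<lambda>u. prod (f u) (fd g u v) + prod (fd f u v) (g u))"
      using Suc by (intro times_differentiable_on_add[OF assms(1)]) auto
    show "prod (f u) (fd g u v) + prod (fd f u v) (g u) = fd (\<lambda>x. prod (f x) (g x)) u v"
      if "u \<in> S" for u using fd_eq[OF d[OF that]] by simp
  qed
  then show ?case using d by (auto simp: differentiable_def)
qed

lemma times_differentiable_on_linear:
  assumes "bounded_linear L" "open S" "times_differentiable_on k S f"
  shows "times_differentiable_on k S (\<lambda>x. L (f x))"
  using assms(3)
proof (induction k arbitrary: f)
  case 0
  then show ?case using assms(1) by (auto intro: bounded_linear.continuous_on)
next
  case (Suc k)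
  have d: "((\<lambda>x. L (f x)) has_derivative (\<lambda>v. L (fd f u v))) (at u)" if "u \<in> S" for u
    using Suc.prems that frechet_derivative_works
    by (intro bounded_linear.has_derivative[OF assms(1)]) auto
  have "times_differentiable_on k S (\<lambda>u. fd (\<lambda>x. L (f x)) u v)" for v
    by (rule times_differentiable_on_cong[OF assms(2) _ Suc.IH[of "\<lambda>u. fd f u v"]])
       (use fd_eq[OF d] Suc.prems in auto)
  then show ?case using d by (auto simp: differentiable_def)
qed

lemma linear_eq_sum_Basis:
  fixes L :: "'a::euclidean_space \<Rightarrow> 'b::real_vector"
  assumes "linear L"
  shows "L v = (\<Sum>b\<in>Basis. (v \<bullet> b) *\<^sub>R L b)"
proof -
  have "L v = L (\<Sum>b\<in>Basis. (v \<bullet> b) *\<^sub>R b)" by (simp add: euclidean_representation)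
  also have "\<dots> = (\<Sum>b\<in>Basis. (v \<bullet> b) *\<^sub>R L b)"
    by (simp add: linear_sum[OF assms] linear_scale[OF assms])
  finally show ?thesis .
qed

text \<open>The definition speaks of derivatives along fixed vectors, whereas the chain rule
  differentiates \<open>g\<close> along the moving vector \<open>fd f u v\<close>. Expanding that
  vector in \<open>Basis\<close> restores fixed directions, which is why the intermediate space is
  Euclidean.\<close>

lemma times_differentiable_on_compose:
  fixes g :: "'b::euclidean_space \<Rightarrow> 'c::real_normed_vector"
  assumes "open S" "times_differentiable_on k S f" "times_differentiable_on k T g" "f ` S \<subseteq> T"
  shows "times_differentiable_on k S (\<lambda>x. g (f x))"
  using assms(2-4)
proof (induction k arbitrary: f g)
  case 0
  then show ?case by (auto intro: continuous_on_compose2)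
next
  case (Suc k)
  have d: "((\<lambda>x. g (f x)) has_derivative (\<lambda>v. fd g (f u) (fd f u v))) (at u)" if "u \<in> S" for u
    using Suc.prems that
    by (intro has_derivative_compose[of f "fd f u" u UNIV g "fd g (f u)"] differentiable_fd) auto
  have "times_differentiable_on k S (\<lambda>u. fd (\<lambda>x. g (f x)) u v)" for v
  proof (rule times_differentiable_on_cong[OF assms(1)])
    have "times_differentiable_on k S f" using Suc.prems(1) times_differentiable_on_Suc_lower by blast
    then show "times_differentiable_on k S (\<lambda>u. \<Sum>b\<in>Basis. (fd f u v \<bullet> b) *\<^sub>R fd g (f u) b)"
      using Suc.prems
      by (intro times_differentiable_on_sum[OF assms(1)] Suc.IH[of f "\<lambda>w. fd g w b" for b]
            bounded_bilinear.times_differentiable_on_bilinear[OF bounded_bilinear_scaleR]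
            times_differentiable_on_linear[of "\<lambda>x. x \<bullet> b" for b] bounded_linear_inner_left assms(1))
         auto
    show "(\<Sum>b\<in>Basis. (fd f u v \<bullet> b) *\<^sub>R fd g (f u) b) = fd (\<lambda>x. g (f x)) u v" if "u \<in> S" for u
      using linear_eq_sum_Basis[OF fd_linear, of g "f u" "fd f u v"] Suc.prems that
      by (subst fd_eq[OF d[OF that]]) auto
  qed
  then show ?case using d by (auto simp: differentiable_def)
qed

named_theorems smooth_intros

lemma smooth_on_subset: "smooth_on S f \<Longrightarrow> T \<subseteq> S \<Longrightarrow> smooth_on T f"
  by (auto simp: smooth_on_def intro: times_differentiable_on_subset)

lemma smooth_on_cong:
  "open S \<Longrightarrow> (\<And>x. x \<in> S \<Longrightarrow> f x = g x) \<Longrightarrow> smooth_on S f \<Longrightarrow> smooth_on S g"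
  by (auto simp: smooth_on_def intro: times_differentiable_on_cong)

lemma smooth_on_local:
  assumes "\<And>x. x \<in> S \<Longrightarrow> \<exists>T. open T \<and> x \<in> T \<and> smooth_on T f"
  shows "smooth_on S f"
  unfolding smooth_on_def
proof
  fix k show "times_differentiable_on k S f"
    by (rule times_differentiable_on_local) (use assms smooth_on_def in blast)
qed

lemma smooth_on_differentiable: "smooth_on S f \<Longrightarrow> u \<in> S \<Longrightarrow> f differentiable at u"
  unfolding smooth_on_def using times_differentiable_on.simps(2)[of 0] by blast

lemma smooth_on_has_derivative: "smooth_on S f \<Longrightarrow> u \<in> S \<Longrightarrow> (f has_derivative fd f u) (at u)"
  using smooth_on_differentiable frechet_derivative_works by blast

lemma smooth_on_continuous: "smooth_on S f \<Longrightarrow> continuous_on S f"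
  unfolding smooth_on_def using times_differentiable_on.simps(1)[of S f] by blast

lemma smooth_on_fd_dir: "smooth_on S f \<Longrightarrow> smooth_on S (\<lambda>u. fd f u v)"
  unfolding smooth_on_def using times_differentiable_on.simps(2) by blast

lemma smooth_on_linear_fd: "smooth_on S f \<Longrightarrow> u \<in> S \<Longrightarrow> linear (fd f u)"
  using smooth_on_differentiable fd_linear by blast

lemma smooth_onI:
  assumes "\<And>u. u \<in> S \<Longrightarrow> f differentiable at u" "\<And>v. smooth_on S (\<lambda>u. fd f u v)"
  shows "smooth_on S f"
  unfolding smooth_on_def
proof
  fix k show "times_differentiable_on k S f"
    using assms by (cases k) (auto simp: smooth_on_def intro!: continuous_at_imp_continuous_on
        differentiable_imp_continuous_within)
qed

lemma smooth_on_const [smooth_intros]: "smooth_on S (\<lambda>x. c)"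
  by (simp add: smooth_on_def times_differentiable_on_const)

lemma smooth_on_linear: "bounded_linear f \<Longrightarrow> smooth_on S f"
  by (rule smooth_onI)
     (simp_all add: bounded_linear_imp_differentiable smooth_on_const
        fd_eq[OF bounded_linear_imp_has_derivative])

lemma smooth_on_ident [smooth_intros]: "smooth_on S (\<lambda>x. x)"
  by (rule smooth_on_linear) (rule bounded_linear_ident)

lemma smooth_on_add [smooth_intros]:
  "open S \<Longrightarrow> smooth_on S f \<Longrightarrow> smooth_on S g \<Longrightarrow> smooth_on S (\<lambda>x. f x + g x)"
  by (simp add: smooth_on_def times_differentiable_on_add)

lemma smooth_on_sum [smooth_intros]:
  "open S \<Longrightarrow> (\<And>i. i \<in> I \<Longrightarrow> smooth_on S (f i)) \<Longrightarrow> smooth_on S (\<lambda>x. \<Sum>i\<in>I. f i x)"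
  by (simp add: smooth_on_def times_differentiable_on_sum)

lemma smooth_on_bounded_linear:
  "bounded_linear L \<Longrightarrow> open S \<Longrightarrow> smooth_on S f \<Longrightarrow> smooth_on S (\<lambda>x. L (f x))"
  by (simp add: smooth_on_def times_differentiable_on_linear)

lemma smooth_on_bilinear:
  "bounded_bilinear p \<Longrightarrow> open S \<Longrightarrow> smooth_on S f \<Longrightarrow> smooth_on S g \<Longrightarrow> smooth_on S (\<lambda>x. p (f x) (g x))"
  by (simp add: smooth_on_def bounded_bilinear.times_differentiable_on_bilinear)

lemma smooth_on_compose:
  fixes g :: "'b::euclidean_space \<Rightarrow> 'c::real_normed_vector"
  assumes "smooth_on T g" "open S" "smooth_on S f" "\<And>x. x \<in> S \<Longrightarrow> f x \<in> T"
  shows "smooth_on S (\<lambda>x. g (f x))"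
  using assms unfolding smooth_on_def by (metis image_subsetI times_differentiable_on_compose)

lemmas smooth_on_scaleR [smooth_intros] = smooth_on_bilinear[OF bounded_bilinear_scaleR]
lemmas smooth_on_mult [smooth_intros] = smooth_on_bilinear[OF bounded_bilinear_mult]
lemmas smooth_on_inner [smooth_intros] = smooth_on_bilinear[OF bounded_bilinear_inner]
lemmas smooth_on_uminus [smooth_intros] = smooth_on_bounded_linear[OF bounded_linear_minus[OF bounded_linear_ident]]
lemmas smooth_on_nth [smooth_intros] = smooth_on_bounded_linear[OF bounded_linear_vec_nth]

lemma smooth_on_diff [smooth_intros]:
  "open S \<Longrightarrow> smooth_on S f \<Longrightarrow> smooth_on S g \<Longrightarrow> smooth_on S (\<lambda>x. f x - g x)"
  using smooth_on_add[of S f "\<lambda>x. - g x"] smooth_on_uminus[of S g] by simp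

text \<open>Base point and direction both move; as for composition, expanding \<open>w x\<close> in
  \<open>Basis\<close> reduces the claim to derivatives along fixed vectors.\<close>

lemma smooth_on_fd [smooth_intros]:
  fixes f :: "'b::euclidean_space \<Rightarrow> 'c::real_normed_vector"
  assumes "open S" "smooth_on T f" "smooth_on S g" "\<And>x. x \<in> S \<Longrightarrow> g x \<in> T" "smooth_on S w"
  shows "smooth_on S (\<lambda>x. fd f (g x) (w x))"
proof (rule smooth_on_cong[OF assms(1)])
  show "smooth_on S (\<lambda>x. \<Sum>b\<in>Basis. (w x \<bullet> b) *\<^sub>R fd f (g x) b)"
    using assms by (intro smooth_intros smooth_on_compose[OF smooth_on_fd_dir[of T f]]) auto
  show "(\<Sum>b\<in>Basis. (w x \<bullet> b) *\<^sub>R fd f (g x) b) = fd f (g x) (w x)" if "x \<in> S" for x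
    using linear_eq_sum_Basis[OF smooth_on_linear_fd[OF assms(2)], of "g x" "w x"] assms that by simp
qed

lemma bounded_linear_axis: "bounded_linear (\<lambda>x::'b::euclidean_space. axis i x :: 'b ^ 'n::finite)"
  unfolding linear_conv_bounded_linear[symmetric]
  by (intro linearI) (auto simp: axis_def vec_eq_iff)

lemma vec_eq_sum_axis: "(f :: 'b::euclidean_space ^ 'n::finite) = (\<Sum>i\<in>UNIV. axis i (f $ i))"
  by (simp add: vec_eq_iff axis_def sum.delta)

lemma smooth_on_vecI:
  fixes f :: "'a::real_normed_vector \<Rightarrow> 'b::euclidean_space ^ 'n::finite"
  assumes "open S" "\<And>i. smooth_on S (\<lambda>x. f x $ i)"
  shows "smooth_on S f"
proof (rule smooth_on_cong[OF assms(1)])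
  show "smooth_on S (\<lambda>x. \<Sum>i\<in>UNIV. axis i (f x $ i))"
    using assms by (intro smooth_on_sum smooth_on_bounded_linear[OF bounded_linear_axis]) auto
qed (use vec_eq_sum_axis in metis)

lemma smooth_on_vec [smooth_intros]:
  fixes f :: "'n::finite \<Rightarrow> 'a::real_normed_vector \<Rightarrow> 'b::euclidean_space"
  assumes "open S" "\<And>i. smooth_on S (f i)"
  shows "smooth_on S (\<lambda>x. \<chi> i. f i x)"
  by (rule smooth_on_vecI) (use assms in auto)

lemma smooth_on_prod [smooth_intros]:
  fixes f :: "'i \<Rightarrow> 'a::real_normed_vector \<Rightarrow> real"
  assumes "open S" "\<And>i. i \<in> I \<Longrightarrow> smooth_on S (f i)"
  shows "smooth_on S (\<lambda>x. \<Prod>i\<in>I. f i x)"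
  using assms(2)
  by (induction I rule: infinite_finite_induct) (auto intro!: smooth_on_const smooth_on_mult assms(1))

text \<open>The derivative of \<open>1/f\<close> is a product of \<open>1/f\<close> with itself and
  \<open>fd f\<close>, so each order of differentiability of \<open>1/f\<close> yields the next
  one.\<close>

lemma smooth_on_inverse [smooth_intros]:
  fixes f :: "'a::real_normed_vector \<Rightarrow> real"
  assumes "open S" "smooth_on S f" "\<And>x. x \<in> S \<Longrightarrow> f x \<noteq> 0"
  shows "smooth_on S (\<lambda>x. inverse (f x))"
proof -
  have d: "((\<lambda>x. inverse (f x)) has_derivative (\<lambda>v. - (inverse (f u) * fd f u v * inverse (f u)))) (at u)"
    if "u \<in> S" for u
    using assms(3)[OF that] smooth_on_has_derivative[OF assms(2) that]
    by (intro Deriv.has_derivative_inverse) auto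
  have "times_differentiable_on k S (\<lambda>x. inverse (f x))" for k
  proof (induction k)
    case 0
    then show ?case using smooth_on_continuous[OF assms(2)] assms(3)
      by (auto intro: continuous_on_inverse)
  next
    case (Suc k)
    have "times_differentiable_on k S (\<lambda>u. fd (\<lambda>x. inverse (f x)) u v)" for v
    proof (rule times_differentiable_on_cong[OF assms(1)])
      show "times_differentiable_on k S (\<lambda>u. - (inverse (f u) * fd f u v * inverse (f u)))"
        using Suc smooth_on_fd_dir[OF assms(2), of v] unfolding smooth_on_def
        by (intro times_differentiable_on_linear[OF bounded_linear_minus[OF bounded_linear_ident]]
            bounded_bilinear.times_differentiable_on_bilinear[OF bounded_bilinear_mult] assms(1)) auto
    qed (use fd_eq[OF d] in auto)
    then show ?case using d by (auto simp: differentiable_def)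
  qed
  then show ?thesis by (simp add: smooth_on_def)
qed

section \<open>Smooth dependence of determinants and inverse matrices\<close>

lemma smooth_on_det [smooth_intros]:
  fixes M :: "'a::real_normed_vector \<Rightarrow> real ^ 'n ^ 'n"
  assumes "open S" "smooth_on S M"
  shows "smooth_on S (\<lambda>x. det (M x))"
  unfolding det_def using assms by (intro smooth_intros) auto

lemma matrix_inv_eq:
  fixes M :: "real ^ 'n ^ 'n"
  assumes "det M \<noteq> 0"
  shows "M ** matrix_inv M = mat 1" "matrix_inv M ** M = mat 1"
proof -
  have "\<exists>B. M ** B = mat 1 \<and> B ** M = mat 1"
    using assms by (metis invertible_def invertible_det_nz)
  then have "M ** matrix_inv M = mat 1 \<and> matrix_inv M ** M = mat 1"
    unfolding matrix_inv_def by (rule someI_ex)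
  then show "M ** matrix_inv M = mat 1" "matrix_inv M ** M = mat 1" by auto
qed

text \<open>Cramer's rule writes each entry of the inverse as a quotient of determinants; smoothness
  of matrix inversion then follows from products and scalar inverses.\<close>

lemma matrix_inv_cramer:
  fixes M :: "real ^ 'n ^ 'n"
  assumes "det M \<noteq> 0"
  shows "matrix_inv M $ k $ j =
    det (\<chi> a b. if b = k then axis j 1 $ a else M $ a $ b) / det M"
proof -
  have "M ** matrix_inv M = mat 1"
    using assms by (rule matrix_inv_eq)
  then have "M *v (matrix_inv M *v axis j 1) = axis j 1" by (simp add: matrix_vector_mul_assoc)
  then have "matrix_inv M *v axis j 1 =
      (\<chi> k. det (\<chi> a b. if b = k then axis j 1 $ a else M $ a $ b) / det M)"
    using cramer[OF assms] by blast
  moreover have "(matrix_inv M *v axis j 1) $ k = matrix_inv M $ k $ j"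
    by (simp add: matrix_vector_mult_basis column_def)
  ultimately show ?thesis by simp
qed

lemma smooth_on_matrix_inv [smooth_intros]:
  fixes M :: "'a::real_normed_vector \<Rightarrow> real ^ 'n ^ 'n"
  assumes "open S" "smooth_on S M" "\<And>x. x \<in> S \<Longrightarrow> det (M x) \<noteq> 0"
  shows "smooth_on S (\<lambda>x. matrix_inv (M x))"
proof (intro smooth_on_vecI assms(1))
  fix i j
  have c: "smooth_on S (\<lambda>x. (if b = i then axis j 1 $ a else M x $ a $ b) :: real)" for a b
    using assms by (cases "b = i") (auto intro!: smooth_intros)
  show "smooth_on S (\<lambda>x. matrix_inv (M x) $ i $ j)"
  proof (rule smooth_on_cong[OF assms(1)])
    show "smooth_on S (\<lambda>x. det (\<chi> a b. if b = i then axis j 1 $ a else M x $ a $ b) * inverse (det (M x)))"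
      using assms by (intro smooth_intros c) auto
    show "det (\<chi> a b. if b = i then axis j 1 $ a else M x $ a $ b) * inverse (det (M x)) =
        matrix_inv (M x) $ i $ j" if "x \<in> S" for x
      unfolding matrix_inv_cramer[OF assms(3)[OF that]] divide_inverse ..
  qed
qed

section \<open>Estimates and the inverse function theorem\<close>

text \<open>Smoothness controls a derivative along one fixed vector at a time. Summing such bounds
  over \<open>Basis\<close> bounds the whole linear map.\<close>

lemma linear_bound_Basis:
  fixes L :: "'a::euclidean_space \<Rightarrow> 'b::real_normed_vector"
  assumes "linear L" "\<And>b. b \<in> Basis \<Longrightarrow> norm (L b) \<le> c b"
  shows "norm (L v) \<le> (\<Sum>b\<in>Basis. c b) * norm v"
proof -
  have "norm (L v) \<le> (\<Sum>b\<in>Basis. norm ((v \<bullet> b) *\<^sub>R L b))"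
    unfolding linear_eq_sum_Basis[OF assms(1), of v] by (rule norm_sum)
  also have "\<dots> \<le> (\<Sum>b\<in>Basis. norm v * c b)"
  proof (rule sum_mono)
    fix b :: 'a assume b: "b \<in> Basis"
    then have "\<bar>v \<bullet> b\<bar> \<le> norm v" by (simp add: Basis_le_norm)
    then show "norm ((v \<bullet> b) *\<^sub>R L b) \<le> norm v * c b"
      using assms(2)[OF b] by (auto intro!: mult_mono)
  qed
  finally show ?thesis by (simp add: sum_distrib_left mult.commute)
qed

lemma smooth_on_bound_compact:
  assumes "smooth_on S f" "compact K" "K \<subseteq> S"
  obtains C where "C \<ge> 0" "\<And>u. u \<in> K \<Longrightarrow> norm (f u) \<le> C"
proof -
  have "bounded (f ` K)"
    using assms by (intro compact_imp_bounded compact_continuous_image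
        continuous_on_subset[OF smooth_on_continuous[OF assms(1)]])
  then obtain C where "\<And>u. u \<in> K \<Longrightarrow> norm (f u) \<le> C" unfolding bounded_iff by auto
  then have "norm (f u) \<le> max 0 C" if "u \<in> K" for u using that by (meson max.coboundedI2)
  then show thesis by (intro that[of "max 0 C"]) auto
qed

lemma smooth_on_fd_bound_compact:
  fixes f :: "'a::euclidean_space \<Rightarrow> 'b::real_normed_vector"
  assumes "smooth_on S f" "compact K" "K \<subseteq> S"
  obtains C where "C \<ge> 0" "\<And>u v. u \<in> K \<Longrightarrow> norm (fd f u v) \<le> C * norm v"
proof -
  have "\<exists>C. C \<ge> 0 \<and> (\<forall>u\<in>K. norm (fd f u b) \<le> C)" for b
    by (rule smooth_on_bound_compact[OF smooth_on_fd_dir[OF assms(1)] assms(2,3), of b]) blast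
  then obtain c where c: "\<And>b. c b \<ge> 0" "\<And>b u. u \<in> K \<Longrightarrow> norm (fd f u b) \<le> c b" by metis
  show thesis
  proof (rule that[of "\<Sum>b\<in>Basis. c b"])
    show "norm (fd f u v) \<le> (\<Sum>b\<in>Basis. c b) * norm v" if "u \<in> K" for u v
      using that c assms by (intro linear_bound_Basis smooth_on_linear_fd[OF assms(1)]) auto
  qed (simp add: c sum_nonneg)
qed

lemma smooth_on_lipschitz_compact:
  fixes f :: "'a::euclidean_space \<Rightarrow> 'b::real_normed_vector"
  assumes "smooth_on S f" "compact K" "convex K" "K \<subseteq> S"
  obtains C where "C \<ge> 0" "\<And>u v. u \<in> K \<Longrightarrow> v \<in> K \<Longrightarrow> norm (f v - f u) \<le> C * norm (v - u)"
proof -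
  obtain C where C: "C \<ge> 0" "\<And>u v. u \<in> K \<Longrightarrow> norm (fd f u v) \<le> C * norm v"
    by (rule smooth_on_fd_bound_compact[OF assms(1,2,4)]) (rule that)
  show thesis
  proof (rule that[OF C(1)])
    show "norm (f v - f u) \<le> C * norm (v - u)" if "u \<in> K" "v \<in> K" for u v
    proof (rule differentiable_bound[OF assms(3) _ _ that(2,1)])
      show "(f has_derivative fd f x) (at x within K)" if "x \<in> K" for x
        using that assms by (meson has_derivative_at_withinI smooth_on_has_derivative subsetD)
      show "onorm (fd f x) \<le> C" if "x \<in> K" for x
        using that C by (intro onorm_le) auto
    qed
  qed
qed

lemma smooth_on_fd_lipschitz_compact:
  fixes f :: "'a::euclidean_space \<Rightarrow> 'b::real_normed_vector"
  assumes "smooth_on S f" "compact K" "convex K" "K \<subseteq> S"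
  obtains C where "C \<ge> 0"
    "\<And>u v w. u \<in> K \<Longrightarrow> v \<in> K \<Longrightarrow> norm (fd f v w - fd f u w) \<le> C * norm (v - u) * norm w"
proof -
  have "\<exists>C. C \<ge> 0 \<and> (\<forall>u\<in>K. \<forall>v\<in>K. norm (fd f v b - fd f u b) \<le> C * norm (v - u))" for b
    by (rule smooth_on_lipschitz_compact[OF smooth_on_fd_dir[OF assms(1)] assms(2-4), of b]) blast
  then obtain c where c: "\<And>b. c b \<ge> 0"
      "\<And>b u v. u \<in> K \<Longrightarrow> v \<in> K \<Longrightarrow> norm (fd f v b - fd f u b) \<le> c b * norm (v - u)" by metis
  show thesis
  proof (rule that[of "\<Sum>b\<in>Basis. c b"])
    fix u v w assume uv: "u \<in> K" "v \<in> K"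
    have "linear (\<lambda>w. fd f v w - fd f u w)"
      using uv assms smooth_on_linear_fd[OF assms(1)] by (intro linear_compose_sub) auto
    then have "norm (fd f v w - fd f u w) \<le> (\<Sum>b\<in>Basis. c b * norm (v - u)) * norm w"
      using c uv by (intro linear_bound_Basis) auto
    then show "norm (fd f v w - fd f u w) \<le> (\<Sum>b\<in>Basis. c b) * norm (v - u) * norm w"
      by (simp add: sum_distrib_right)
  qed (simp add: c sum_nonneg)
qed

text \<open>The map \<open>x \<mapsto> f x - fd f u x\<close> has derivative
  \<open>fd f x - fd f u\<close>, which the Lipschitz bound makes at most
  \<open>C * norm (v - u)\<close> on the segment; the mean value inequality does the rest. The
  constant is not the sharp one, only the second order matters.\<close>

lemma smooth_on_taylor_compact:
  fixes f :: "'a::euclidean_space \<Rightarrow> 'b::real_normed_vector"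
  assumes "smooth_on S f" "compact K" "convex K" "K \<subseteq> S"
  obtains C where "C \<ge> 0"
    "\<And>u v. u \<in> K \<Longrightarrow> v \<in> K \<Longrightarrow> norm (f v - f u - fd f u (v - u)) \<le> C * norm (v - u) ^ 2"
proof -
  obtain C where C: "C \<ge> 0"
    "\<And>u v w. u \<in> K \<Longrightarrow> v \<in> K \<Longrightarrow> norm (fd f v w - fd f u w) \<le> C * norm (v - u) * norm w"
    by (rule smooth_on_fd_lipschitz_compact[OF assms]) (rule that)
  show thesis
  proof (rule that[OF C(1)])
    fix u v assume uv: "u \<in> K" "v \<in> K"
    let ?I = "closed_segment u v"
    have I: "?I \<subseteq> K" using uv assms(3) by (simp add: closed_segment_subset)
    have "norm ((f v - fd f u v) - (f u - fd f u u)) \<le> (C * norm (v - u)) * norm (v - u)"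
    proof (rule differentiable_bound[of ?I "\<lambda>x. f x - fd f u x" "\<lambda>x w. fd f x w - fd f u w"])
      fix x assume x: "x \<in> ?I"
      have "bounded_linear (fd f u)"
        using uv assms(4) by (intro has_derivative_bounded_linear[OF smooth_on_has_derivative[OF assms(1)]]) auto
      then have "(fd f u has_derivative fd f u) (at x within ?I)"
        by (rule bounded_linear_imp_has_derivative)
      moreover have "(f has_derivative fd f x) (at x within ?I)"
        using x I assms(4) by (intro has_derivative_at_withinI[OF smooth_on_has_derivative[OF assms(1)]]) auto
      ultimately show "((\<lambda>x. f x - fd f u x) has_derivative (\<lambda>w. fd f x w - fd f u w)) (at x within ?I)"
        by (rule has_derivative_diff[rotated])
      show "onorm (\<lambda>w. fd f x w - fd f u w) \<le> C * norm (v - u)"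
      proof (rule onorm_le)
        fix w
        have "norm (fd f x w - fd f u w) \<le> C * norm (x - u) * norm w" using C x I uv by auto
        also have "\<dots> \<le> C * norm (v - u) * norm w"
          using x C(1) by (intro mult_right_mono mult_left_mono)
            (auto simp: norm_minus_commute dest: segment_bound(1))
        finally show "norm (fd f x w - fd f u w) \<le> C * norm (v - u) * norm w" .
      qed
    qed auto
    moreover have "fd f u (v - u) = fd f u v - fd f u u"
      using smooth_on_linear_fd[OF assms(1)] uv assms(4) linear_diff by blast
    moreover have "f v - f u - (fd f u v - fd f u u) = (f v - fd f u v) - (f u - fd f u u)" by simp
    ultimately show "norm (f v - f u - fd f u (v - u)) \<le> C * norm (v - u) ^ 2"
      by (simp only: power2_eq_square mult.assoc)
  qed
qed

text \<open>The squared norm is used because the norm itself is not differentiable at zero. The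
  summand \<open>e\<^sup>2\<close> in \<open>g\<close> absorbs the inhomogeneity through
  \<open>2 * norm (D s) * e \<le> (norm (D s))\<^sup>2 + e\<^sup>2\<close>; this costs the extra 1
  in \<open>k = 2 * C + 1\<close> and makes \<open>g\<close> nonincreasing. With
  \<open>e = 0\<close> the lemma says that \<open>D\<close> vanishes.\<close>

lemma gronwall_from_zero:
  fixes D :: "real \<Rightarrow> 'a::real_inner"
  assumes C: "C \<ge> 0" and e: "e \<ge> 0"
    and D: "\<And>t. t \<in> {0..1} \<Longrightarrow> (D has_vector_derivative D' t) (at t within {0..1})"
    and bound: "\<And>t. t \<in> {0..1} \<Longrightarrow> norm (D' t) \<le> C * norm (D t) + e"
    and "D 0 = 0" and t: "t \<in> {0..1}"
  shows "norm (D t) \<le> e * exp (2 * C + 1)"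
proof -
  define k where "k = 2 * C + 1"
  define g where "g s = (D s \<bullet> D s + e\<^sup>2) * exp (- k * s)" for s
  have cont: "continuous_on {0..1} D"
    using D by (meson continuous_on_vector_derivative)
  have "g t \<le> g 0"
  proof (rule DERIV_nonpos_imp_decreasing_open[of 0 t g])
    show "0 \<le> t" using t by simp
    show "continuous_on {0..t} g" unfolding g_def
      using t by (intro continuous_intros continuous_on_subset[OF cont]) auto
    fix s assume s: "0 < s" "s < t"
    then have s01: "s \<in> {0..1}" "s \<in> {0<..<1}" using t by auto
    have "(D has_vector_derivative D' s) (at s)"
      using D[OF s01(1)] s01(2) at_within_interior[of s "{0..1}"] by simp
    then have dd: "((\<lambda>s. D s \<bullet> D s) has_real_derivative (2 * (D s \<bullet> D' s))) (at s)"
      unfolding has_vector_derivative_def has_field_derivative_def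
      by (auto intro!: derivative_eq_intros simp: fun_eq_iff inner_commute)
    have "(g has_real_derivative
        (2 * (D s \<bullet> D' s)) * exp (- k * s) + (D s \<bullet> D s + e\<^sup>2) * (- k * exp (- k * s))) (at s)"
    proof -
      have e1: "((\<lambda>s. exp (- k * s)) has_real_derivative (- k * exp (- k * s))) (at s)"
        by (auto intro!: derivative_eq_intros)
      have e2: "((\<lambda>s. D s \<bullet> D s + e\<^sup>2) has_real_derivative (2 * (D s \<bullet> D' s))) (at s)"
        using DERIV_add[OF dd DERIV_const[of "e\<^sup>2"]] by simp
      have "g = (\<lambda>s. (D s \<bullet> D s + e\<^sup>2) * exp (- k * s))" unfolding g_def ..
      then show ?thesis using DERIV_mult[OF e2 e1] by (simp add: mult.commute add.commute)
    qed
    moreover have "(2 * (D s \<bullet> D' s)) * exp (- k * s) + (D s \<bullet> D s + e\<^sup>2) * (- k * exp (- k * s)) \<le> 0"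
    proof -
      have "2 * (D s \<bullet> D' s) \<le> 2 * (norm (D s) * norm (D' s))"
        using norm_cauchy_schwarz by simp
      also have "\<dots> \<le> 2 * (norm (D s) * (C * norm (D s) + e))"
        using bound[OF s01(1)] by (intro mult_left_mono) auto
      also have "\<dots> = 2 * C * (norm (D s))\<^sup>2 + 2 * (norm (D s) * e)"
        by (simp add: power2_eq_square algebra_simps)
      also have "\<dots> \<le> 2 * C * (norm (D s))\<^sup>2 + ((norm (D s))\<^sup>2 + e\<^sup>2)"
        using sum_squares_bound[of "norm (D s)" e] by simp
      also have "\<dots> = k * (D s \<bullet> D s) + e\<^sup>2"
        by (simp add: k_def algebra_simps power2_norm_eq_inner)
      also have "\<dots> \<le> k * (D s \<bullet> D s + e\<^sup>2)"
        using C by (simp add: k_def algebra_simps)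
      finally have "(2 * (D s \<bullet> D' s) - k * (D s \<bullet> D s + e\<^sup>2)) * exp (- k * s) \<le> 0"
        by (intro mult_nonpos_nonneg) auto
      then show ?thesis by (simp add: algebra_simps)
    qed
    ultimately show "\<exists>y. (g has_real_derivative y) (at s) \<and> y \<le> 0" by blast
  qed
  then have "(D t \<bullet> D t + e\<^sup>2) * exp (- (k * t)) \<le> e\<^sup>2" using assms(5) by (simp add: g_def)
  then have "D t \<bullet> D t + e\<^sup>2 \<le> e\<^sup>2 * exp (k * t)" by (simp add: exp_minus field_simps)
  \<comment> \<open>Replacing \<open>k * t\<close> by the generous bound \<open>2 * k\<close> turns
    the right side into a perfect square, so that the square root can be taken.\<close>
  also have "\<dots> \<le> e\<^sup>2 * exp (2 * k)"
  proof -
    have "k * t \<le> k * 2" using t C by (intro mult_left_mono) (auto simp: k_def)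
    then show ?thesis by (intro mult_left_mono) auto
  qed
  also have "\<dots> = (e * exp k)\<^sup>2" by (simp add: power_mult_distrib exp_double)
  finally have "D t \<bullet> D t + e\<^sup>2 \<le> (e * exp k)\<^sup>2" .
  then have "(norm (D t))\<^sup>2 \<le> (e * exp k)\<^sup>2"
    using zero_le_power2[of e] unfolding power2_norm_eq_inner[of "D t"] by linarith
  then have "norm (D t) \<le> e * exp k" by (rule power2_le_imp_le) (use e in simp)
  then show ?thesis unfolding k_def .
qed

section \<open>Diffeomorphisms and the smooth inverse function theorem\<close>

definition diffeo :: "(real ^ 'n) set \<Rightarrow> (real ^ 'n) set \<Rightarrow>
    (real ^ 'n \<Rightarrow> real ^ 'n) \<Rightarrow> (real ^ 'n \<Rightarrow> real ^ 'n) \<Rightarrow> bool" where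
  "diffeo U V f g \<longleftrightarrow> open U \<and> open V \<and> smooth_on U f \<and> smooth_on V g \<and> f ` U = V \<and> g ` V = U \<and>
     (\<forall>u\<in>U. g (f u) = u) \<and> (\<forall>v\<in>V. f (g v) = v)"

lemma diffeo_sym: "diffeo U V f g \<Longrightarrow> diffeo V U g f"
  by (auto simp: diffeo_def)

lemma diffeo_restrict:
  assumes "diffeo U V f g" "open U'" "U' \<subseteq> U"
  shows "diffeo U' (f ` U') f g"
proof -
  have "f ` U' = V \<inter> g -` U'"
  proof
    show "f ` U' \<subseteq> V \<inter> g -` U'" using assms unfolding diffeo_def by auto
    show "V \<inter> g -` U' \<subseteq> f ` U'"
    proof
      fix v assume "v \<in> V \<inter> g -` U'"
      then have "f (g v) = v" "g v \<in> U'" using assms unfolding diffeo_def by auto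
      then show "v \<in> f ` U'" by (metis imageI)
    qed
  qed
  moreover have "continuous_on V g" using assms smooth_on_continuous unfolding diffeo_def by blast
  ultimately have "open (f ` U')"
    using assms continuous_open_preimage[of V g U'] unfolding diffeo_def by auto
  moreover have "g ` f ` U' = U'"
  proof -
    have "g (f u) = u" if "u \<in> U'" for u using that assms unfolding diffeo_def by auto
    then show ?thesis unfolding image_image by simp
  qed
  moreover have "f ` U' \<subseteq> V" using assms unfolding diffeo_def by auto
  ultimately show ?thesis
    using assms smooth_on_subset[of U f U'] smooth_on_subset[of V g "f ` U'"]
    unfolding diffeo_def by (simp add: subset_iff)
qed

lemma matrix_works_linear: "linear f \<Longrightarrow> matrix f *v x = f (x :: real ^ 'n)"
  by (simp add: matrix_works)

lemma smooth_on_matrix_fd: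
  fixes f :: "real ^ 'n \<Rightarrow> real ^ 'm"
  assumes "open S" "smooth_on S f"
  shows "smooth_on S (\<lambda>x. matrix (fd f x))"
  unfolding matrix_def using assms by (intro smooth_intros smooth_on_fd_dir) auto

text \<open>The inverse function theorem for continuously differentiable maps provides
  \<open>g\<close> and its derivative. The formula \<open>fdg\<close> expresses
  \<open>fd g y\<close> by a smooth function of \<open>g y\<close>, so \<open>k\<close>-fold
  differentiability of \<open>g\<close> passes to its derivative by composition, and induction gives
  smoothness.\<close>

lemma smooth_inverse_function:
  fixes f :: "real ^ 'n \<Rightarrow> real ^ 'n"
  assumes "smooth_on U f" "open U" "x0 \<in> U" "\<And>v. fd f x0 v = 0 \<Longrightarrow> v = 0"
  obtains U' V g where "U' \<subseteq> U" "x0 \<in> U'" "diffeo U' V f g"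
proof -
  define f' where "f' x = Blinfun (fd f x)" for x
  have f': "blinfun_apply (f' x) = fd f x" if "x \<in> U" for x
    unfolding f'_def using smooth_on_has_derivative[OF assms(1) that]
    by (intro bounded_linear_Blinfun_apply has_derivative_bounded_linear)
  have lin: "linear (fd f x)" if "x \<in> U" for x
    using smooth_on_linear_fd[OF assms(1) that] .
  have "inj (fd f x0)" using lin[OF assms(3)] assms(4) by (simp add: linear_injective_0)
  then obtain g0 where g0: "linear g0" "g0 \<circ> fd f x0 = id"
    using linear_injective_left_inverse lin[OF assms(3)] by blast
  have inv: "Blinfun g0 o\<^sub>L f' x0 = id_blinfun"
  proof (rule blinfun_eqI)
    fix v
    have "blinfun_apply (Blinfun g0) = g0"
      using g0(1) by (intro bounded_linear_Blinfun_apply) (simp add: linear_conv_bounded_linear)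
    then show "blinfun_apply (Blinfun g0 o\<^sub>L f' x0) v = blinfun_apply id_blinfun v"
      using f'[OF assms(3)] g0(2) by (simp add: fun_eq_iff)
  qed
  have cont: "continuous_on U f'"
  proof (rule continuous_on_blinfun_componentwise)
    fix i :: "real ^ 'n" assume "i \<in> Basis"
    show "continuous_on U (\<lambda>x. blinfun_apply (f' x) i)"
      using smooth_on_continuous[OF smooth_on_fd_dir[OF assms(1), of i]] f'
      by (simp cong: continuous_on_cong)
  qed
  have der: "(f has_derivative blinfun_apply (f' x)) (at x)" if "x \<in> U" for x
    using smooth_on_has_derivative[OF assms(1) that] f'[OF that] by simp
  obtain U' V g g' where *: "open U'" "U' \<subseteq> U" "x0 \<in> U'" "open V" "f x0 \<in> V" "homeomorphism U' V f g"
    "\<And>y. y \<in> V \<Longrightarrow> (g has_derivative (g' y)) (at y)"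
    "\<And>y. y \<in> V \<Longrightarrow> g' y = inv (blinfun_apply (f'(g y)))"
    "\<And>y. y \<in> V \<Longrightarrow> bij (blinfun_apply (f'(g y)))"
    by (rule inverse_function_theorem[OF assms(2) der cont assms(3) inv], assumption) (rule that)
  have h: "f ` U' = V" "g ` V = U'" "\<And>u. u \<in> U' \<Longrightarrow> g (f u) = u" "\<And>v. v \<in> V \<Longrightarrow> f (g v) = v"
    using *(6) by (auto simp: homeomorphism_def)
  have bij: "bij (fd f x)" if "x \<in> U'" for x
  proof -
    have "f x \<in> V" using h(1) that by blast
    from *(9)[OF this] show ?thesis using h(3)[OF that] f'[of x] that *(2) by auto
  qed
  have det: "det (matrix (fd f x)) \<noteq> 0" if "x \<in> U'" for x
  proof -
    have "(*v) (matrix (fd f x)) = fd f x"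
      using lin that *(2) by (intro ext matrix_works_linear) auto
    moreover have "linear (fd f x)" using lin that *(2) by auto
    ultimately show ?thesis using bij[OF that] det_nz_iff_inj[of "fd f x"] bij_is_inj by auto
  qed
  have fdg: "fd g y v = matrix_inv (matrix (fd f (g y))) *v v" if "y \<in> V" for y v
  proof -
    have gy: "g y \<in> U'" using that h by auto
    let ?A = "matrix (fd f (g y))"
    have "fd g y v = inv (fd f (g y)) v"
      using fd_eq[OF *(7)[OF that]] *(8)[OF that] f' gy *(2) by auto
    moreover have "fd f (g y) (matrix_inv ?A *v v) = v"
      using matrix_works_linear[OF lin, of "g y" "matrix_inv ?A *v v"] gy *(2)
        matrix_inv_eq(1)[OF det[OF gy]] by (auto simp: matrix_vector_mul_assoc)
    ultimately show ?thesis using bij[OF gy] by (metis bij_is_inj inv_f_f)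
  qed
  have "times_differentiable_on k V g" for k
  proof (induction k)
    case 0
    then show ?case using *(6) by (simp add: homeomorphism_def)
  next
    case (Suc k)
    have "times_differentiable_on k V (\<lambda>y. fd g y v)" for v
    proof (rule times_differentiable_on_cong[OF *(4)])
      have "smooth_on U' (\<lambda>x. matrix_inv (matrix (fd f x)) *v v)"
        unfolding matrix_vector_mult_def using *(1,2) det
        by (intro smooth_intros smooth_on_matrix_fd smooth_on_subset[OF assms(1)]) auto
      then show "times_differentiable_on k V (\<lambda>y. matrix_inv (matrix (fd f (g y))) *v v)"
        using times_differentiable_on_compose[OF *(4) Suc] h(2) unfolding smooth_on_def by blast
    qed (use fdg in auto)
    then show ?case using *(7) by (auto simp: differentiable_def)
  qed
  then have "diffeo U' V f g"
    unfolding diffeo_def using *(1,2,4) h smooth_on_subset[OF assms(1), of U'] by (simp add: smooth_on_def)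
  then show thesis using that *(2,3) by blast
qed

section \<open>Integrals with a parameter and bump functions\<close>

text \<open>Differentiation under the integral replaces \<open>F\<close> by its derivative along the
  fixed vector \<open>(0, v)\<close>, which is smooth on the same set \<open>T\<close>. The
  integrand therefore stays in the class over which the induction generalizes.\<close>

lemma smooth_on_integral_param:
  fixes F :: "real \<times> 'a::euclidean_space \<Rightarrow> 'b::banach"
  assumes "smooth_on T F" "open S" "\<And>t z. t \<in> {0..1} \<Longrightarrow> z \<in> S \<Longrightarrow> (t, z) \<in> T"
  shows "smooth_on S (\<lambda>z. integral {0..1} (\<lambda>t. F (t, z)))"
    and "z \<in> S \<Longrightarrow> fd (\<lambda>z. integral {0..1} (\<lambda>t. F (t, z))) z v =
            integral {0..1} (\<lambda>t. fd F (t, z) (0, v))"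
proof -
  have contp: "continuous_on (S \<times> cbox 0 1) (\<lambda>(z, t). G (t, z))" if "smooth_on T G"
    for G :: "real \<times> 'a \<Rightarrow> 'b"
    unfolding split_beta
    by (intro continuous_on_compose2[OF smooth_on_continuous[OF that]] continuous_intros)
       (use assms(3) in auto)
  have contt: "continuous_on {0..1} (\<lambda>t. G (t, z))" if "smooth_on T G" "z \<in> S"
    for G :: "real \<times> 'a \<Rightarrow> 'b" and z
    by (intro continuous_on_compose2[OF smooth_on_continuous[OF that(1)]] continuous_intros)
       (use assms(3) that in auto)
  have deriv: "((\<lambda>z. integral {0..1} (\<lambda>t. G (t, z))) has_derivative
      (\<lambda>v. integral {0..1} (\<lambda>t. fd G (t, z) (0, v)))) (at z)"
    if G: "smooth_on T G" and z: "z \<in> S" for G :: "real \<times> 'a \<Rightarrow> 'b" and z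
  proof -
    \<comment> \<open>\<open>leibniz_rule\<close> works on a convex parameter set, so the derivative
      at \<open>z\<close> is computed within a ball and then freed from the restriction.\<close>
    obtain e where e: "e > 0" "ball z e \<subseteq> S" using assms(2) z openE by blast
    define fx where "fx x t = Blinfun (\<lambda>v. fd G (t, x) (0, v))" for x t
    have comp: "((\<lambda>x. G (t, x)) has_derivative (\<lambda>v. fd G (t, x) (0, v))) (at x)"
      if "x \<in> S" "t \<in> {0..1}" for x t
      by (rule has_derivative_compose[of "\<lambda>x. (t, x)" "\<lambda>v. (0, v)" x UNIV G])
         (auto intro!: derivative_eq_intros smooth_on_has_derivative[OF G] assms(3) that)
    have fx: "blinfun_apply (fx x t) = (\<lambda>v. fd G (t, x) (0, v))" if "x \<in> S" "t \<in> {0..1}" for x t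
      unfolding fx_def
      by (rule bounded_linear_Blinfun_apply) (rule has_derivative_bounded_linear[OF comp[OF that]])
    have cfx: "continuous_on (S \<times> cbox 0 1) (\<lambda>(x, t). fx x t)"
      unfolding split_beta
    proof (rule continuous_on_blinfun_componentwise)
      fix i :: 'a assume "i \<in> Basis"
      have "continuous_on (S \<times> cbox 0 1) (\<lambda>p. fd G (snd p, fst p) (0, i))"
        using contp[OF smooth_on_fd_dir[OF G, of "(0, i)"]] by (simp add: split_beta)
      then show "continuous_on (S \<times> cbox 0 1) (\<lambda>p. blinfun_apply (fx (fst p) (snd p)) i)"
        by (rule continuous_on_cong[THEN iffD1, rotated -1]) (auto simp: fx)
    qed
    have "((\<lambda>x. integral (cbox 0 1) (\<lambda>t. G (t, x))) has_derivative
        blinfun_apply (integral (cbox 0 1) (fx z))) (at z within ball z e)"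
    proof (rule leibniz_rule)
      show "((\<lambda>x. G (t, x)) has_derivative blinfun_apply (fx x t)) (at x within ball z e)"
        if "x \<in> ball z e" "t \<in> cbox 0 1" for x t
        using that e fx comp by (metis box_real(2) has_derivative_at_withinI subsetD)
      show "(\<lambda>t. G (t, x)) integrable_on cbox 0 1" if "x \<in> ball z e" for x
        using that e contt[OF G] by (auto intro!: integrable_continuous_interval)
      show "continuous_on (ball z e \<times> cbox 0 1) (\<lambda>(x, t). fx x t)"
        using e by (intro continuous_on_subset[OF cfx]) auto
    qed (use e in auto)
    moreover have "blinfun_apply (integral (cbox 0 1) (fx z)) v =
        integral {0..1} (\<lambda>t. fd G (t, z) (0, v))" for v
    proof -
      have "continuous_on {0..1} (fx z)"
      proof -
        have "continuous_on {0..1} (\<lambda>t. (z, t))" by (intro continuous_intros)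
        from continuous_on_compose2[OF cfx this] show ?thesis using z by auto
      qed
      then have "fx z integrable_on {0..1}" by (rule integrable_continuous_interval)
      from integral_linear[OF this blinfun.bounded_linear_left[of v]]
      have "blinfun_apply (integral {0..1} (fx z)) v = integral {0..1} (\<lambda>t. blinfun_apply (fx z t) v)"
        by (simp add: o_def)
      also have "\<dots> = integral {0..1} (\<lambda>t. fd G (t, z) (0, v))"
        by (rule integral_cong) (simp add: fx[OF z])
      finally show ?thesis by simp
    qed
    then have "blinfun_apply (integral (cbox 0 1) (fx z)) =
        (\<lambda>v. integral {0..1} (\<lambda>t. fd G (t, z) (0, v)))" by (rule ext)
    ultimately show ?thesis
      using e(1) at_within_open[of z "ball z e"] by simp
  qed
  have "times_differentiable_on k S (\<lambda>z. integral {0..1} (\<lambda>t. G (t, z)))" if "smooth_on T G"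
    for k and G :: "real \<times> 'a \<Rightarrow> 'b"
    using that
  proof (induction k arbitrary: G)
    case 0
    then show ?case
      using integral_continuous_on_param[of S 0 1 "\<lambda>z t. G (t, z)"] contp by simp
  next
    case (Suc k)
    have "times_differentiable_on k S (\<lambda>z. fd (\<lambda>z. integral {0..1} (\<lambda>t. G (t, z))) z v)" for v
      by (rule times_differentiable_on_cong[OF assms(2) _ Suc.IH[OF smooth_on_fd_dir[OF Suc.prems]]])
         (use fd_eq[OF deriv[OF Suc.prems]] in simp)
    then show ?case using deriv[OF Suc.prems] by (auto simp: differentiable_def)
  qed
  then show "smooth_on S (\<lambda>z. integral {0..1} (\<lambda>t. F (t, z)))"
    using assms(1) unfolding smooth_on_def by blast
  show "z \<in> S \<Longrightarrow> fd (\<lambda>z. integral {0..1} (\<lambda>t. F (t, z))) z v =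
      integral {0..1} (\<lambda>t. fd F (t, z) (0, v))"
    using fd_eq[OF deriv[OF assms(1)]] by simp
qed

section \<open>The Poincare lemma in some of the coordinates\<close>

definition coord_proj :: "'n set \<Rightarrow> real ^ 'n \<Rightarrow> real ^ 'n" where
  "coord_proj I z = (\<chi> i. if i \<in> I then z $ i else 0)"

lemma linear_coord_proj: "linear (coord_proj I)"
  by (intro linearI) (auto simp: coord_proj_def vec_eq_iff)

lemma bounded_linear_coord_proj: "bounded_linear (coord_proj I :: real ^ 'n \<Rightarrow> _)"
  using linear_coord_proj linear_conv_bounded_linear by blast

lemma coord_proj_axis: "coord_proj I (axis i 1) = (if i \<in> I then axis i 1 else 0)"
  by (auto simp: coord_proj_def vec_eq_iff axis_def)

lemma vec_eq_sum_axis_real: "(v :: real ^ 'n) = (\<Sum>i\<in>UNIV. v $ i *\<^sub>R axis i 1)"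
  by (simp add: vec_eq_iff axis_def if_distrib[of "\<lambda>x. _ * x"] cong: if_cong)

lemma coord_proj_eq_sum: "coord_proj I z = (\<Sum>i\<in>I. z $ i *\<^sub>R axis i 1)"
proof -
  have "coord_proj I z = (\<Sum>i\<in>UNIV. (if i \<in> I then z $ i *\<^sub>R axis i 1 else 0))"
    by (rule trans[OF vec_eq_sum_axis_real]) (auto simp: coord_proj_def intro: sum.cong)
  then show ?thesis by (simp add: sum.If_cases)
qed

text \<open>The homotopy \<open>\<sigma>\<close> scales the coordinates in \<open>I\<close> by
  \<open>t\<close> and fixes the others, which act as parameters; closedness is therefore used for
  indices in \<open>I\<close> only. Since no coordinate grows in absolute value,
  \<open>\<sigma>\<close> stays in the ball.\<close>

lemma partial_poincare:
  fixes \<omega> :: "'n::finite \<Rightarrow> real ^ 'n \<Rightarrow> real"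
  assumes smooth: "\<And>i. i \<in> I \<Longrightarrow> smooth_on (ball 0 \<rho>) (\<omega> i)"
    and closed: "\<And>i j z. i \<in> I \<Longrightarrow> j \<in> I \<Longrightarrow> z \<in> ball 0 \<rho> \<Longrightarrow>
        fd (\<omega> i) z (axis j 1) = fd (\<omega> j) z (axis i 1)"
  obtains F where "smooth_on (ball 0 \<rho>) F"
    "\<And>j z. j \<in> I \<Longrightarrow> z \<in> ball 0 \<rho> \<Longrightarrow> fd F z (axis j 1) = \<omega> j z"
proof -
  let ?B = "ball (0 :: real ^ 'n) \<rho>"
  define \<sigma> :: "real \<times> (real ^ 'n) \<Rightarrow> real ^ 'n" where
    "\<sigma> p = snd p + (fst p - 1) *\<^sub>R coord_proj I (snd p)" for p
  define T where "T = \<sigma> -` ?B"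
  have \<sigma>_smooth: "smooth_on S \<sigma>" if "open S" for S
    unfolding \<sigma>_def[abs_def] using that
    by (intro smooth_intros smooth_on_bounded_linear[OF bounded_linear_coord_proj]
          smooth_on_linear[OF bounded_linear_fst] smooth_on_linear[OF bounded_linear_snd])
  have "continuous_on UNIV \<sigma>" using smooth_on_continuous[OF \<sigma>_smooth[OF open_UNIV]] .
  then have T: "open T" unfolding T_def by (simp add: open_vimage)
  have \<sigma>_norm: "norm (\<sigma> (t, z)) \<le> norm z" if "t \<in> {0..1}" for t z
  proof (rule norm_le_componentwise_cart)
    fix i show "norm (\<sigma> (t, z) $ i) \<le> norm (z $ i)"
      using that mult_left_le_one_le[of "\<bar>z $ i\<bar>" "\<bar>t\<bar>"]
      by (auto simp: \<sigma>_def coord_proj_def algebra_simps abs_mult)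
  qed
  have in_T: "(t, z) \<in> T" if "t \<in> {0..1}" "z \<in> ?B" for t z
    using \<sigma>_norm[OF that(1), of z] that(2) by (auto simp: T_def)
  \<comment> \<open>This is the form contracted with the \<open>I\<close>-part of \<open>z\<close>,
    which is the velocity of the path \<open>t \<mapsto> \<sigma> (t, z)\<close>; its integral over
    the path is the candidate potential.\<close>
  define G where "G p = (\<Sum>i\<in>I. snd p $ i * \<omega> i (\<sigma> p))" for p
  have \<omega>\<sigma>: "smooth_on T (\<lambda>p. \<omega> i (\<sigma> p))" if "i \<in> I" for i
    using T by (intro smooth_on_compose[OF smooth[OF that]] \<sigma>_smooth) (auto simp: T_def)
  have G: "smooth_on T G"
    unfolding G_def[abs_def] using T \<omega>\<sigma>
    by (intro smooth_intros smooth_on_linear[OF bounded_linear_snd]) auto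
  define F where "F z = integral {0..1} (\<lambda>t. G (t, z))" for z
  have "smooth_on ?B F"
    unfolding F_def[abs_def] by (rule smooth_on_integral_param(1)[OF G]) (use in_T in auto)
  moreover have "fd F z (axis j 1) = \<omega> j z" if j: "j \<in> I" and z: "z \<in> ?B" for j z
  proof -
    have d\<sigma>: "(\<sigma> has_derivative (\<lambda>v. snd v + (fst p - 1) *\<^sub>R coord_proj I (snd v)
        + fst v *\<^sub>R coord_proj I (snd p))) (at p)" for p
      unfolding \<sigma>_def[abs_def]
      by (auto intro!: derivative_eq_intros bounded_linear.has_derivative[OF bounded_linear_coord_proj])
    have d\<omega>: "(\<omega> i has_derivative fd (\<omega> i) (\<sigma> p)) (at (\<sigma> p))" if "p \<in> T" "i \<in> I" for p i
      using that by (intro smooth_on_has_derivative[OF smooth]) (auto simp: T_def)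
    have d\<omega>\<sigma>: "((\<lambda>p. \<omega> i (\<sigma> p)) has_derivative (\<lambda>v. fd (\<omega> i) (\<sigma> p) (snd v
        + (fst p - 1) *\<^sub>R coord_proj I (snd v) + fst v *\<^sub>R coord_proj I (snd p)))) (at p)"
      if "p \<in> T" "i \<in> I" for p i
      using has_derivative_compose[OF d\<sigma> d\<omega>[OF that]] by simp
    have dG: "fd G (t, z) (0, axis j 1) = \<omega> j (\<sigma> (t, z)) + t * fd (\<omega> j) (\<sigma> (t, z)) (coord_proj I z)"
      if t: "t \<in> {0..1}" for t
    proof -
      let ?s = "\<sigma> (t, z)"
      have sB: "?s \<in> ?B" using in_T[OF t z] by (simp add: T_def)
      have "(G has_derivative (\<lambda>v. \<Sum>i\<in>I. snd (t, z) $ i * fd (\<omega> i) ?s (snd v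
          + (fst (t, z) - 1) *\<^sub>R coord_proj I (snd v) + fst v *\<^sub>R coord_proj I (snd (t, z)))
          + snd v $ i * \<omega> i ?s)) (at (t, z))"
        unfolding G_def[abs_def]
        by (intro has_derivative_sum has_derivative_mult d\<omega>\<sigma> in_T t z
              bounded_linear_imp_has_derivative
              bounded_linear_compose[OF bounded_linear_vec_nth bounded_linear_snd])
      from fd_eq[OF this]
      have "fd G (t, z) (0, axis j 1) = (\<Sum>i\<in>I. z $ i * fd (\<omega> i) ?s (axis j 1
          + (t - 1) *\<^sub>R coord_proj I (axis j 1)) + axis j 1 $ i * \<omega> i ?s)"
        by simp
      also have "axis j 1 + (t - 1) *\<^sub>R coord_proj I (axis j 1) = t *\<^sub>R axis j (1::real)"
        using j by (simp add: coord_proj_axis algebra_simps)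
      also have "(\<Sum>i\<in>I. z $ i * fd (\<omega> i) ?s (t *\<^sub>R axis j 1) + axis j 1 $ i * \<omega> i ?s) =
          (\<Sum>i\<in>I. t * (z $ i * fd (\<omega> j) ?s (axis i 1))) + (\<Sum>i\<in>I. axis j 1 $ i * \<omega> i ?s)"
        unfolding sum.distrib[symmetric]
      proof (rule sum.cong[OF refl])
        fix i assume i: "i \<in> I"
        have "fd (\<omega> i) ?s (t *\<^sub>R axis j 1) = t * fd (\<omega> i) ?s (axis j 1)"
          using linear_scale[OF smooth_on_linear_fd[OF smooth[OF i] sB]] by simp
        then show "z $ i * fd (\<omega> i) ?s (t *\<^sub>R axis j 1) + axis j 1 $ i * \<omega> i ?s =
            t * (z $ i * fd (\<omega> j) ?s (axis i 1)) + axis j 1 $ i * \<omega> i ?s"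
          using closed[OF i j sB] by simp
      qed
      also have "(\<Sum>i\<in>I. axis j 1 $ i * \<omega> i ?s) = \<omega> j ?s"
        using j by (simp add: axis_def if_distrib[of "\<lambda>x. x * _"] cong: if_cong)
      also have "(\<Sum>i\<in>I. t * (z $ i * fd (\<omega> j) ?s (axis i 1))) = t * fd (\<omega> j) ?s (coord_proj I z)"
        unfolding coord_proj_eq_sum
        by (simp add: linear_sum[OF smooth_on_linear_fd[OF smooth[OF j] sB]]
            linear_scale[OF smooth_on_linear_fd[OF smooth[OF j] sB]] sum_distrib_left)
      finally show ?thesis by simp
    qed
    have "fd F z (axis j 1) = integral {0..1} (\<lambda>t. fd G (t, z) (0, axis j 1))"
      unfolding F_def[abs_def] by (rule smooth_on_integral_param(2)[OF G open_ball[of 0 \<rho>]]) (use in_T z in auto)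
    also have "\<dots> = integral {0..1} (\<lambda>t. \<omega> j (\<sigma> (t, z)) + t * fd (\<omega> j) (\<sigma> (t, z)) (coord_proj I z))"
      by (rule integral_cong) (rule dG)
    \<comment> \<open>After closedness has exchanged the indices, the integrand is the
      \<open>t\<close>-derivative of \<open>t * \<omega> j (\<sigma> (t, z))\<close>.\<close>
    also have "\<dots> = 1 * \<omega> j (\<sigma> (1, z)) - 0 * \<omega> j (\<sigma> (0, z))"
    proof (rule integral_unique, rule fundamental_theorem_of_calculus)
      fix t :: real assume t: "t \<in> {0..1}"
      let ?s = "\<sigma> (t, z)"
      have "((\<lambda>t. (t, z)) has_derivative (\<lambda>h. (h, 0))) (at t within {0..1})"
        by (auto intro!: derivative_eq_intros)
      from has_derivative_compose[OF this d\<omega>\<sigma>[OF in_T[OF t z] j]]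
      have "((\<lambda>t. \<omega> j (\<sigma> (t, z))) has_derivative
          (\<lambda>h. fd (\<omega> j) ?s (h *\<^sub>R coord_proj I z))) (at t within {0..1})"
        using linear_0[OF linear_coord_proj, of I] by simp
      moreover have "fd (\<omega> j) ?s (h *\<^sub>R coord_proj I z) = h *\<^sub>R fd (\<omega> j) ?s (coord_proj I z)" for h
        using linear_scale[OF smooth_on_linear_fd[OF smooth[OF j]], of ?s] in_T[OF t z]
        by (simp add: T_def)
      ultimately have "((\<lambda>t. \<omega> j (\<sigma> (t, z))) has_vector_derivative
          fd (\<omega> j) ?s (coord_proj I z)) (at t within {0..1})"
        unfolding has_vector_derivative_def by simp
      from has_vector_derivative_mult[OF has_vector_derivative_id this]
      show "((\<lambda>t. t * \<omega> j (\<sigma> (t, z))) has_vector_derivative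
          \<omega> j ?s + t * fd (\<omega> j) ?s (coord_proj I z)) (at t within {0..1})"
        by (simp add: add.commute)
    qed simp
    also have "\<dots> = \<omega> j z" by (simp add: \<sigma>_def)
    finally show ?thesis .
  qed
  ultimately show thesis by (rule that)
qed


section \<open>Bump functions\<close>

definition exp_tail :: "real poly \<Rightarrow> real \<Rightarrow> real" where
  "exp_tail P s = (if s > 0 then poly P (inverse s) * exp (- inverse s) else 0)"

lemma exp_tail_tendsto_0: "(exp_tail P \<longlongrightarrow> 0) (at 0)"
proof -
  have "((\<lambda>x. \<Sum>i\<le>degree P. coeff P i * (x ^ i / exp x)) \<longlongrightarrow> (\<Sum>i\<le>degree P. coeff P i * 0)) at_top"
    by (intro tendsto_intros tendsto_power_div_exp_0)
  then have "((\<lambda>x. poly P x * exp (- x)) \<longlongrightarrow> 0) at_top"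
    by (simp add: poly_altdef sum_distrib_right exp_minus divide_inverse mult.assoc)
  from filterlim_compose[OF this filterlim_inverse_at_top_right]
  have r: "((\<lambda>s. poly P (inverse s) * exp (- inverse s)) \<longlongrightarrow> 0) (at_right 0)" .
  have "(exp_tail P \<longlongrightarrow> 0) (at_right 0)"
    by (rule Lim_transform_eventually[OF r])
       (auto simp: eventually_at_filter exp_tail_def)
  moreover have "(exp_tail P \<longlongrightarrow> 0) (at_left 0)"
    by (rule Lim_transform_eventually[OF tendsto_const])
       (auto simp: eventually_at_filter exp_tail_def)
  ultimately show ?thesis by (simp add: filterlim_at_split)
qed

text \<open>With \<open>t = 1/s\<close> one has \<open>d/ds = - t\<^sup>2 d/dt\<close>, so
  differentiating \<open>P(t) exp(- t)\<close> replaces \<open>P\<close> by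
  \<open>t\<^sup>2 (P - P')\<close>. The family over all polynomials is thus closed under
  differentiation, also at the gluing point.\<close>

lemma exp_tail_has_derivative:
  "(exp_tail P has_real_derivative exp_tail ([:0, 0, 1:] * (P - pderiv P)) s) (at s)"
proof (cases s "0 :: real" rule: linorder_cases)
  case less
  have "((\<lambda>s. 0) has_real_derivative 0) (at s)" by simp
  then have "(exp_tail P has_real_derivative 0) (at s)"
    by (rule DERIV_cong_ev[THEN iffD1, rotated -1, OF _ refl _ refl])
       (use eventually_nhds_in_open[of "{..<0}" s] less in \<open>auto elim!: eventually_mono simp: exp_tail_def\<close>)
  then show ?thesis using less by (simp add: exp_tail_def)
next
  case equal
  \<comment> \<open>The difference quotient at 0 is itself a member of the family, for the
    polynomial \<open>t P(t)\<close>, and every member tends to 0 there.\<close>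
  have "((\<lambda>h. (exp_tail P (0 + h) - exp_tail P 0) / h) \<longlongrightarrow> 0) (at 0)"
    by (rule Lim_transform_eventually[OF exp_tail_tendsto_0[of "[:0, 1:] * P"]])
       (auto simp: exp_tail_def eventually_at_filter divide_inverse)
  then have "(exp_tail P has_real_derivative 0) (at 0)" by (simp add: DERIV_def)
  then show ?thesis using equal by (simp add: exp_tail_def)
next
  case greater
  have "((\<lambda>s. poly P (inverse s) * exp (- inverse s)) has_real_derivative
      exp_tail ([:0, 0, 1:] * (P - pderiv P)) s) (at s)"
    using greater
    by (auto intro!: derivative_eq_intros DERIV_chain2[OF poly_DERIV] simp: exp_tail_def algebra_simps power2_eq_square)
  then show ?thesis
    by (rule DERIV_cong_ev[THEN iffD1, rotated -1, OF _ refl _ refl])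
       (use eventually_nhds_in_open[of "{0<..}" s] greater in \<open>auto elim!: eventually_mono simp: exp_tail_def\<close>)
qed

lemma smooth_on_exp_tail: "smooth_on S (exp_tail P)"
proof -
  have d: "(exp_tail P has_derivative (\<lambda>v. exp_tail ([:0, 0, 1:] * (P - pderiv P)) s * v)) (at s)" for P s
    using exp_tail_has_derivative by (simp add: has_field_derivative_def)
  have "times_differentiable_on k UNIV (exp_tail P)" for k
  proof (induction k arbitrary: P)
    case 0
    show ?case using exp_tail_has_derivative by (auto intro!: DERIV_continuous_on)
  next
    case (Suc k)
    have "times_differentiable_on k UNIV (\<lambda>s. fd (exp_tail P) s v)" for v
      unfolding fd_eq[OF d]
      by (rule times_differentiable_on_linear[OF bounded_linear_mult_left open_UNIV Suc.IH])
    then show ?case using d by (auto simp: differentiable_def)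
  qed
  then have "smooth_on UNIV (exp_tail P)" by (simp add: smooth_on_def)
  then show ?thesis by (rule smooth_on_subset) simp
qed

lemma smooth_bump:
  fixes u :: "'a::euclidean_space"
  assumes "open U" "u \<in> U"
  obtains \<phi> :: "'a \<Rightarrow> real" and K where "smooth_on UNIV \<phi>" "compact K" "K \<subseteq> U" "\<phi> u = 1"
    "\<And>z. z \<notin> K \<Longrightarrow> \<phi> z = 0"
proof -
  obtain e where e: "e > 0" "cball u e \<subseteq> U" using assms open_contains_cball by blast
  define \<phi> where "\<phi> z = inverse (exp_tail 1 (e\<^sup>2)) * exp_tail 1 (e\<^sup>2 - (z - u) \<bullet> (z - u))" for z
  have "smooth_on UNIV \<phi>"
    unfolding \<phi>_def[abs_def]
    by (intro smooth_intros smooth_on_compose[OF smooth_on_exp_tail[of UNIV]]) auto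
  moreover have "\<phi> u = 1" using e by (simp add: \<phi>_def exp_tail_def)
  moreover have "\<phi> z = 0" if "z \<notin> cball u e" for z
  proof -
    have "e\<^sup>2 \<le> (norm (z - u))\<^sup>2" using that e by (intro power_mono) (auto simp: dist_norm norm_minus_commute)
    then show ?thesis by (simp add: \<phi>_def exp_tail_def power2_norm_eq_inner)
  qed
  ultimately show thesis using e(2) by (intro that[of \<phi> "cball u e"]) auto
qed

section \<open>Integrable linear systems of total differential equations\<close>

text \<open>The bilinear map with coefficients \<open>b i j\<close>. It is used in two roles: as the
  contraction of Christoffel symbols with two vectors, and as the right side of the linear system
  \<open>d\<omega>(v) = B(u; v, \<omega>)\<close>.\<close>

definition bil :: "('i::finite \<Rightarrow> 'j::finite \<Rightarrow> 'c::real_vector) \<Rightarrow> real ^ 'i \<Rightarrow> real ^ 'j \<Rightarrow> 'c" where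
  "bil b v w = (\<Sum>i\<in>UNIV. \<Sum>j\<in>UNIV. (v $ i * w $ j) *\<^sub>R b i j)"

lemma bil_add_left: "bil b (v + v') w = bil b v w + bil b v' w"
  by (simp add: bil_def sum.distrib algebra_simps)

lemma bil_add_right: "bil b v (w + w') = bil b v w + bil b v w'"
  by (simp add: bil_def sum.distrib algebra_simps)

lemma bil_diff_right: "bil b v (w - w') = bil b v w - bil b v w'"
  by (simp add: bil_def sum_subtractf algebra_simps)

lemma bil_diff_coeff: "bil (\<lambda>i j. b i j - c i j) v w = bil b v w - bil c v w"
  by (simp add: bil_def sum_subtractf algebra_simps)

lemma bil_add_coeff: "bil (\<lambda>i j. b i j + c i j) v w = bil b v w + bil c v w"
  by (simp add: bil_def sum.distrib algebra_simps)

lemma bil_scale_left: "bil b (t *\<^sub>R v) w = t *\<^sub>R bil b v w"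
  by (simp add: bil_def scaleR_sum_right mult_ac)

lemma bil_scale_right: "bil b v (t *\<^sub>R w) = t *\<^sub>R bil b v w"
  by (simp add: bil_def scaleR_sum_right mult_ac)

lemma bil_scale_coeff: "bil (\<lambda>i j. t *\<^sub>R b i j) v w = t *\<^sub>R bil b v w"
  by (simp add: bil_def scaleR_sum_right mult_ac)

lemma bil_axis: "bil b (axis i 1) (axis j 1) = b i j"
proof -
  have "bil b (axis i 1) (axis j 1) = (\<Sum>i'\<in>UNIV. if i' = i then b i' j else 0)"
    unfolding bil_def
    by (intro sum.cong refl) (simp add: axis_def if_distrib[of "\<lambda>x. x *\<^sub>R _"] if_distrib[of "\<lambda>x. _ * x"] cong: if_cong)
  then show ?thesis by simp
qed

lemma norm_bil:
  fixes b :: "'i::finite \<Rightarrow> 'j::finite \<Rightarrow> 'c::real_normed_vector"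
  assumes "\<And>i j. norm (b i j) \<le> c"
  shows "norm (bil b v w) \<le> (real CARD('i) * real CARD('j) * c) * norm v * norm w"
proof -
  have "norm (bil b v w) \<le> (\<Sum>i::'i\<in>UNIV. \<Sum>j::'j\<in>UNIV. norm v * norm w * c)"
    unfolding bil_def
  proof (intro order_trans[OF norm_sum] sum_mono)
    fix i j
    have "norm ((v $ i * w $ j) *\<^sub>R b i j) = \<bar>v $ i\<bar> * \<bar>w $ j\<bar> * norm (b i j)" by (simp add: abs_mult)
    also have "\<dots> \<le> norm v * norm w * c"
      using assms by (intro mult_mono component_le_norm_cart) auto
    finally show "norm ((v $ i * w $ j) *\<^sub>R b i j) \<le> norm v * norm w * c" .
  qed
  then show ?thesis by (simp add: mult_ac)
qed

lemma smooth_on_bil [smooth_intros]: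
  assumes "open S" "\<And>i j. smooth_on S (b i j)" "smooth_on S v" "smooth_on S w"
  shows "smooth_on S (\<lambda>u. bil (\<lambda>i j. b i j u) (v u) (w u))"
  unfolding bil_def using assms by (intro smooth_intros) auto

lemma has_derivative_bil:
  assumes "\<And>i j. (b i j has_derivative b' i j) (at u within S)"
    and "(v has_derivative v') (at u within S)" "(w has_derivative w') (at u within S)"
  shows "((\<lambda>u. bil (\<lambda>i j. b i j u) (v u) (w u)) has_derivative
    (\<lambda>z. bil (\<lambda>i j. b' i j z) (v u) (w u) + bil (\<lambda>i j. b i j u) (v' z) (w u)
       + bil (\<lambda>i j. b i j u) (v u) (w' z))) (at u within S)"
proof -
  have n: "((\<lambda>u. v u $ i) has_derivative (\<lambda>z. v' z $ i)) (at u within S)"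
    "((\<lambda>u. w u $ j) has_derivative (\<lambda>z. w' z $ j)) (at u within S)" for i j
    using assms(2,3) by (auto intro: bounded_linear.has_derivative[OF bounded_linear_vec_nth])
  have "((\<lambda>u. bil (\<lambda>i j. b i j u) (v u) (w u)) has_derivative (\<lambda>z. \<Sum>i\<in>UNIV. \<Sum>j\<in>UNIV.
      (v u $ i * w u $ j) *\<^sub>R b' i j z + (v u $ i * w' z $ j + v' z $ i * w u $ j) *\<^sub>R b i j u)) (at u within S)"
    unfolding bil_def by (intro has_derivative_sum has_derivative_scaleR has_derivative_mult n assms(1))
  then show ?thesis by (simp add: bil_def sum.distrib algebra_simps)
qed

lemma has_derivative_quadratic:
  fixes f :: "'a::real_normed_vector \<Rightarrow> 'b::real_normed_vector"
  assumes "bounded_linear L" "\<delta> > 0"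
    and "\<And>v. norm v < \<delta> \<Longrightarrow> norm (f (u + v) - f u - L v) \<le> C * norm v ^ 2"
  shows "(f has_derivative L) (at u)"
proof (rule has_derivativeI[OF assms(1)])
  have "((\<lambda>y. C * norm (y - u)) \<longlongrightarrow> C * norm (u - u)) (at u)" by (intro tendsto_intros)
  then have lim: "((\<lambda>y. C * norm (y - u)) \<longlongrightarrow> 0) (at u)" by simp
  show "((\<lambda>y. (f y - f u - L (y - u)) /\<^sub>R norm (y - u)) \<longlongrightarrow> 0) (at u)"
  proof (rule Lim_null_comparison[OF _ lim])
    have "\<forall>\<^sub>F y in at u. dist y u < \<delta>" using assms(2) by (auto simp: eventually_at)
    moreover have "norm ((f y - f u - L (y - u)) /\<^sub>R norm (y - u)) \<le> C * norm (y - u)"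
      if "dist y u < \<delta>" for y
    proof (cases "y = u")
      case False
      have "norm (f y - f u - L (y - u)) \<le> C * norm (y - u) ^ 2"
        using assms(3)[of "y - u"] that by (simp add: dist_norm)
      then have "inverse (norm (y - u)) * norm (f y - f u - L (y - u))
          \<le> inverse (norm (y - u)) * (C * norm (y - u) ^ 2)"
        by (intro mult_left_mono) auto
      moreover have "inverse (norm (y - u)) * (C * norm (y - u) ^ 2) = C * norm (y - u)"
        using False by (simp add: power2_eq_square field_simps)
      moreover have "norm ((f y - f u - L (y - u)) /\<^sub>R norm (y - u)) =
          inverse (norm (y - u)) * norm (f y - f u - L (y - u))" by simp
      ultimately show ?thesis by linarith
    qed simp
    ultimately show "\<forall>\<^sub>F y in at u. norm ((f y - f u - L (y - u)) /\<^sub>R norm (y - u)) \<le> C * norm (y - u)"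
      by (auto elim: eventually_mono)
  qed
qed

text \<open>Integrating the system along the ray from the origin to \<open>u\<close> gives an
  integral equation for \<open>P\<close>. Its right side contracts by 1/2 on small balls whether or
  not the system is integrable; integrability is what later turns the fixed point into a solution in
  all directions.\<close>

lemma total_system_fixed_point:
  fixes b :: "'n::finite \<Rightarrow> 'k::finite \<Rightarrow> real ^ 'n \<Rightarrow> real ^ 'k" and w0 :: "real ^ 'k"
  assumes cont: "\<And>i j. continuous_on (cball 0 R) (b i j)" and "R > 0"
    and bound: "\<And>u v w. u \<in> cball 0 R \<Longrightarrow> norm (bil (\<lambda>i j. b i j u) v w) \<le> C * norm v * norm w"
    and "C \<ge> 0" "C * R \<le> 1 / 2"
  obtains P where "continuous_on UNIV P" "bounded (range P)"
    "\<And>u. u \<in> cball 0 R \<Longrightarrow>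
       P u = w0 + integral {0..1} (\<lambda>t. bil (\<lambda>i j. b i j (t *\<^sub>R u)) u (P (t *\<^sub>R u)))"
proof -
  let ?K = "cball (0 :: real ^ 'n) R"
  \<comment> \<open>The retraction onto the ball lets the operator act on bounded continuous
    functions on the whole space, a complete metric space to which the fixed point theorem applies.
    On the ball itself nothing changes.\<close>
  define \<rho> where "\<rho> = closest_point ?K"
  have \<rho>: "\<rho> u \<in> ?K" for u
    unfolding \<rho>_def using \<open>R > 0\<close> by (intro closest_point_in_set) auto
  have \<rho>_id: "\<rho> u = u" if "u \<in> ?K" for u
    unfolding \<rho>_def using that by (rule closest_point_self)
  have \<rho>_cont: "continuous_on S \<rho>" for S
    unfolding \<rho>_def using \<open>R > 0\<close> by (intro continuous_on_closest_point) auto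
  have in_K: "t *\<^sub>R \<rho> u \<in> ?K" if "t \<in> {0..1}" for t u
  proof -
    have "t * norm (\<rho> u) \<le> 1 * R" using that \<rho>[of u] \<open>R > 0\<close> by (intro mult_mono) auto
    then show ?thesis using that by auto
  qed
  define I where "I P u t = bil (\<lambda>i j. b i j (t *\<^sub>R \<rho> u)) (\<rho> u) (P (t *\<^sub>R \<rho> u))"
    for P :: "real ^ 'n \<Rightarrow> real ^ 'k" and u t
  have I_cont: "continuous_on (UNIV \<times> cbox 0 1) (\<lambda>(u, t). I P u t)" if "continuous_on UNIV P" for P
    unfolding I_def bil_def split_beta
    by (intro continuous_intros continuous_on_compose2[OF cont] continuous_on_compose2[OF that]
          continuous_on_compose2[OF \<rho>_cont[of UNIV]]) (use in_K in auto)
  have I_cont1: "continuous_on {0..1} (I P u)" if "continuous_on UNIV P" for P u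
  proof -
    have "continuous_on {0..1} (\<lambda>t. (u, t))" by (intro continuous_intros)
    from continuous_on_compose2[OF I_cont[OF that] this] show ?thesis by auto
  qed
  have I_bound: "norm (I P u t) \<le> 1 / 2 * norm (P (t *\<^sub>R \<rho> u))" if "t \<in> {0..1}" for P u t
  proof -
    have "norm (I P u t) \<le> C * norm (\<rho> u) * norm (P (t *\<^sub>R \<rho> u))"
      unfolding I_def by (rule bound[OF in_K[OF that]])
    also have "\<dots> \<le> C * R * norm (P (t *\<^sub>R \<rho> u))"
      using \<rho>[of u] \<open>C \<ge> 0\<close> by (intro mult_right_mono mult_left_mono) auto
    also have "\<dots> \<le> 1 / 2 * norm (P (t *\<^sub>R \<rho> u))"
      using assms(5) by (intro mult_right_mono) auto
    finally show ?thesis .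
  qed
  have int_bound: "norm (integral {0..1} f) \<le> B"
    if "continuous_on {0..1} f" "\<And>t. t \<in> {0..1} \<Longrightarrow> norm (f t) \<le> B" for f :: "real \<Rightarrow> real ^ 'k" and B
    using integral_bound[of 0 1 f B] that by simp
  define F where "F P u = w0 + integral {0..1} (I P u)" for P u
  have F_bcont: "F (apply_bcontfun P) \<in> bcontfun" for P :: "(real ^ 'n) \<Rightarrow>\<^sub>C (real ^ 'k)"
  proof -
    have "continuous_on UNIV (F P)"
      unfolding F_def[abs_def]
      using integral_continuous_on_param[OF I_cont[of P]] by (intro continuous_intros) simp
    moreover obtain M where M: "\<And>x. norm (P x) \<le> M"
      using bounded_apply_bcontfun[of P] unfolding bounded_iff by auto
    have "norm (F P u) \<le> norm w0 + 1 / 2 * M" for u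
    proof -
      have "norm (integral {0..1} (I P u)) \<le> 1 / 2 * M"
        using I_bound[of _ P u] M by (intro int_bound I_cont1) (auto intro: order_trans)
      then show ?thesis unfolding F_def by (meson add_left_mono norm_triangle_ineq order_trans)
    qed
    then have "bounded (range (F P))" unfolding bounded_iff by blast
    ultimately show ?thesis by (simp add: bcontfun_def)
  qed
  define \<F> where "\<F> P = Bcontfun (F (apply_bcontfun P))" for P
  have \<F>: "apply_bcontfun (\<F> P) = F (apply_bcontfun P)" for P
    unfolding \<F>_def by (rule Bcontfun_inverse[OF F_bcont])
  have "\<exists>!P. \<F> P = P"
  proof (rule banach_fix_type[of "1/2"])
    show "\<forall>P Q. dist (\<F> P) (\<F> Q) \<le> 1 / 2 * dist P Q"
    proof (intro allI dist_bound)
      fix P Q :: "(real ^ 'n) \<Rightarrow>\<^sub>C (real ^ 'k)" and u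
      have c: "continuous_on {0..1} (I P u)" "continuous_on {0..1} (I Q u)"
        by (intro I_cont1 continuous_on_apply_bcontfun)+
      have "F P u - F Q u = integral {0..1} (\<lambda>t. I P u t - I Q u t)"
        unfolding F_def using c by (subst integral_diff) (auto intro!: integrable_continuous_interval)
      also have "\<dots> = integral {0..1} (I (\<lambda>x. P x - Q x) u)"
        unfolding I_def bil_diff_right ..
      also have "norm \<dots> \<le> 1 / 2 * dist P Q"
      proof (rule int_bound)
        show "continuous_on {0..1} (I (\<lambda>x. P x - Q x) u)" by (intro I_cont1 continuous_intros) auto
        fix t :: real assume "t \<in> {0..1}"
        then show "norm (I (\<lambda>x. P x - Q x) u t) \<le> 1 / 2 * dist P Q"
          using I_bound[of t "\<lambda>x. P x - Q x" u] dist_bounded[of P "t *\<^sub>R \<rho> u" Q]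
          by (simp add: dist_norm)
      qed
      finally show "dist (\<F> P u) (\<F> Q u) \<le> 1 / 2 * dist P Q" by (simp add: \<F> dist_norm)
    qed
  qed auto
  then obtain P where P: "\<F> P = P" by blast
  have "P u = w0 + integral {0..1} (\<lambda>t. bil (\<lambda>i j. b i j (t *\<^sub>R u)) u (P (t *\<^sub>R u)))"
    if "u \<in> ?K" for u
  proof -
    have "P u = F P u" using \<F>[of P] unfolding P by simp
    then show ?thesis unfolding F_def I_def \<rho>_id[OF that] .
  qed
  then show thesis by (intro that[of P]) auto
qed


text \<open>If the curvature vanishes, the values of \<open>P\<close> along the rays through \<open>u\<close> and \<open>u + v\<close> differ by
  the expected first-order term up to an error satisfying a Gronwall inequality with inhomogeneity
  of order \<open>norm v ^ 2\<close>; no derivative with respect to a parameter is needed.\<close>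

lemma total_system_solution:
  fixes b :: "'n::finite \<Rightarrow> 'k::finite \<Rightarrow> real ^ 'n \<Rightarrow> real ^ 'k"
  assumes smooth: "\<And>i j. smooth_on S (b i j)" and S: "open S" "0 \<in> S"
    and flat: "\<And>u v v' w. u \<in> S \<Longrightarrow>
      bil (\<lambda>i j. fd (b i j) u v) v' w + bil (\<lambda>i j. b i j u) v' (bil (\<lambda>i j. b i j u) v w) =
      bil (\<lambda>i j. fd (b i j) u v') v w + bil (\<lambda>i j. b i j u) v (bil (\<lambda>i j. b i j u) v' w)"
  obtains e where "e > 0" "ball 0 e \<subseteq> S"
    "\<And>w0. \<exists>\<omega>. \<omega> 0 = w0 \<and> smooth_on (ball 0 e) \<omega> \<and>
       (\<forall>u\<in>ball 0 e. (\<omega> has_derivative (\<lambda>v. bil (\<lambda>i j. b i j u) v (\<omega> u))) (at u))"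
proof -
  obtain r where r: "r > 0" "cball 0 r \<subseteq> S" using S open_contains_cball by blast
  let ?N = "real CARD('n) * real CARD('k)"
  let ?Kr = "cball (0 :: real ^ 'n) r"
  have K0: "compact ?Kr" "convex ?Kr" by auto
  have "\<exists>c. \<forall>u\<in>?Kr. norm (b i j u) \<le> c" for i j
    by (rule smooth_on_bound_compact[OF smooth K0(1) r(2)]) blast
  then obtain c0 where c0: "\<And>i j u. u \<in> ?Kr \<Longrightarrow> norm (b i j u) \<le> c0 i j" by metis
  have "\<exists>c. \<forall>u\<in>?Kr. \<forall>v. norm (fd (b i j) u v) \<le> c * norm v" for i j
    by (rule smooth_on_fd_bound_compact[OF smooth K0(1) r(2)]) blast
  then obtain c1 where c1: "\<And>i j u v. u \<in> ?Kr \<Longrightarrow> norm (fd (b i j) u v) \<le> c1 i j * norm v" by metis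
  have "\<exists>c. \<forall>u\<in>?Kr. \<forall>v\<in>?Kr. norm (b i j v - b i j u - fd (b i j) u (v - u)) \<le> c * norm (v - u) ^ 2" for i j
    by (rule smooth_on_taylor_compact[OF smooth K0 r(2)]) blast
  then obtain c2 where c2: "\<And>i j u v. u \<in> ?Kr \<Longrightarrow> v \<in> ?Kr \<Longrightarrow>
      norm (b i j v - b i j u - fd (b i j) u (v - u)) \<le> c2 i j * norm (v - u) ^ 2" by metis
  \<comment> \<open>A single constant dominating, for all coefficients, the bounds for values, first
    derivatives and Taylor remainders.\<close>
  define c where "c = (\<Sum>i\<in>UNIV. \<Sum>j\<in>UNIV. \<bar>c0 i j\<bar> + \<bar>c1 i j\<bar> + \<bar>c2 i j\<bar>)"
  have "\<bar>c0 i j\<bar> + \<bar>c1 i j\<bar> + \<bar>c2 i j\<bar> \<le> c" for i j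
  proof -
    have "\<bar>c0 i j\<bar> + \<bar>c1 i j\<bar> + \<bar>c2 i j\<bar> \<le> (\<Sum>j\<in>UNIV. \<bar>c0 i j\<bar> + \<bar>c1 i j\<bar> + \<bar>c2 i j\<bar>)"
      by (rule member_le_sum) auto
    also have "\<dots> \<le> c" unfolding c_def by (rule member_le_sum) (auto intro: sum_nonneg)
    finally show ?thesis .
  qed
  then have c_le: "c0 i j \<le> c" "c1 i j \<le> c" "c2 i j \<le> c" for i j
    by (smt (verit))+
  have "c \<ge> 0" unfolding c_def by (intro sum_nonneg) auto
  define C where "C = ?N * c"
  have "C \<ge> 0" using \<open>c \<ge> 0\<close> by (simp add: C_def)
  \<comment> \<open>The second bound makes \<open>C * R \<le> 1 / 2\<close>, the contraction factor
    of the radial equation.\<close>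
  define R where "R = min r (1 / (2 * (C + 1)))"
  have R: "R > 0" "R \<le> r" using r(1) \<open>C \<ge> 0\<close> by (auto simp: R_def)
  have "C * R \<le> C * (1 / (2 * (C + 1)))" using \<open>C \<ge> 0\<close> by (intro mult_left_mono) (auto simp: R_def)
  also have "\<dots> \<le> 1 / 2" using \<open>C \<ge> 0\<close> by (simp add: field_simps)
  finally have CR: "C * R \<le> 1 / 2" .
  let ?K = "cball (0 :: real ^ 'n) R"
  have K: "?K \<subseteq> ?Kr" "?K \<subseteq> S" using R r by auto
  define B where "B u v w = bil (\<lambda>i j. b i j u) v w" for u v w
  define B1 where "B1 u z v w = bil (\<lambda>i j. fd (b i j) u z) v w" for u z v w
  have B_bound: "norm (B u v w) \<le> C * norm v * norm w" if "u \<in> ?K" for u v w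
    unfolding B_def C_def
    using order_trans[OF c0 c_le(1)] that K by (intro norm_bil) auto
  have B1_bound: "norm (B1 u z v w) \<le> C * norm z * norm v * norm w" if "u \<in> ?K" for u z v w
  proof -
    have "norm (fd (b i j) u z) \<le> c * norm z" for i j
      using c1[OF subsetD[OF K(1) that], of i j z] mult_right_mono[OF c_le(2)[of i j], of "norm z"]
      by simp
    from norm_bil[OF this, where v = v and w = w] show ?thesis by (simp add: B1_def C_def mult_ac)
  qed
  have B2_bound: "norm (B u' v w - B u v w - B1 u (u' - u) v w) \<le> C * norm (u' - u) ^ 2 * norm v * norm w"
    if "u \<in> ?K" "u' \<in> ?K" for u u' v w
  proof -
    have "norm (b i j u' - b i j u - fd (b i j) u (u' - u)) \<le> c * norm (u' - u) ^ 2" for i j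
      using c2[OF subsetD[OF K(1) that(1)] subsetD[OF K(1) that(2)], of i j]
        mult_right_mono[OF c_le(3)[of i j], of "norm (u' - u) ^ 2"] by simp
    from norm_bil[OF this, where v = v and w = w] show ?thesis by (simp add: B_def B1_def C_def mult_ac bil_diff_coeff)
  qed
  have flatB: "B1 u v v' w + B u v' (B u v w) = B1 u v' v w + B u v (B u v' w)" if "u \<in> ?K" for u v v' w
    using flat[of u v v' w] that K unfolding B_def B1_def by blast
  have B1_scale: "B1 u (t *\<^sub>R z) v w = t *\<^sub>R B1 u z v w" if "u \<in> ?K" for u t z v w
    using linear_scale[OF smooth_on_linear_fd[OF smooth]] that K
    unfolding B1_def by (simp add: bil_scale_coeff subset_iff)
  have exists: "\<exists>\<omega>. \<omega> 0 = w0 \<and> smooth_on (ball 0 R) \<omega> \<and>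
       (\<forall>u\<in>ball 0 R. (\<omega> has_derivative (\<lambda>v. bil (\<lambda>i j. b i j u) v (\<omega> u))) (at u))" for w0
  proof -
    have b_cont: "continuous_on ?K (b i j)" for i j
      by (rule continuous_on_subset[OF smooth_on_continuous[OF smooth] K(2)])
    obtain P where P: "continuous_on UNIV P" "bounded (range P)"
        "\<And>u. u \<in> ?K \<Longrightarrow> P u = w0 + integral {0..1} (\<lambda>t. B (t *\<^sub>R u) u (P (t *\<^sub>R u)))"
      by (rule total_system_fixed_point[of R b C w0, OF b_cont R(1) _ \<open>C \<ge> 0\<close> CR])
         (use B_bound in \<open>auto simp: B_def\<close>)
    obtain M where M: "M \<ge> 0" "\<And>u. norm (P u) \<le> M"
      using P(2) unfolding bounded_iff by (metis norm_ge_zero order_trans rangeI)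
    have ray_in: "t *\<^sub>R u \<in> ?K" if "u \<in> ?K" "t \<in> {0..1}" for t u
    proof -
      have "t * norm u \<le> 1 * R" using that R by (intro mult_mono) auto
      then show ?thesis using that by auto
    qed
    \<comment> \<open>For the point \<open>s *\<^sub>R u\<close>, substituting \<open>t * s\<close>
      in the radial integral turns it into the integral of one fixed function \<open>g\<close> over
      \<open>{0..s}\<close>. Differentiating in \<open>s\<close> gives the differential equation
      along the ray.\<close>
    have ray: "((\<lambda>t. P (t *\<^sub>R u)) has_vector_derivative B (t *\<^sub>R u) u (P (t *\<^sub>R u))) (at t within {0..1})"
      if u: "u \<in> ?K" and t: "t \<in> {0..1}" for u t
    proof -
      define g where "g t = B (t *\<^sub>R u) u (P (t *\<^sub>R u))" for t
      have g: "continuous_on {0..1} g"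
        unfolding g_def B_def bil_def
        by (intro continuous_intros continuous_on_compose2[OF b_cont] continuous_on_compose2[OF P(1)])
           (use ray_in[OF u] in auto)
      define J where "J s = integral {0..s} g" for s
      have J: "(J has_vector_derivative g s) (at s within {0..1})" if "s \<in> {0..1}" for s
        unfolding J_def by (rule integral_has_vector_derivative[OF g that])
      have P_J: "P (s *\<^sub>R u) = w0 + J s" if s: "s \<in> {0..1}" for s
      proof -
        have "integral {0..1} (\<lambda>t. s *\<^sub>R g (t * s)) = J (1 * s) - J (0 * s)"
        proof (rule integral_unique, rule fundamental_theorem_of_calculus)
          fix t :: real assume t: "t \<in> {0..1}"
          have sub: "(\<lambda>t. t * s) ` {0..1} \<subseteq> {0..1}" using s by (auto intro: mult_le_one)
          have "((\<lambda>t. t * s) has_vector_derivative s) (at t within {0..1})"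
            by (auto intro!: derivative_eq_intros)
          from vector_diff_chain_within[OF this has_vector_derivative_within_subset[OF J sub]]
          show "((\<lambda>t. J (t * s)) has_vector_derivative s *\<^sub>R g (t * s)) (at t within {0..1})"
            using subsetD[OF sub imageI[OF t]] by (simp add: o_def)
        qed simp
        moreover have "P (s *\<^sub>R u) = w0 + integral {0..1} (\<lambda>t. s *\<^sub>R g (t * s))"
          using P(3)[OF ray_in[OF u s]] by (simp add: g_def B_def bil_scale_left)
        ultimately show ?thesis by (simp add: J_def)
      qed
      have wJ: "((\<lambda>s. w0 + J s) has_vector_derivative g t) (at t within {0..1})"
        using has_vector_derivative_add[OF has_vector_derivative_const J[OF t]] by simp
      show ?thesis
        unfolding g_def[symmetric] by (rule has_vector_derivative_transform[OF t _ wJ]) (rule P_J)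
    qed
    \<comment> \<open>In the constant, the first factor collects the four contributions of order
      \<open>norm v ^ 2\<close> to \<open>D'\<close> and the exponential comes from the two
      contributions linear in \<open>D\<close>. The factor \<open>2 * R\<close> bounds
      \<open>norm v\<close>, since both \<open>u\<close> and \<open>u + v\<close> lie in the
      ball.\<close>
    have quad: "norm (P (u + v) - P u - B u v (P u)) \<le>
        ((C * C * M + C * M + C * R * C * M + C * R * M) * exp (2 * (C * R + C * (2 * R) * R) + 1)) * norm v ^ 2"
      if u: "u \<in> ?K" and uv: "u + v \<in> ?K" for u v
    proof -
      define p where "p t = P (t *\<^sub>R u)" for t
      define q where "q t = P (t *\<^sub>R (u + v))" for t
      \<comment> \<open>\<open>D t\<close> compares the rays through \<open>u\<close> and
        \<open>u + v\<close>, corrected by the expected first-order term at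
        \<open>t *\<^sub>R u\<close>. At \<open>t = 1\<close> it is the remainder to be estimated,
        at \<open>t = 0\<close> it vanishes.\<close>
      define D where "D t = q t - p t - B (t *\<^sub>R u) (t *\<^sub>R v) (p t)" for t
      define D' where "D' t = B (t *\<^sub>R (u + v)) (u + v) (q t) - B (t *\<^sub>R u) u (p t) -
        (B1 (t *\<^sub>R u) u (t *\<^sub>R v) (p t) + B (t *\<^sub>R u) v (p t)
          + B (t *\<^sub>R u) (t *\<^sub>R v) (B (t *\<^sub>R u) u (p t)))" for t
      have v_le: "norm v \<le> 2 * R"
        using norm_triangle_ineq4[of "u + v" u] u uv by auto
      have "norm (D 1) \<le> (C * C * M + C * M + C * R * C * M + C * R * M) * norm v ^ 2 *
          exp (2 * (C * R + C * (2 * R) * R) + 1)"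
      proof (rule gronwall_from_zero)
        show "D 0 = 0" by (simp add: D_def p_def q_def B_def bil_def)
        fix t :: real assume t: "t \<in> {0..1}"
        let ?x = "t *\<^sub>R u" and ?y = "t *\<^sub>R (u + v)"
        have xy: "?x \<in> ?K" "?y \<in> ?K" using ray_in t u uv by auto
        have "((\<lambda>t. b i j (t *\<^sub>R u)) has_derivative (\<lambda>h. fd (b i j) ?x (h *\<^sub>R u))) (at t within {0..1})" for i j
          by (rule has_derivative_compose[OF _ smooth_on_has_derivative[OF smooth]])
             (use xy K in \<open>auto intro!: derivative_eq_intros\<close>)
        moreover have "((\<lambda>t. t *\<^sub>R v) has_derivative (\<lambda>h. h *\<^sub>R v)) (at t within {0..1})"
          by (auto intro!: derivative_eq_intros)
        moreover have "(p has_derivative (\<lambda>h. h *\<^sub>R B ?x u (p t))) (at t within {0..1})"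
          using ray[OF u t] unfolding p_def has_vector_derivative_def .
        ultimately have "((\<lambda>t. B (t *\<^sub>R u) (t *\<^sub>R v) (p t)) has_derivative
            (\<lambda>h. B1 ?x (h *\<^sub>R u) (t *\<^sub>R v) (p t) + B ?x (h *\<^sub>R v) (p t)
              + B ?x (t *\<^sub>R v) (h *\<^sub>R B ?x u (p t)))) (at t within {0..1})"
          unfolding B_def B1_def by (rule has_derivative_bil)
        then have "((\<lambda>t. B (t *\<^sub>R u) (t *\<^sub>R v) (p t)) has_vector_derivative
            (B1 ?x u (t *\<^sub>R v) (p t) + B ?x v (p t) + B ?x (t *\<^sub>R v) (B ?x u (p t)))) (at t within {0..1})"
          unfolding has_vector_derivative_def
          by (simp add: B1_scale[OF xy(1)] B_def bil_scale_left bil_scale_right scaleR_add_right)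
        then show "(D has_vector_derivative D' t) (at t within {0..1})"
          unfolding D_def D'_def p_def q_def
          by (intro has_vector_derivative_diff ray u uv t)
        have qp: "q t = p t + (D t + t *\<^sub>R B ?x v (p t))" by (simp add: D_def B_def bil_scale_left)
        let ?Rem = "B ?y (u + v) (q t) - B ?x (u + v) (q t) - B1 ?x (t *\<^sub>R v) (u + v) (q t)"
        \<comment> \<open>The terms of first order in \<open>v\<close> that do not contain
          \<open>D t\<close> cancel by flatness. What remains is linear in \<open>D t\<close> or of
          second order in \<open>v\<close>.\<close>
        have "D' t = B ?x (u + v) (D t) + t *\<^sub>R B ?x v (B ?x v (p t)) + t *\<^sub>R B1 ?x v v (q t)
            + t *\<^sub>R B1 ?x v u (D t + t *\<^sub>R B ?x v (p t)) + ?Rem"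
        proof -
          have f: "t *\<^sub>R B ?x u (B ?x v (p t)) =
              t *\<^sub>R (B1 ?x u v (p t) + B ?x v (B ?x u (p t)) - B1 ?x v u (p t))"
            by (rule arg_cong[where f = "scaleR t"])
               (use flatB[OF xy(1), of v u "p t"] in \<open>simp add: algebra_simps\<close>)
          have e1: "B ?x (u + v) (q t) = B ?x u (p t) + B ?x v (p t) + B ?x (u + v) (D t)
              + t *\<^sub>R B ?x u (B ?x v (p t)) + t *\<^sub>R B ?x v (B ?x v (p t))"
            unfolding qp by (simp add: B_def bil_add_left bil_add_right bil_scale_right scaleR_add_right)
          have e2: "B1 ?x (t *\<^sub>R v) (u + v) (q t) = t *\<^sub>R B1 ?x v v (q t) + t *\<^sub>R B1 ?x v u (p t)
              + t *\<^sub>R B1 ?x v u (D t + t *\<^sub>R B ?x v (p t))"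
          proof -
            have "B1 ?x v u (q t) = B1 ?x v u (p t) + B1 ?x v u (D t + t *\<^sub>R B ?x v (p t))"
              unfolding qp by (simp add: B1_def bil_add_right)
            then show ?thesis
              by (simp add: B1_scale[OF xy(1)]) (simp add: B1_def bil_add_left scaleR_add_right)
          qed
          have e3: "B1 ?x u (t *\<^sub>R v) (p t) = t *\<^sub>R B1 ?x u v (p t)"
            "B ?x (t *\<^sub>R v) (B ?x u (p t)) = t *\<^sub>R B ?x v (B ?x u (p t))"
            by (simp_all add: B_def B1_def bil_scale_left)
          show ?thesis
            unfolding D'_def e3 e2 e1 f by (simp add: algebra_simps)
        qed
        moreover have "norm (B ?x (u + v) (D t)) \<le> C * R * norm (D t)"
        proof -
          have "norm (B ?x (u + v) (D t)) \<le> C * norm (u + v) * norm (D t)" by (rule B_bound[OF xy(1)])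
          also have "\<dots> \<le> C * R * norm (D t)"
            using uv \<open>C \<ge> 0\<close> by (intro mult_right_mono mult_left_mono) auto
          finally show ?thesis .
        qed
        moreover have scale_le: "norm (t *\<^sub>R z) \<le> norm z" for z :: "real ^ 'k"
          using t mult_left_le_one_le[of "norm z" "\<bar>t\<bar>"] by simp
        have Bp: "norm (B ?x v (p t)) \<le> C * norm v * M"
          using B_bound[OF xy(1), of v "p t"] M(2)[of ?x] \<open>C \<ge> 0\<close>
          unfolding p_def by (meson mult_left_mono mult_nonneg_nonneg norm_ge_zero order_trans)
        have "norm (t *\<^sub>R B ?x v (B ?x v (p t))) \<le> C * C * M * norm v ^ 2"
        proof -
          have "norm (t *\<^sub>R B ?x v (B ?x v (p t))) \<le> C * norm v * norm (B ?x v (p t))"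
            by (rule order_trans[OF scale_le B_bound[OF xy(1)]])
          also have "\<dots> \<le> C * norm v * (C * norm v * M)" using Bp \<open>C \<ge> 0\<close> by (intro mult_left_mono) auto
          finally show ?thesis by (simp add: power2_eq_square mult_ac)
        qed
        moreover have "norm (t *\<^sub>R B1 ?x v v (q t)) \<le> C * M * norm v ^ 2"
        proof -
          have "norm (t *\<^sub>R B1 ?x v v (q t)) \<le> C * norm v * norm v * norm (q t)"
            by (rule order_trans[OF scale_le B1_bound[OF xy(1)]])
          also have "\<dots> \<le> C * norm v * norm v * M" using M \<open>C \<ge> 0\<close> unfolding q_def by (intro mult_left_mono) auto
          finally show ?thesis by (simp add: power2_eq_square mult_ac)
        qed
        moreover have "norm (t *\<^sub>R B1 ?x v u (D t + t *\<^sub>R B ?x v (p t))) \<le>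
            C * (2 * R) * R * norm (D t) + C * R * C * M * norm v ^ 2"
        proof -
          have "norm (t *\<^sub>R B1 ?x v u (D t + t *\<^sub>R B ?x v (p t))) \<le>
              C * norm v * norm u * norm (D t + t *\<^sub>R B ?x v (p t))"
            by (rule order_trans[OF scale_le B1_bound[OF xy(1)]])
          also have "\<dots> \<le> C * norm v * R * (norm (D t) + C * norm v * M)"
          proof (intro mult_mono)
            show "norm (D t + t *\<^sub>R B ?x v (p t)) \<le> norm (D t) + C * norm v * M"
              using norm_triangle_ineq scale_le Bp by (meson add_left_mono order_trans)
          qed (use u R \<open>C \<ge> 0\<close> in auto)
          also have "\<dots> = C * norm v * R * norm (D t) + C * R * C * M * norm v ^ 2"
            by (simp add: power2_eq_square algebra_simps)
          also have "C * norm v * R * norm (D t) \<le> C * (2 * R) * R * norm (D t)"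
            using v_le R \<open>C \<ge> 0\<close> by (intro mult_right_mono mult_left_mono) auto
          finally show ?thesis by simp
        qed
        moreover have "norm ?Rem \<le> C * R * M * norm v ^ 2"
        proof -
          have "?y - ?x = t *\<^sub>R v" by (simp add: algebra_simps)
          then have "norm ?Rem \<le> C * norm (t *\<^sub>R v) ^ 2 * norm (u + v) * norm (q t)"
            using B2_bound[OF xy, of "u + v" "q t"] by simp
          also have "\<dots> \<le> C * norm v ^ 2 * R * M"
            using uv R \<open>C \<ge> 0\<close> M t mult_left_le_one_le[of "norm v" "\<bar>t\<bar>"]
            unfolding q_def by (intro mult_mono power_mono) auto
          finally show ?thesis by (simp add: mult_ac)
        qed
        ultimately have "norm (D' t) \<le> C * R * norm (D t) + C * C * M * norm v ^ 2 + C * M * norm v ^ 2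
            + (C * (2 * R) * R * norm (D t) + C * R * C * M * norm v ^ 2) + C * R * M * norm v ^ 2"
          by (metis (no_types, lifting) norm_triangle_mono)
        then show "norm (D' t) \<le> (C * R + C * (2 * R) * R) * norm (D t)
            + (C * C * M + C * M + C * R * C * M + C * R * M) * norm v ^ 2"
          by (simp add: algebra_simps)
      qed (use \<open>C \<ge> 0\<close> M R in auto)
      then show ?thesis by (simp add: D_def p_def q_def mult_ac)
    qed
    have deriv: "(P has_derivative (\<lambda>v. B u v (P u))) (at u)" if u: "u \<in> ball 0 R" for u
    proof (rule has_derivative_quadratic[where \<delta> = "R - norm u"])
      have "linear (\<lambda>v. B u v (P u))"
        by (intro linearI) (simp_all add: B_def bil_add_left bil_scale_left)
      then show "bounded_linear (\<lambda>v. B u v (P u))" by (simp add: linear_conv_bounded_linear)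
      show "R - norm u > 0" using u by auto
      fix v :: "real ^ 'n" assume "norm v < R - norm u"
      then have "u + v \<in> ?K" using norm_triangle_ineq[of u v] by auto
      then show "norm (P (u + v) - P u - B u v (P u)) \<le>
        ((C * C * M + C * M + C * R * C * M + C * R * M) * exp (2 * (C * R + C * (2 * R) * R) + 1)) * norm v ^ 2"
        using quad u by auto
    qed
    \<comment> \<open>The equation expresses the derivative of \<open>P\<close> by \<open>P\<close>
      and the smooth coefficients, so every order gained for \<open>P\<close> passes to its
      derivative.\<close>
    have "times_differentiable_on k (ball 0 R) P" for k
    proof (induction k)
      case 0
      show ?case using continuous_on_subset[OF P(1)] by auto
    next
      case (Suc k)
      have "times_differentiable_on k (ball 0 R) (\<lambda>u. fd P u v)" for v
      proof (rule times_differentiable_on_cong[OF open_ball])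
        have "times_differentiable_on k (ball 0 R) (b i j)" for i j
          using smooth_on_subset[OF smooth, of "ball 0 R"] K unfolding smooth_on_def by (simp add: subset_iff)
        then show "times_differentiable_on k (ball 0 R) (\<lambda>u. \<Sum>i\<in>UNIV. \<Sum>j\<in>UNIV. (v $ i * P u $ j) *\<^sub>R b i j u)"
          by (intro times_differentiable_on_sum open_ball
              bounded_bilinear.times_differentiable_on_bilinear[OF bounded_bilinear_scaleR]
              bounded_bilinear.times_differentiable_on_bilinear[OF bounded_bilinear_mult]
              times_differentiable_on_const times_differentiable_on_linear[OF bounded_linear_vec_nth] Suc)
      qed (use fd_eq[OF deriv] in \<open>simp add: B_def bil_def\<close>)
      moreover have "P differentiable at u" if "u \<in> ball 0 R" for u
        by (rule differentiableI[OF deriv[OF that]])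
      ultimately show ?case by simp
    qed
    then have "smooth_on (ball 0 R) P" by (simp add: smooth_on_def)
    moreover have "P 0 = w0" using P(3)[of 0] R by (simp add: B_def bil_def)
    ultimately show ?thesis using deriv unfolding B_def by blast
  qed
  moreover have "ball 0 R \<subseteq> S" using K(2) by (meson ball_subset_cball order_trans)
  ultimately show thesis using that[OF R(1)] by blast
qed

section \<open>Affine coordinates of a flat connection\<close>

lemma bil_swap: "(\<And>i j. b i j = c j i) \<Longrightarrow> bil b v w = bil c w v"
  unfolding bil_def by (subst sum.swap) (simp add: mult.commute)

lemma fd_nth:
  fixes f :: "'a::real_normed_vector \<Rightarrow> 'b::real_normed_vector ^ 'n::finite"
  assumes "f differentiable at u"
  shows "fd (\<lambda>u. f u $ k) u v = fd f u v $ k"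
  using fd_eq[OF bounded_linear.has_derivative[OF bounded_linear_vec_nth differentiable_fd[OF assms]]]
  by (simp add: fun_eq_iff)

lemma differentiable_nth:
  fixes f :: "'a::real_normed_vector \<Rightarrow> 'b::real_normed_vector ^ 'n::finite"
  shows "f differentiable at u \<Longrightarrow> (\<lambda>u. f u $ k) differentiable at u"
  using bounded_linear.has_derivative[OF bounded_linear_vec_nth] unfolding differentiable_def by blast

lemma inner_bil: "x \<bullet> bil b v w = (\<Sum>i\<in>UNIV. \<Sum>j\<in>UNIV. v $ i * w $ j * (x \<bullet> b i j))"
  by (simp add: bil_def inner_sum_right)

lemma linear_bil_right: "linear (bil b v)"
  by (intro linearI) (simp_all add: bil_add_right bil_scale_right)

lemma linear_bil_left: "linear (\<lambda>v. bil b v w)"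
  by (intro linearI) (simp_all add: bil_add_left bil_scale_left)

lemma linear_eq_sum_axis:
  fixes L :: "real ^ 'n \<Rightarrow> 'b::real_vector"
  assumes "linear L"
  shows "L v = (\<Sum>i\<in>UNIV. v $ i *\<^sub>R L (axis i 1))"
proof -
  have "L v = L (\<Sum>i\<in>UNIV. v $ i *\<^sub>R axis i 1)" using vec_eq_sum_axis_real[of v] by simp
  then show ?thesis by (simp add: linear_sum[OF assms] linear_scale[OF assms])
qed

text \<open>The covector fields \<open>w\<close> with \<open>dw(v)\<^sub>j = w \<bullet> \<Gamma>(v, e\<^sub>j)\<close> are the parallel ones. Flatness makes the
  system integrable and the symmetry of \<open>\<Gamma>\<close> makes its solutions closed, so that a parallel coframe
  consists of the differentials of affine coordinates.\<close>

lemma affine_coordinates: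
  fixes G :: "'n::finite \<Rightarrow> 'n \<Rightarrow> real ^ 'n \<Rightarrow> real ^ 'n"
  assumes smooth: "\<And>i j. smooth_on S (G i j)" and S: "open S" "0 \<in> S"
    and sym: "\<And>i j u. u \<in> S \<Longrightarrow> G i j u = G j i u"
    and flat: "\<And>i j k u. u \<in> S \<Longrightarrow>
      fd (G j k) u (axis i 1) + bil (\<lambda>i j. G i j u) (axis i 1) (G j k u) =
      fd (G i k) u (axis j 1) + bil (\<lambda>i j. G i j u) (axis j 1) (G i k u)"
  obtains U V \<phi> \<psi> where "diffeo U V \<phi> \<psi>" "0 \<in> U" "U \<subseteq> S" "\<phi> 0 = 0"
    "\<And>u v. u \<in> U \<Longrightarrow> fd \<phi> u v = 0 \<Longrightarrow> v = 0"
    "\<And>u i j. u \<in> U \<Longrightarrow> fd (\<lambda>u. fd \<phi> u (axis j 1)) u (axis i 1) = fd \<phi> u (G i j u)"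
proof -
  \<comment> \<open>The coefficients are transposed because the unknown is a covector: the
    \<open>j\<close>-th entry of \<open>bil\<close> with these coefficients at \<open>v\<close>,
    \<open>w\<close> is \<open>w \<bullet> \<Gamma>(v, e\<^sub>j)\<close>.\<close>
  define b where "b i k u = (\<chi> j. G i j u $ k)" for i k and u :: "real ^ 'n"
  have b_smooth: "smooth_on S (b i k)" for i k
    unfolding b_def[abs_def] by (intro smooth_intros S smooth)
  have b_nth: "bil (\<lambda>i k. b i k u) v w $ j = w \<bullet> bil (\<lambda>i j. G i j u) v (axis j 1)" for u v w j
  proof -
    have "bil (\<lambda>i k. b i k u) v w $ j = (\<Sum>i\<in>UNIV. v $ i * (w \<bullet> G i j u))"
      by (simp add: bil_def b_def inner_vec_def sum_distrib_left mult_ac)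
    also have "\<dots> = w \<bullet> (\<Sum>i\<in>UNIV. v $ i *\<^sub>R bil (\<lambda>i j. G i j u) (axis i 1) (axis j 1))"
      by (simp add: inner_sum_right bil_axis)
    finally show ?thesis using linear_eq_sum_axis[OF linear_bil_left[where b = "\<lambda>i j. G i j u" and w = "axis j 1"], of v] by simp
  qed
  have db_nth: "bil (\<lambda>i k. fd (b i k) u v) v' w $ j =
      w \<bullet> bil (\<lambda>l i. fd (G i j) u (axis l 1)) v v'" if "u \<in> S" for u v v' w j
  proof -
    have "fd (b i k) u v $ j = fd (G i j) u v $ k" for i k
    proof -
      have "fd (b i k) u v $ j = fd (\<lambda>u. b i k u $ j) u v"
        using smooth_on_differentiable[OF b_smooth that] by (simp add: fd_nth)
      also have "\<dots> = fd (G i j) u v $ k"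
        using smooth_on_differentiable[OF smooth that] by (simp add: b_def fd_nth)
      finally show ?thesis .
    qed
    then have "bil (\<lambda>i k. fd (b i k) u v) v' w $ j = (\<Sum>i\<in>UNIV. v' $ i * (w \<bullet> fd (G i j) u v))"
      by (simp add: bil_def inner_vec_def sum_distrib_left mult_ac)
    also have "\<dots> = (\<Sum>i\<in>UNIV. v' $ i * (w \<bullet> (\<Sum>l\<in>UNIV. v $ l *\<^sub>R fd (G i j) u (axis l 1))))"
      by (subst (1) linear_eq_sum_axis[OF smooth_on_linear_fd[OF smooth that], of _ _ v]) (rule refl)
    also have "\<dots> = (\<Sum>i\<in>UNIV. \<Sum>l\<in>UNIV. v $ l * v' $ i * (w \<bullet> fd (G i j) u (axis l 1)))"
      by (simp add: inner_sum_right sum_distrib_left mult_ac)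
    also have "\<dots> = w \<bullet> bil (\<lambda>l i. fd (G i j) u (axis l 1)) v v'"
      unfolding inner_bil by (rule sum.swap)
    finally show ?thesis .
  qed
  have bb_nth: "bil (\<lambda>i k. b i k u) v' (bil (\<lambda>i k. b i k u) v w) $ j =
      w \<bullet> bil (\<lambda>l i. bil (\<lambda>i j. G i j u) (axis l 1) (G i j u)) v v'" for u v v' w j
  proof -
    have "bil (\<lambda>i k. b i k u) v' (bil (\<lambda>i k. b i k u) v w) $ j =
        (\<Sum>m\<in>UNIV. (w \<bullet> bil (\<lambda>i j. G i j u) v (axis m 1)) * bil (\<lambda>i j. G i j u) v' (axis j 1) $ m)"
      unfolding b_nth[of _ v'] inner_vec_def[of "bil _ _ _"] by (simp add: b_nth)
    also have "\<dots> = w \<bullet> (\<Sum>m\<in>UNIV. (bil (\<lambda>i j. G i j u) v' (axis j 1) $ m) *\<^sub>R bil (\<lambda>i j. G i j u) v (axis m 1))"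
      by (simp add: inner_sum_right mult.commute)
    also have "\<dots> = w \<bullet> bil (\<lambda>i j. G i j u) v (bil (\<lambda>i j. G i j u) v' (axis j 1))"
      by (subst (2) linear_eq_sum_axis[OF linear_bil_right]) (rule refl)
    also have "bil (\<lambda>i j. G i j u) v' (axis j 1) = (\<Sum>i\<in>UNIV. v' $ i *\<^sub>R G i j u)"
      using linear_eq_sum_axis[OF linear_bil_left[where b = "\<lambda>i j. G i j u" and w = "axis j 1"], of v'] by (simp add: bil_axis)
    also have "bil (\<lambda>i j. G i j u) v (\<Sum>i\<in>UNIV. v' $ i *\<^sub>R G i j u) =
        (\<Sum>i\<in>UNIV. v' $ i *\<^sub>R bil (\<lambda>i j. G i j u) v (G i j u))"
      by (simp add: linear_sum[OF linear_bil_right] bil_scale_right)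
    also have "\<dots> = (\<Sum>i\<in>UNIV. v' $ i *\<^sub>R (\<Sum>l\<in>UNIV. v $ l *\<^sub>R bil (\<lambda>i j. G i j u) (axis l 1) (G i j u)))"
      by (subst (1) linear_eq_sum_axis[OF linear_bil_left[of "\<lambda>i j. G i j u"], of v]) (rule refl)
    also have "\<dots> = bil (\<lambda>l i. bil (\<lambda>i j. G i j u) (axis l 1) (G i j u)) v v'"
      unfolding bil_def[of "\<lambda>l i. bil (\<lambda>i j. G i j u) (axis l 1) (G i j u)"]
      by (subst sum.swap) (simp add: scaleR_sum_right mult.commute)
    finally show ?thesis .
  qed
  \<comment> \<open>In each component \<open>j\<close>, both sides are \<open>w\<close> paired with
    one bilinear expression, evaluated at \<open>(v, v')\<close> and at \<open>(v', v)\<close>. The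
    hypothesis \<open>flat\<close> says that this expression is symmetric.\<close>
  have integrable: "bil (\<lambda>i j. fd (b i j) u v) v' w + bil (\<lambda>i j. b i j u) v' (bil (\<lambda>i j. b i j u) v w) =
      bil (\<lambda>i j. fd (b i j) u v') v w + bil (\<lambda>i j. b i j u) v (bil (\<lambda>i j. b i j u) v' w)"
    if u: "u \<in> S" for u v v' w
  proof (rule vec_eq_iff[THEN iffD2], rule allI)
    fix j
    have "(bil (\<lambda>i j. fd (b i j) u v) v' w + bil (\<lambda>i j. b i j u) v' (bil (\<lambda>i j. b i j u) v w)) $ j =
        w \<bullet> bil (\<lambda>l i. fd (G i j) u (axis l 1) + bil (\<lambda>i j. G i j u) (axis l 1) (G i j u)) v v'" for v v'
      by (simp add: db_nth[OF u] bb_nth bil_add_coeff inner_add_right)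
    moreover have "bil (\<lambda>l i. fd (G i j) u (axis l 1) + bil (\<lambda>i j. G i j u) (axis l 1) (G i j u)) v v' =
        bil (\<lambda>l i. fd (G i j) u (axis l 1) + bil (\<lambda>i j. G i j u) (axis l 1) (G i j u)) v' v"
      by (rule bil_swap) (rule flat[OF u])
    ultimately show "(bil (\<lambda>i j. fd (b i j) u v) v' w + bil (\<lambda>i j. b i j u) v' (bil (\<lambda>i j. b i j u) v w)) $ j =
        (bil (\<lambda>i j. fd (b i j) u v') v w + bil (\<lambda>i j. b i j u) v (bil (\<lambda>i j. b i j u) v' w)) $ j"
      by simp
  qed
  obtain e where e: "e > 0" "ball 0 e \<subseteq> S"
    "\<And>w0. \<exists>\<omega>. \<omega> 0 = w0 \<and> smooth_on (ball 0 e) \<omega> \<and>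
       (\<forall>u\<in>ball 0 e. (\<omega> has_derivative (\<lambda>v. bil (\<lambda>i j. b i j u) v (\<omega> u))) (at u))"
    by (rule total_system_solution[of S b, OF b_smooth S integrable]) (assumption, rule that)
  let ?B = "ball (0 :: real ^ 'n) e"
  \<comment> \<open>Starting from the standard coframe makes the derivative of \<open>\<phi>\<close>
    at 0 the identity, so \<open>\<phi>\<close> is a local diffeomorphism.\<close>
  have "\<exists>\<omega>. \<omega> 0 = axis k 1 \<and> smooth_on ?B \<omega> \<and>
       (\<forall>u\<in>?B. (\<omega> has_derivative (\<lambda>v. bil (\<lambda>i j. b i j u) v (\<omega> u))) (at u))" for k :: 'n
    by (rule e(3))
  then obtain \<omega> where \<omega>: "\<And>k. \<omega> k 0 = axis k 1" "\<And>k. smooth_on ?B (\<omega> k)"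
      "\<And>k u. u \<in> ?B \<Longrightarrow> (\<omega> k has_derivative (\<lambda>v. bil (\<lambda>i j. b i j u) v (\<omega> k u))) (at u)" by metis
  have fd\<omega>: "fd (\<lambda>u. \<omega> k u $ j) u (axis i 1) = \<omega> k u \<bullet> G i j u" if "u \<in> ?B" for k i j u
  proof -
    have "fd (\<lambda>u. \<omega> k u $ j) u (axis i 1) = bil (\<lambda>i j. b i j u) (axis i 1) (\<omega> k u) $ j"
      using smooth_on_differentiable[OF \<omega>(2) that] fd_eq[OF \<omega>(3)[OF that]] by (simp add: fd_nth)
    then show ?thesis by (simp add: b_nth bil_axis)
  qed
  have "\<exists>F. smooth_on ?B F \<and> (\<forall>j. \<forall>z\<in>?B. fd F z (axis j 1) = \<omega> k z $ j)" for k
  proof (rule partial_poincare[of UNIV e "\<lambda>j u. \<omega> k u $ j"])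
    show "smooth_on ?B (\<lambda>u. \<omega> k u $ j)" for j by (intro smooth_intros \<omega>) auto
    show "fd (\<lambda>u. \<omega> k u $ i) z (axis j 1) = fd (\<lambda>u. \<omega> k u $ j) z (axis i 1)" if "z \<in> ?B" for i j z
      using fd\<omega>[OF that] sym[of z i j] e(2) that by auto
  qed blast
  then obtain F where F: "\<And>k. smooth_on ?B (F k)" "\<And>k j z. z \<in> ?B \<Longrightarrow> fd (F k) z (axis j 1) = \<omega> k z $ j"
    by metis
  have fdF: "fd (F k) z v = \<omega> k z \<bullet> v" if "z \<in> ?B" for k z v
    using linear_eq_sum_axis[OF smooth_on_linear_fd[OF F(1) that], of k v] F(2)[OF that]
    by (simp add: inner_vec_def mult.commute)
  define \<phi> where "\<phi> u = (\<chi> k. F k u - F k 0)" for u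
  have \<phi>_smooth: "smooth_on ?B \<phi>"
    unfolding \<phi>_def[abs_def] by (intro smooth_intros F) auto
  have fd\<phi>: "fd \<phi> z v $ k = \<omega> k z \<bullet> v" if "z \<in> ?B" for z v k
  proof -
    have "fd \<phi> z v $ k = fd (\<lambda>u. F k u - F k 0) z v"
      using fd_nth[OF smooth_on_differentiable[OF \<phi>_smooth that], of k v] by (simp add: \<phi>_def)
    also have "\<dots> = fd (F k) z v"
      using fd_eq[OF has_derivative_diff[OF smooth_on_has_derivative[OF F(1) that] has_derivative_const]]
      by (simp add: fun_eq_iff)
    finally show ?thesis using fdF[OF that] by simp
  qed
  \<comment> \<open>In the coordinates \<open>\<phi>\<close> the Christoffel symbols become the
    difference of the two sides, so this equation says that those coordinates are affine.\<close>
  have second: "fd (\<lambda>u. fd \<phi> u (axis j 1)) u (axis i 1) = fd \<phi> u (G i j u)" if u: "u \<in> ?B" for u i j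
  proof (rule vec_eq_iff[THEN iffD2], rule allI)
    fix k
    have "fd (\<lambda>u. fd \<phi> u (axis j 1)) u (axis i 1) $ k = fd (\<lambda>u. fd \<phi> u (axis j 1) $ k) u (axis i 1)"
      using smooth_on_differentiable[OF smooth_on_fd_dir[OF \<phi>_smooth] u] by (simp add: fd_nth)
    also have "\<dots> = fd (\<lambda>u. \<omega> k u $ j) u (axis i 1)"
      by (subst fd_cong_open[OF open_ball u, of _ "\<lambda>u. \<omega> k u $ j"]) (simp_all add: fd\<phi> inner_axis)
    finally show "fd (\<lambda>u. fd \<phi> u (axis j 1)) u (axis i 1) $ k = fd \<phi> u (G i j u) $ k"
      using fd\<omega>[OF u] fd\<phi>[OF u] by simp
  qed
  have inj0: "v = 0" if "fd \<phi> 0 v = 0" for v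
    using that fd\<phi>[of 0 v] e(1) \<omega>(1) by (simp add: vec_eq_iff inner_axis')
  obtain U V \<psi> where U: "U \<subseteq> ?B" "0 \<in> U" "diffeo U V \<phi> \<psi>"
    by (rule smooth_inverse_function[OF \<phi>_smooth open_ball _ inj0]) (use e(1) in auto)
  have inj: "v = 0" if u: "u \<in> U" and v: "fd \<phi> u v = 0" for u v
  proof -
    have op: "open U" "\<phi> u \<in> V" using U(3) u by (auto simp: diffeo_def)
    have "((\<lambda>x. \<psi> (\<phi> x)) has_derivative (\<lambda>v. fd \<psi> (\<phi> u) (fd \<phi> u v))) (at u)"
      using U op u unfolding diffeo_def
      by (intro has_derivative_compose[OF smooth_on_has_derivative smooth_on_has_derivative]) auto
    moreover have "((\<lambda>x. \<psi> (\<phi> x)) has_derivative (\<lambda>v. v)) (at u)"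
      by (rule has_derivative_transform_within_open[OF has_derivative_ident op(1) u])
         (use U(3) in \<open>auto simp: diffeo_def\<close>)
    ultimately have "v = fd \<psi> (\<phi> u) (fd \<phi> u v)" using has_derivative_unique by metis
    moreover have "linear (fd \<psi> (\<phi> u))"
      using U(3) op smooth_on_linear_fd unfolding diffeo_def by blast
    ultimately show "v = 0" using v linear_0 by metis
  qed
  show thesis
    by (rule that[OF U(3,2)]) (use U(1) e(2) second inj in \<open>auto simp: \<phi>_def vec_eq_iff\<close>)
qed

section \<open>Leaves of a symmetric bivector field of constant rank\<close>

lemma bounded_bilinear_matrix_matrix_mult:
  "bounded_bilinear ((**) :: real ^ 'n ^ 'm \<Rightarrow> real ^ 'k ^ 'n \<Rightarrow> real ^ 'k ^ 'm)"
  unfolding bilinear_conv_bounded_bilinear[symmetric] bilinear_def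
  by (auto intro!: linearI
      simp: vec_eq_iff matrix_matrix_mult_def sum.distrib sum_distrib_left algebra_simps)

lemma bounded_bilinear_matrix_vector_mult:
  "bounded_bilinear ((*v) :: real ^ 'n ^ 'm \<Rightarrow> real ^ 'n \<Rightarrow> real ^ 'm)"
  unfolding bilinear_conv_bounded_bilinear[symmetric] bilinear_def
  by (auto intro!: linearI
      simp: vec_eq_iff matrix_vector_mult_def sum.distrib sum_distrib_left algebra_simps)

lemmas smooth_on_matrix_mult [smooth_intros] = smooth_on_bilinear[OF bounded_bilinear_matrix_matrix_mult]
lemmas smooth_on_matrix_vector_mult [smooth_intros] = smooth_on_bilinear[OF bounded_bilinear_matrix_vector_mult]

lemma fd_matrix_mult:
  fixes A :: "'a::real_normed_vector \<Rightarrow> real ^ 'n ^ 'm" and B :: "'a \<Rightarrow> real ^ 'k ^ 'n"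
  assumes "A differentiable at u" "B differentiable at u"
  shows "fd (\<lambda>u. A u ** B u) u v = A u ** fd B u v + fd A u v ** B u"
  using fd_eq[OF bounded_bilinear.FDERIV[OF bounded_bilinear_matrix_matrix_mult
      differentiable_fd[OF assms(1)] differentiable_fd[OF assms(2)]]] by (simp add: fun_eq_iff)

section \<open>Principal blocks of symmetric matrices\<close>

definition coord_mat :: "'n set \<Rightarrow> real ^ 'n ^ 'n" where
  "coord_mat I = (\<chi> a b. if a = b then (if a \<in> I then 1 else 0) else 0)"

lemma coord_mat_mult_nth: "(coord_mat I ** A) $ a $ b = (if a \<in> I then A $ a $ b else 0)"
  by (simp add: coord_mat_def matrix_matrix_mult_def if_distrib[of "\<lambda>x. x * _"] cong: if_cong)

lemma mult_coord_mat_nth: "(A ** coord_mat I) $ a $ b = (if b \<in> I then A $ a $ b else 0)"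
  by (simp add: coord_mat_def matrix_matrix_mult_def if_distrib[of "\<lambda>x. _ * x"] cong: if_cong)

lemma coord_mat_vector: "coord_mat I *v z = coord_proj I z"
  by (simp add: vec_eq_iff coord_mat_def coord_proj_def matrix_vector_mult_def
      if_distrib[of "\<lambda>x. x * _"] cong: if_cong)

lemma coord_mat_idem: "coord_mat I ** coord_mat I = coord_mat I"
  by (simp add: vec_eq_iff coord_mat_mult_nth) (simp add: coord_mat_def)

lemma transpose_coord_mat: "transpose (coord_mat I) = coord_mat I"
  by (auto simp: vec_eq_iff coord_mat_def transpose_def)

text \<open>The principal block over \<open>I\<close> is completed by the identity on the other
  coordinates. The full-size determinant is then the principal minor, and inverting this matrix
  inverts the block.\<close>

definition block :: "'n set \<Rightarrow> real ^ 'n ^ 'n \<Rightarrow> real ^ 'n ^ 'n" where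
  "block I H = coord_mat I ** H ** coord_mat I + (mat 1 - coord_mat I)"

lemma block_vector_nth:
  "(block I H *v t) $ a = (if a \<in> I then (H *v coord_proj I t) $ a else t $ a)"
proof -
  have "block I H *v t = coord_proj I (H *v coord_proj I t) + (t - coord_proj I t)"
    unfolding block_def
    by (simp add: matrix_vector_mult_add_rdistrib matrix_vector_mult_diff_rdistrib
        matrix_vector_mul_assoc[symmetric] coord_mat_vector)
  then show ?thesis by (simp add: coord_proj_def)
qed

lemma det_nz_iff_ker: "det A \<noteq> 0 \<longleftrightarrow> (\<forall>x. A *v x = 0 \<longrightarrow> x = 0)" for A :: "real ^ 'n ^ 'n"
  by (simp add: invertible_det_nz[symmetric] invertible_left_inverse matrix_left_invertible_ker)

lemma symmetric_mult_vector:
  fixes H :: "real ^ 'n ^ 'n"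
  assumes "transpose H = H"
  shows "H *v t = (\<Sum>i\<in>UNIV. t $ i *\<^sub>R H $ i)"
proof -
  have "H $ i $ j = H $ j $ i" for i j using arg_cong[OF assms, of "\<lambda>A. A $ j $ i"] by (simp add: transpose_def)
  then show ?thesis by (simp add: vec_eq_iff matrix_vector_mult_def mult.commute)
qed

text \<open>Rows forming a basis of the row space already carry a nonsingular principal block when
  \<open>H\<close> is symmetric. If \<open>t\<close> is supported on \<open>I\<close> and orthogonal
  to the rows in \<open>I\<close>, it is orthogonal to all rows, so \<open>H *v t = 0\<close>; by
  symmetry this is a linear relation among the rows in \<open>I\<close>, and
  \<open>t = 0\<close>.\<close>

lemma exists_invertible_block:
  fixes H :: "real ^ 'n ^ 'n"
  assumes sym: "transpose H = H"
  obtains I where "card I = rank H" "det (block I H) \<noteq> 0"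
proof -
  obtain B where B: "B \<subseteq> range (($) H)" "independent B" "range (($) H) \<subseteq> span B"
      "card B = dim (range (($) H))"
    by (rule basis_exists)
  have "rows H = range (($) H)" by (auto simp: rows_def row_def)
  then have cardB: "card B = rank H" using B(4) by (simp add: row_rank_def)
  obtain g where g: "\<And>v. v \<in> B \<Longrightarrow> H $ g v = v" using B(1) by (metis f_inv_into_f subsetD)
  define I where "I = g ` B"
  have inj: "inj_on g B" using g by (metis inj_onI)
  have finB: "finite B" using B(2) by (rule finiteI_independent)
  have "det (block I H) \<noteq> 0" unfolding det_nz_iff_ker
  proof (intro allI impI)
    fix t assume t: "block I H *v t = 0"
    have t_out: "t $ a = 0" if "a \<notin> I" for a
      using arg_cong[OF t, of "\<lambda>v. v $ a"] that by (simp add: block_vector_nth)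
    then have pt: "coord_proj I t = t" by (auto simp: vec_eq_iff coord_proj_def)
    have Ht: "H $ a \<bullet> t = (H *v t) $ a" for a
      by (simp add: matrix_vector_mult_def inner_vec_def)
    have "H $ a \<bullet> t = 0" if "a \<in> I" for a
      using arg_cong[OF t, of "\<lambda>v. v $ a"] that pt by (simp add: block_vector_nth Ht)
    then have "B \<subseteq> {v. v \<bullet> t = 0}" using g by (force simp: I_def)
    then have "span B \<subseteq> {v. v \<bullet> t = 0}"
      by (intro span_minimal) (auto simp: subspace_def inner_add_left)
    then have "H *v t = 0" using B(3) by (auto simp: vec_eq_iff Ht[symmetric])
    then have "0 = (\<Sum>i\<in>UNIV. t $ i *\<^sub>R H $ i)" using symmetric_mult_vector[OF sym] by simp
    also have "\<dots> = (\<Sum>i\<in>I. t $ i *\<^sub>R H $ i)"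
      by (rule sum.mono_neutral_right) (auto simp: t_out)
    also have "\<dots> = (\<Sum>v\<in>B. t $ g v *\<^sub>R v)"
      unfolding I_def by (subst sum.reindex[OF inj]) (simp add: g)
    finally have "t $ g v = 0" if "v \<in> B" for v
      using independentD[OF B(2) finB order_refl, of "\<lambda>v. t $ g v"] that by simp
    then have "t $ a = 0" for a using t_out by (cases "a \<in> I") (auto simp: I_def)
    then show "t = 0" by (simp add: vec_eq_iff)
  qed
  moreover have "card I = rank H" unfolding I_def using card_image[OF inj] cardB by simp
  ultimately show thesis using that by blast
qed

text \<open>On vectors supported on \<open>I\<close>, the \<open>I\<close>-entries of
  \<open>H *v t\<close> determine \<open>t\<close>. The images of the unit vectors in
  \<open>I\<close> are therefore \<open>card I\<close> independent vectors and, by the rank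
  hypothesis, span the range. Geometrically, the range is a graph over the coordinate plane of
  \<open>I\<close>.\<close>

lemma range_determined_by_block:
  fixes H :: "real ^ 'n ^ 'n"
  assumes rank: "rank H = card I" and det: "det (block I H) \<noteq> 0"
    and x: "x \<in> range ((*v) H)" "\<And>a. a \<in> I \<Longrightarrow> x $ a = 0"
  shows "x = 0"
proof -
  define S :: "(real ^ 'n) set" where "S = (\<lambda>i. axis i 1) ` I"
  have S: "independent S"
    unfolding S_def by (rule independent_mono[OF independent_Basis]) (auto simp: axis_in_Basis_iff)
  have supp: "span S \<subseteq> {t. coord_proj I t = t}"
  proof (rule span_minimal)
    show "S \<subseteq> {t. coord_proj I t = t}" by (auto simp: S_def coord_proj_axis)
    show "subspace {t. coord_proj I t = t}"
      by (auto simp: subspace_def linear_add[OF linear_coord_proj] linear_scale[OF linear_coord_proj]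
          linear_0[OF linear_coord_proj])
  qed
  have ker: "t = 0" if "t \<in> span S" "\<And>a. a \<in> I \<Longrightarrow> (H *v t) $ a = 0" for t
  proof -
    have pt: "coord_proj I t = t" using that supp by auto
    have "t $ a = 0" if "a \<notin> I" for a
      using arg_cong[OF pt, of "\<lambda>v. v $ a"] that by (simp add: coord_proj_def)
    then have "(block I H *v t) $ a = 0" for a using that(2) by (simp add: block_vector_nth pt)
    then have "block I H *v t = 0" by (simp add: vec_eq_iff)
    then show ?thesis using det det_nz_iff_ker by blast
  qed
  have lin: "linear ((*v) H)" by simp
  have inj: "inj_on ((*v) H) (span S)"
  proof (rule inj_onI)
    fix s t assume "s \<in> span S" "t \<in> span S" "H *v s = H *v t"
    then have "s - t = 0" by (intro ker) (auto simp: span_diff matrix_vector_mult_diff_distrib)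
    then show "s = t" by simp
  qed
  have ind: "independent ((*v) H ` S)"
    by (rule linear_independent_injective_image[OF lin S inj])
  have "inj_on ((*v) H) S" using inj inj_on_subset span_superset by blast
  then have "card ((*v) H ` S) = card S" by (rule card_image)
  also have "card S = card I" unfolding S_def by (rule card_image) (auto simp: inj_on_def axis_eq_axis)
  finally have "dim (range ((*v) H)) \<le> card ((*v) H ` S)" using rank by (simp add: rank_dim_range)
  then have "range ((*v) H) \<subseteq> span ((*v) H ` S)"
    by (intro card_ge_dim_independent[OF _ ind]) auto
  then have "x \<in> (*v) H ` span S" using x(1) by (simp add: linear_span_image[OF lin] subset_iff)
  then obtain t where t: "t \<in> span S" "x = H *v t" by blast
  then show ?thesis using ker[OF t(1)] x(2) by simp
qed

lemmas matrix_mult_diff_left = bounded_bilinear.diff_left[OF bounded_bilinear_matrix_matrix_mult]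
lemmas matrix_mult_diff_right = bounded_bilinear.diff_right[OF bounded_bilinear_matrix_matrix_mult]
lemmas matrix_mult_add_left = bounded_bilinear.add_left[OF bounded_bilinear_matrix_matrix_mult]

lemma mat_mult_left: "A ** B = C \<Longrightarrow> A ** (B ** X) = C ** (X :: real ^ 'n ^ 'n)"
  by (simp add: matrix_mul_assoc)

lemma smooth_on_block:
  fixes h :: "'a::real_normed_vector \<Rightarrow> real ^ 'n ^ 'n"
  shows "open S \<Longrightarrow> smooth_on S h \<Longrightarrow> smooth_on S (\<lambda>u. block I (h u))"
  unfolding block_def by (intro smooth_intros)

text \<open>\<open>M = block I H\<close> satisfies \<open>P M = M P = P H P\<close>, so its inverse
  \<open>G\<close> commutes with \<open>P\<close>, and \<open>K = P G\<close> inverts the principal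
  block on the range of \<open>P\<close> and is zero on the complementary coordinates. For symmetric
  \<open>H\<close>, transposing shows that \<open>transpose K\<close> inverts the block too;
  uniqueness of inverses gives the symmetry of \<open>K\<close>.\<close>

lemma block_inverse_algebra:
  fixes H :: "real ^ 'n ^ 'n" and I :: "'n set"
  defines "P \<equiv> coord_mat I" and "K \<equiv> coord_mat I ** matrix_inv (block I H) ** coord_mat I"
  assumes det: "det (block I H) \<noteq> 0"
  shows "P ** K = K" "K ** P = K" "K ** (H ** P) = P" "P ** (H ** K) = P"
    and "transpose H = H \<Longrightarrow> transpose K = K"
proof -
  define M G where "M = block I H" and "G = matrix_inv M"
  have PP: "P ** P = P" unfolding P_def by (rule coord_mat_idem)
  note PPX = mat_mult_left[OF PP]
  have PM: "P ** M = P ** (H ** P)" and MP: "M ** P = P ** (H ** P)"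
    unfolding M_def block_def P_def[symmetric]
    by (simp_all add: matrix_add_ldistrib matrix_mult_add_left matrix_mult_diff_left matrix_mult_diff_right
        matrix_mul_assoc[symmetric] PP PPX)
  have G: "M ** G = mat 1" "G ** M = mat 1"
    unfolding G_def using matrix_inv_eq det by (auto simp: M_def)
  have comm: "G ** P = P ** G"
  proof -
    have "G ** P = G ** ((P ** M) ** G)" using G by (simp add: matrix_mul_assoc[symmetric])
    also have "\<dots> = G ** ((M ** P) ** G)" by (simp add: PM MP)
    also have "\<dots> = (G ** M) ** (P ** G)" by (simp add: matrix_mul_assoc)
    finally show ?thesis by (simp add: G)
  qed
  have K: "K = P ** (G ** P)" "K = G ** P" "K = P ** G"
    unfolding K_def P_def[symmetric] M_def[symmetric] G_def[symmetric]
    by (simp_all add: comm matrix_mul_assoc[symmetric] PPX)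
  show PK: "P ** K = K" by (simp add: K(3) PPX)
  show KP: "K ** P = K" by (simp add: K(2) matrix_mul_assoc[symmetric] PP)
  show KHP: "K ** (H ** P) = P"
  proof -
    have "K ** (H ** P) = G ** (P ** (H ** P))" by (simp add: K(2) matrix_mul_assoc[symmetric])
    also have "\<dots> = (G ** M) ** P" unfolding MP[symmetric] by (rule matrix_mul_assoc)
    finally show ?thesis by (simp add: G)
  qed
  show PHK: "P ** (H ** K) = P"
  proof -
    have "P ** (H ** K) = (P ** (H ** P)) ** G" by (simp add: K(3) matrix_mul_assoc)
    also have "\<dots> = P ** (M ** G)" unfolding PM[symmetric] by (rule matrix_mul_assoc[symmetric])
    finally show ?thesis by (simp add: G)
  qed
  show "transpose K = K" if sym: "transpose H = H"
  proof -
    have tP: "transpose P = P" unfolding P_def by (rule transpose_coord_mat)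
    have tKP: "transpose K = P ** transpose K"
      using arg_cong[OF KP, of transpose] by (simp add: matrix_transpose_mul tP)
    have "P ** (H ** transpose K) = P"
      using arg_cong[OF KHP, of transpose] by (simp add: matrix_transpose_mul tP sym matrix_mul_assoc)
    then have "K ** P = (K ** P) ** (H ** transpose K)" by (simp add: matrix_mul_assoc[symmetric])
    also have "\<dots> = K ** (H ** (P ** transpose K))" using tKP by (simp add: KP)
    also have "\<dots> = (K ** (H ** P)) ** transpose K" by (simp add: matrix_mul_assoc)
    finally show ?thesis using tKP by (simp add: KHP KP)
  qed
qed

lemma matrix_eq_0I: "(\<And>y. A *v y = 0) \<Longrightarrow> A = 0" for A :: "real ^ 'n ^ 'm"
  by (simp add: matrix_eq)

lemma matrix_vector_mult_nth: "(A *v x) $ i = (\<Sum>j\<in>UNIV. A $ i $ j * x $ j)"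
  by (simp add: matrix_vector_mult_def)

lemma fd_matrix_mult_eq:
  fixes A :: "'a::real_normed_vector \<Rightarrow> real ^ 'n ^ 'm" and B :: "'a \<Rightarrow> real ^ 'k ^ 'n"
  assumes "open U" "u \<in> U" "A differentiable at u" "B differentiable at u"
    and "\<And>x. x \<in> U \<Longrightarrow> A x ** B x = C x"
  shows "A u ** fd B u v + fd A u v ** B u = fd C u v"
  using fd_matrix_mult[OF assms(3,4), of v] fd_cong_open[OF assms(1,2), of "\<lambda>x. A x ** B x" C] assms(5)
  by simp

lemma fd_matrix_vector_mult_const:
  fixes A :: "'a::real_normed_vector \<Rightarrow> real ^ 'n ^ 'm"
  assumes "A differentiable at u"
  shows "fd (\<lambda>u. A u *v y) u v = fd A u v *v y"
  using fd_eq[OF bounded_linear.has_derivative[OF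
      bounded_bilinear.bounded_linear_left[OF bounded_bilinear_matrix_vector_mult] differentiable_fd[OF assms]]]
  by (simp add: fun_eq_iff)

lemma inner_symmetric_matrix:
  fixes T :: "real ^ 'n ^ 'n"
  shows "transpose T = T \<Longrightarrow> c \<bullet> (T *v b) = (T *v c) \<bullet> b"
  by (metis dot_lmul_matrix vector_transpose_matrix)

text \<open>The Codazzi hypothesis exchanges the direction slot with the first matrix slot, while
  the symmetry of \<open>h\<close> exchanges the two matrix slots. The second conclusion combines
  them to exchange the direction with the argument vector; linearity passes from basis covectors to
  arbitrary \<open>a\<close> and \<open>b\<close>.\<close>

lemma codazzi_derivative:
  fixes h :: "real ^ 'n \<Rightarrow> real ^ 'n ^ 'n"
  assumes "smooth_on S h" "open S" and u: "u \<in> S"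
    and sym: "\<And>u. u \<in> S \<Longrightarrow> transpose (h u) = h u"
    and codazzi: "\<And>i j k. fd h u (h u $ i) $ j $ k = fd h u (h u $ j) $ i $ k"
  shows "transpose (fd h u w) = fd h u w"
    and "fd h u (h u *v a) *v b = fd h u (h u *v b) *v a"
proof -
  have d: "h differentiable at u" using assms smooth_on_differentiable by blast
  have sym_nth: "h x $ i $ j = h x $ j $ i" if "x \<in> S" for x i j
    using arg_cong[OF sym[OF that], of "\<lambda>A. A $ j $ i"] by (simp add: transpose_def)
  have fd_sym: "fd h u w $ i $ j = fd h u w $ j $ i" for w i j
  proof -
    have nn: "fd (\<lambda>x. h x $ i $ j) u w = fd h u w $ i $ j" for i j
      using fd_nth[OF differentiable_nth[OF d]] fd_nth[OF d] by metis
    have "fd (\<lambda>x. h x $ i $ j) u = fd (\<lambda>x. h x $ j $ i) u"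
      by (rule fd_cong_open[OF assms(2) u]) (rule sym_nth)
    then show ?thesis using nn by metis
  qed
  then show "transpose (fd h u w) = fd h u w" by (simp add: transpose_def vec_eq_iff)
  have lin: "linear (fd h u)" using d by (rule fd_linear)
  have A: "fd h u (h u *v a) $ c $ j = (\<Sum>i\<in>UNIV. a $ i * fd h u (h u $ i) $ c $ j)" for a c j
    unfolding symmetric_mult_vector[OF sym[OF u]]
    by (simp add: linear_sum[OF lin] linear_scale[OF lin])
  have "(fd h u (h u *v a) *v b) $ c = (fd h u (h u *v b) *v a) $ c" for c
  proof -
    have "(fd h u (h u *v a) *v b) $ c = (\<Sum>j\<in>UNIV. \<Sum>i\<in>UNIV. a $ i * b $ j * fd h u (h u $ i) $ c $ j)"
      by (simp add: matrix_vector_mult_nth A sum_distrib_left sum_distrib_right mult_ac)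
    also have "\<dots> = (\<Sum>i\<in>UNIV. \<Sum>j\<in>UNIV. b $ j * a $ i * fd h u (h u $ j) $ c $ i)"
      unfolding fd_sym[of _ c] codazzi[of _ _ c] by (subst sum.swap) (simp add: codazzi mult_ac)
    also have "\<dots> = (fd h u (h u *v b) *v a) $ c"
      by (simp add: matrix_vector_mult_nth A sum_distrib_left sum_distrib_right mult_ac)
    finally show ?thesis .
  qed
  then show "fd h u (h u *v a) *v b = fd h u (h u *v b) *v a" by (simp add: vec_eq_iff)
qed

text \<open>\<open>Q = h K\<close> is the projection onto the range of \<open>h\<close> along the coordinate plane \<open>I = 0\<close>. Its
  derivative vanishes in the directions of its range: the leaves of the characteristic distribution
  are affine subspaces.\<close>

lemma projection_derivative:
  fixes h :: "real ^ 'n \<Rightarrow> real ^ 'n ^ 'n" and I :: "'n set"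
  defines "K \<equiv> \<lambda>u. coord_mat I ** matrix_inv (block I (h u)) ** coord_mat I"
  defines "Q \<equiv> \<lambda>u. h u ** K u"
  assumes smooth: "smooth_on U h" "open U"
    and sym: "\<And>u. u \<in> U \<Longrightarrow> transpose (h u) = h u"
    and codazzi: "\<And>u i j k. u \<in> U \<Longrightarrow> fd h u (h u $ i) $ j $ k = fd h u (h u $ j) $ i $ k"
    and rank: "\<And>u. u \<in> U \<Longrightarrow> rank (h u) = card I"
    and det: "\<And>u. u \<in> U \<Longrightarrow> det (block I (h u)) \<noteq> 0"
  shows "smooth_on U K" "smooth_on U Q"
    and "\<And>u. u \<in> U \<Longrightarrow> Q u ** h u = h u"
    and "\<And>u. u \<in> U \<Longrightarrow> coord_mat I ** Q u = coord_mat I"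
    and "\<And>u. u \<in> U \<Longrightarrow> Q u ** coord_mat I = Q u"
    and "\<And>u y. u \<in> U \<Longrightarrow> fd Q u (Q u *v y) = 0"
    and "\<And>u w. u \<in> U \<Longrightarrow> fd K u w = - (K u ** (fd h u w ** K u))"
proof -
  let ?P = "coord_mat I"
  show K_smooth: "smooth_on U K"
    unfolding K_def by (intro smooth_intros smooth_on_block smooth det)
  then show Q_smooth: "smooth_on U Q"
    unfolding Q_def by (intro smooth_intros smooth)
  have alg: "?P ** K u = K u" "K u ** ?P = K u" "K u ** (h u ** ?P) = ?P" "?P ** (h u ** K u) = ?P"
    if "u \<in> U" for u
    using block_inverse_algebra(1-4)[OF det[OF that]] unfolding K_def by auto
  show PQ: "?P ** Q u = ?P" if "u \<in> U" for u using alg(4)[OF that] by (simp add: Q_def)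
  show QP: "Q u ** ?P = Q u" if "u \<in> U" for u
    using alg(2)[OF that] by (simp add: Q_def matrix_mul_assoc[symmetric])
  show Qh: "Q u ** h u = h u" if u: "u \<in> U" for u
  proof -
    \<comment> \<open>Both products lie in the range of \<open>h u\<close> and have the same
      \<open>I\<close>-entries, since \<open>P Q = P\<close>; constant rank makes a vector in the
      range with zero \<open>I\<close>-entries vanish.\<close>
    have "(Q u ** h u - h u) *v y = 0" for y
    proof (rule range_determined_by_block[OF rank[OF u] det[OF u]])
      have "(Q u ** h u - h u) *v y = h u *v (K u *v (h u *v y) - y)"
        by (simp add: Q_def matrix_vector_mult_diff_rdistrib matrix_vector_mult_diff_distrib
            matrix_vector_mul_assoc matrix_mul_assoc)
      then show "(Q u ** h u - h u) *v y \<in> range ((*v) (h u))" by simp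
      have P0: "?P *v ((Q u ** h u - h u) *v y) = 0"
        using mat_mult_left[OF PQ[OF u], of "h u"]
        by (simp add: matrix_vector_mult_diff_rdistrib matrix_vector_mult_diff_distrib matrix_vector_mul_assoc)
      then show "((Q u ** h u - h u) *v y) $ a = 0" if "a \<in> I" for a
        using that arg_cong[OF P0[unfolded coord_mat_vector coord_proj_def], of "\<lambda>v. v $ a"]
        by (simp only: vec_lambda_beta zero_index if_True)
    qed
    then have "Q u ** h u - h u = 0" by (rule matrix_eq_0I)
    then show ?thesis by simp
  qed
  have dh: "h differentiable at u" and dK: "K differentiable at u" and dQ: "Q differentiable at u"
    if "u \<in> U" for u
    using that smooth(1) K_smooth Q_smooth smooth_on_differentiable by blast+
  show "fd Q u (Q u *v y) = 0" if u: "u \<in> U" for u y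
  proof -
    define a where "a = K u *v y"
    define w where "w = h u *v a"
    have w: "Q u *v y = w" by (simp add: w_def a_def Q_def matrix_vector_mul_assoc)
    have cod: "transpose (fd h u w') = fd h u w'"
        "fd h u (h u *v a) *v b = fd h u (h u *v b) *v a" for w' a b
      using codazzi_derivative[OF smooth u sym codazzi[OF u]] by auto
    have QA: "Q u ** fd h u w = fd h u w"
    proof -
      have "\<gamma> \<bullet> ((fd h u w - Q u ** fd h u w) *v b) = 0" for \<gamma> b
      proof -
        \<comment> \<open>Subtracting \<open>\<gamma> v* Q u\<close> does not change the pairing
          with multiples of the complement of \<open>Q\<close> and puts the covector into the kernel
          of \<open>h u\<close>. Total symmetry then moves it into the direction slot, where it
          enters as \<open>h u *v \<gamma>' = 0\<close>.\<close>
        define \<gamma>' where "\<gamma>' = \<gamma> - \<gamma> v* Q u"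
        have "h u *v \<gamma>' = \<gamma> v* h u - \<gamma> v* (Q u ** h u)"
          using sym[OF u] by (simp add: \<gamma>'_def matrix_vector_mult_diff_distrib
              matrix_vector_mul_assoc matrix_transpose_mul flip: transpose_matrix_vector)
        then have h\<gamma>: "h u *v \<gamma>' = 0" using Qh[OF u] by simp
        have "\<gamma> \<bullet> ((fd h u w - Q u ** fd h u w) *v b) = \<gamma>' \<bullet> (fd h u w *v b)"
          by (simp add: \<gamma>'_def matrix_vector_mult_diff_rdistrib inner_diff_left inner_diff_right
              dot_lmul_matrix matrix_vector_mul_assoc)
        also have "\<dots> = (fd h u w *v \<gamma>') \<bullet> b" by (rule inner_symmetric_matrix[OF cod(1)])
        also have "fd h u w *v \<gamma>' = fd h u (h u *v \<gamma>') *v a" unfolding w_def by (rule cod(2))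
        also have "\<dots> = 0" using linear_0[OF fd_linear[OF dh[OF u]]] h\<gamma> by simp
        finally show ?thesis by simp
      qed
      then have "(fd h u w - Q u ** fd h u w) *v b = 0" for b using inner_eq_zero_iff by blast
      then have "fd h u w - Q u ** fd h u w = 0" by (rule matrix_eq_0I)
      then show ?thesis by simp
    qed
    \<comment> \<open>Differentiating \<open>Q h = h\<close> and cancelling with \<open>QA\<close>
      leaves \<open>dQ h = 0\<close>, hence \<open>dQ Q = 0\<close>.\<close>
    have "Q u ** fd h u w + fd Q u w ** h u = fd h u w"
      by (rule fd_matrix_mult_eq[OF smooth(2) u dQ[OF u] dh[OF u] Qh])
    then have "fd Q u w ** h u = 0" using QA by simp
    then have dQQ: "fd Q u w ** Q u = 0" by (simp add: Q_def matrix_mul_assoc)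
    \<comment> \<open>Idempotence now gives \<open>Q dQ = dQ\<close>. On the other hand
      \<open>P Q = P\<close> gives \<open>P dQ = 0\<close>, and \<open>Q = Q P\<close> gives
      \<open>Q dQ = Q P dQ = 0\<close>.\<close>
    have "Q x ** Q x = Q x" if "x \<in> U" for x
      using Qh[OF that] by (simp add: Q_def matrix_mul_assoc)
    then have "Q u ** fd Q u w + fd Q u w ** Q u = fd Q u w"
      by (rule fd_matrix_mult_eq[OF smooth(2) u dQ[OF u] dQ[OF u]])
    then have QdQ: "Q u ** fd Q u w = fd Q u w" using dQQ by simp
    have "?P ** fd Q u w + fd (\<lambda>_. ?P) u w ** Q u = fd (\<lambda>_. ?P) u w"
      by (rule fd_matrix_mult_eq[OF smooth(2) u _ dQ[OF u] PQ]) simp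
    then have "?P ** fd Q u w = 0" by simp
    then have "Q u ** fd Q u w = 0" using mat_mult_left[OF QP[OF u], of "fd Q u w"] by simp
    then show ?thesis using QdQ w by simp
  qed
  \<comment> \<open>\<open>K\<close> inverts \<open>h\<close> only up to \<open>P\<close>, so the
    usual formula for the derivative of an inverse comes from \<open>K h P = P\<close>, multiplied
    by \<open>K\<close> on the right. The factor \<open>h K\<close> after \<open>dK\<close>
    disappears because \<open>dK = dK P\<close> and \<open>P h K = P\<close>.\<close>
  show "fd K u w = - (K u ** (fd h u w ** K u))" if u: "u \<in> U" for u w
  proof -
    have dKh: "(\<lambda>u. K u ** h u) differentiable at u"
      using smooth_on_differentiable[OF smooth_on_matrix_mult[OF smooth(2) K_smooth smooth(1)] u] .
    have KhP: "(K x ** h x) ** ?P = ?P" if "x \<in> U" for x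
      using alg(3)[OF that] by (simp add: matrix_mul_assoc)
    have "(K u ** h u) ** fd (\<lambda>_. ?P) u w + fd (\<lambda>u. K u ** h u) u w ** ?P = fd (\<lambda>_. ?P) u w"
      by (rule fd_matrix_mult_eq[OF smooth(2) u dKh _ KhP]) simp
    then have "(K u ** fd h u w + fd K u w ** h u) ** ?P = 0"
      by (simp add: fd_matrix_mult[OF dK[OF u] dh[OF u]])
    then have "(K u ** fd h u w + fd K u w ** h u) ** (?P ** K u) = 0"
      by (metis matrix_mul_assoc times0_left)
    then have e: "K u ** (fd h u w ** K u) + fd K u w ** (h u ** K u) = 0"
      by (simp add: alg(1)[OF u] matrix_mult_add_left matrix_mul_assoc[symmetric])
    have "fd K u w ** ?P = fd K u w"
    proof -
      have "K u ** fd (\<lambda>_. ?P) u w + fd K u w ** ?P = fd K u w"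
        by (rule fd_matrix_mult_eq[OF smooth(2) u dK[OF u] _ alg(2)]) simp
      then show ?thesis by simp
    qed
    then have "fd K u w ** (h u ** K u) = fd K u w"
      using alg(4)[OF u] by (metis matrix_mul_assoc)
    then show ?thesis using e by (simp add: eq_neg_iff_add_eq_0 add.commute)
  qed
qed

text \<open>In the coordinates \<open>z = (x, y)\<close> the leaf through \<open>(0, y)\<close> is \<open>y + Q(y) x\<close>, and \<open>Q\<close> is constant on it;
  the \<open>I\<close>-block of \<open>h\<close> is inverted by \<open>K\<close>, whose restriction to each leaf is a Hessian matrix.\<close>

lemma hessian_leaf_coordinates:
  fixes h :: "real ^ 'n \<Rightarrow> real ^ 'n ^ 'n"
  assumes smooth: "smooth_on S h" and S: "open S" "0 \<in> S"
    and sym: "\<And>u. u \<in> S \<Longrightarrow> transpose (h u) = h u"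
    and codazzi: "\<And>u i j k. u \<in> S \<Longrightarrow> fd h u (h u $ i) $ j $ k = fd h u (h u $ j) $ i $ k"
    and rank: "\<And>u. u \<in> S \<Longrightarrow> rank (h u) = r"
  obtains I :: "'n set" and \<rho> V \<Phi> \<Psi> f where
    "card I = r" "\<rho> > 0" "diffeo (ball 0 \<rho>) V \<Phi> \<Psi>" "V \<subseteq> S" "\<Phi> 0 = 0" "smooth_on (ball 0 \<rho>) f"
    "\<And>u i j. u \<in> V \<Longrightarrow> i \<in> I \<Longrightarrow> j \<in> I \<Longrightarrow>
       fd (\<lambda>u. fd \<Phi> (\<Psi> u) (axis j 1)) u (fd \<Phi> (\<Psi> u) (axis i 1)) = 0"
    "\<And>u k l. u \<in> V \<Longrightarrow> h u $ k $ l =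
       (\<Sum>i\<in>I. \<Sum>j\<in>I. h u $ i $ j * (fd \<Phi> (\<Psi> u) (axis i 1) $ k * fd \<Phi> (\<Psi> u) (axis j 1) $ l))"
    "\<And>z. z \<in> ball 0 \<rho> \<Longrightarrow> inverse_matrices I (\<lambda>i j. h (\<Phi> z) $ i $ j)
       (\<lambda>i j. fd (\<lambda>z. fd f z (axis j 1)) z (axis i 1))"
proof -
  obtain I where I: "card I = rank (h 0)" "det (block I (h 0)) \<noteq> 0"
    using exists_invertible_block[OF sym[OF S(2)]] .
  \<comment> \<open>The rank is constant on \<open>S\<close>, but the chosen minor may vanish away
    from 0; \<open>U\<close> is where the same \<open>I\<close> serves.\<close>
  define U where "U = {u \<in> S. det (block I (h u)) \<noteq> 0}"
  have "U = S \<inter> (\<lambda>u. det (block I (h u))) -` (- {0})" by (auto simp: U_def)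
  moreover have "continuous_on S (\<lambda>u. det (block I (h u)))"
    by (intro smooth_on_continuous smooth_intros smooth_on_block smooth S)
  ultimately have U: "open U" "0 \<in> U" "U \<subseteq> S"
    using continuous_open_preimage[OF _ S(1), of "\<lambda>u. det (block I (h u))" "- {0}"] I(2) S(2)
    by (auto simp: U_def)
  let ?P = "coord_mat I"
  define K where "K u = ?P ** matrix_inv (block I (h u)) ** ?P" for u
  define Q where "Q u = h u ** K u" for u
  have hU: "smooth_on U h" using smooth_on_subset[OF smooth U(3)] .
  have symU: "transpose (h u) = h u"
    and codU: "\<And>i j k. fd h u (h u $ i) $ j $ k = fd h u (h u $ j) $ i $ k"
    and rankU: "rank (h u) = card I" and detU: "det (block I (h u)) \<noteq> 0" if "u \<in> U" for u
    using that U(3) S(2) sym codazzi rank I(1) by (auto simp: U_def)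
  note pd = projection_derivative[OF hU U(1) symU codU rankU detU, folded K_def Q_def]
  have K_smooth: "smooth_on U K" and Q_smooth: "smooth_on U Q"
    using pd(1,2) unfolding K_def[abs_def] Q_def[abs_def] by simp_all
  have Qh: "Q u ** h u = h u" and PQ: "?P ** Q u = ?P" and QP: "Q u ** ?P = Q u" if "u \<in> U" for u
    using pd(3-5)[OF _ _ _ _ that] by auto
  have dQ: "fd Q u (Q u *v y) = 0" and dK: "fd K u w = - (K u ** (fd h u w ** K u))"
    if "u \<in> U" for u y w
    using pd(6,7)[OF _ _ _ _ that] unfolding K_def[abs_def] Q_def[abs_def] by auto
  have alg: "?P ** K u = K u" "K u ** ?P = K u" "K u ** (h u ** ?P) = ?P" "?P ** (h u ** K u) = ?P"
    "transpose (K u) = K u" if "u \<in> U" for u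
    using block_inverse_algebra[OF detU[OF that]] symU[OF that] unfolding K_def by auto
  obtain R where R: "R > 0" "cball 0 R \<subseteq> U" using U open_contains_cball by blast
  obtain C where C: "C \<ge> 0" "\<And>u. u \<in> cball 0 R \<Longrightarrow> norm (Q u) \<le> C"
    by (rule smooth_on_bound_compact[OF Q_smooth compact_cball R(2)]) (rule that)
  obtain C1 where C1: "C1 \<ge> 0" "\<And>u v. u \<in> cball 0 R \<Longrightarrow> norm (fd Q u v) \<le> C1 * norm v"
    by (rule smooth_on_fd_bound_compact[OF Q_smooth compact_cball R(2)]) (rule that)
  obtain m where m: "m > 0" "\<And>A (x :: real ^ 'n). norm (A *v x :: real ^ 'n) \<le> norm A * norm x * m"
    using bounded_bilinear.pos_bounded[OF bounded_bilinear_matrix_vector_mult] by blast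
  \<comment> \<open>Since \<open>norm (Q u *v z) \<le> C * norm z * m\<close>, this radius keeps the
    whole segment from \<open>base z\<close> to \<open>\<Phi> z\<close> inside the ball where the
    bounds hold.\<close>
  define \<rho>0 where "\<rho>0 = R / (1 + C * m)"
  have \<rho>0: "\<rho>0 > 0" using R C m by (auto simp: \<rho>0_def intro!: divide_pos_pos add_pos_nonneg)
  define base where "base z = z - coord_proj I z" for z :: "real ^ 'n"
  have base_norm: "norm (base z) \<le> norm z" for z
    by (rule norm_le_componentwise_cart) (simp add: base_def coord_proj_def)
  have base_linear: "bounded_linear base"
    unfolding base_def[abs_def] by (intro bounded_linear_sub bounded_linear_ident bounded_linear_coord_proj)
  \<comment> \<open>\<open>base z\<close> is the \<open>y\<close>-part of \<open>z\<close>, and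
    applying \<open>Q\<close> to all of \<open>z\<close> amounts to applying it to the
    \<open>x\<close>-part because \<open>Q P = Q\<close>.\<close>
  define \<Phi> where "\<Phi> z = base z + Q (base z) *v z" for z
  have leaf_in: "base z + t *\<^sub>R (Q (base z) *v z) \<in> cball 0 R" if z: "z \<in> ball 0 \<rho>0" and t: "t \<in> {0..1}" for z t
  proof -
    have z_le: "norm z * (1 + C * m) \<le> R"
      using z R C m by (auto simp: \<rho>0_def pos_less_divide_eq add_pos_nonneg)
    have "norm z * 1 \<le> norm z * (1 + C * m)" using C m by (intro mult_left_mono) auto
    then have "base z \<in> cball 0 R" using base_norm[of z] z_le by auto
    then have "norm (Q (base z) *v z) \<le> C * norm z * m"
      using C m by (intro order_trans[OF m(2)] mult_right_mono) auto
    then have "norm (t *\<^sub>R (Q (base z) *v z)) \<le> C * norm z * m"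
      using t mult_left_le_one_le[of "norm (Q (base z) *v z)" "\<bar>t\<bar>"] by simp
    then have "norm (base z + t *\<^sub>R (Q (base z) *v z)) \<le> norm z + C * norm z * m"
      using norm_triangle_mono base_norm by blast
    then show ?thesis using z_le by (simp add: algebra_simps)
  qed
  have base_in: "base z \<in> U" if "z \<in> ball 0 \<rho>0" for z
    using leaf_in[OF that, of 0] R(2) by auto
  have \<Phi>_in: "\<Phi> z \<in> U" if "z \<in> ball 0 \<rho>0" for z
    using leaf_in[OF that, of 1] R(2) by (auto simp: \<Phi>_def)
  \<comment> \<open>Along the segment, the constant direction is
    \<open>Q (p t) *v z - D t *v z\<close>. The derivative of \<open>Q\<close> kills the first
    summand, so \<open>D\<close> satisfies a homogeneous Gronwall inequality and vanishes.\<close>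
  have Q_leaf: "Q (\<Phi> z) = Q (base z)" if z: "z \<in> ball 0 \<rho>0" for z
  proof -
    define p where "p t = base z + t *\<^sub>R (Q (base z) *v z)" for t
    define D where "D t = Q (p t) - Q (base z)" for t
    have "norm (D 1) \<le> 0 * exp (2 * (C1 * (norm z * m)) + 1)"
    proof (rule gronwall_from_zero[where D' = "\<lambda>t. fd Q (p t) (Q (base z) *v z)"])
      fix t :: real assume t: "t \<in> {0..1}"
      have pK: "p t \<in> cball 0 R" using leaf_in[OF z t] by (simp add: p_def)
      then have pU: "p t \<in> U" using R by auto
      have "(p has_derivative (\<lambda>h. h *\<^sub>R (Q (base z) *v z))) (at t within {0..1})"
        unfolding p_def by (auto intro!: derivative_eq_intros)
      from has_derivative_compose[OF this smooth_on_has_derivative[OF Q_smooth pU]]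
      have "((\<lambda>t. Q (p t)) has_derivative (\<lambda>h. h *\<^sub>R fd Q (p t) (Q (base z) *v z))) (at t within {0..1})"
        by (simp add: linear_scale[OF smooth_on_linear_fd[OF Q_smooth pU]])
      then show "(D has_vector_derivative fd Q (p t) (Q (base z) *v z)) (at t within {0..1})"
        unfolding D_def has_vector_derivative_def by (auto intro!: derivative_eq_intros)
      have "Q (base z) *v z = Q (p t) *v z - D t *v z"
        by (simp add: D_def matrix_vector_mult_diff_rdistrib)
      then have "fd Q (p t) (Q (base z) *v z) = - fd Q (p t) (D t *v z)"
        using linear_diff[OF smooth_on_linear_fd[OF Q_smooth pU]] dQ[OF pU] by simp
      then have "norm (fd Q (p t) (Q (base z) *v z)) \<le> C1 * norm (D t *v z)"
        using C1(2)[OF pK] by simp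
      also have "\<dots> \<le> C1 * (norm (D t) * norm z * m)" using C1(1) m(2) by (intro mult_left_mono)
      finally show "norm (fd Q (p t) (Q (base z) *v z)) \<le> C1 * (norm z * m) * norm (D t) + 0"
        by (simp add: mult_ac)
    qed (use C1 m in \<open>auto simp: D_def p_def\<close>)
    then show ?thesis by (simp add: D_def p_def \<Phi>_def)
  qed
  have \<Phi>_smooth: "smooth_on (ball 0 \<rho>0) \<Phi>"
    unfolding \<Phi>_def[abs_def]
    by (intro smooth_intros smooth_on_linear[OF base_linear] smooth_on_compose[OF Q_smooth]
          base_in open_ball)
  have d\<Phi>: "fd \<Phi> z v = base v + (Q (base z) *v v + fd Q (base z) (base v) *v z)"
    if z: "z \<in> ball 0 \<rho>0" for z v
  proof -
    have "((\<lambda>z. Q (base z)) has_derivative (\<lambda>v. fd Q (base z) (base v))) (at z)"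
      by (rule has_derivative_compose[OF bounded_linear_imp_has_derivative[OF base_linear]
            smooth_on_has_derivative[OF Q_smooth base_in[OF z]]])
    from bounded_bilinear.FDERIV[OF bounded_bilinear_matrix_vector_mult this has_derivative_ident]
    have "(\<Phi> has_derivative (\<lambda>v. base v + (Q (base z) *v v + fd Q (base z) (base v) *v z))) (at z)"
      unfolding \<Phi>_def[abs_def]
      by (intro has_derivative_add bounded_linear_imp_has_derivative[OF base_linear])
    then show ?thesis by (simp add: fd_eq)
  qed
  have base_axis: "base (axis i 1) = 0" if "i \<in> I" for i
    using that by (simp add: base_def coord_proj_axis)
  \<comment> \<open>Moving in an \<open>x\<close>-direction leaves \<open>base z\<close> unchanged,
    so only the explicit linear factor of \<open>\<Phi>\<close> is differentiated;
    \<open>Q_leaf\<close> then moves the evaluation point to \<open>\<Phi> z\<close>.\<close>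
  have d\<Phi>_axis: "fd \<Phi> z (axis i 1) = Q (\<Phi> z) *v axis i 1" if z: "z \<in> ball 0 \<rho>0" and i: "i \<in> I" for z i
    using linear_0[OF smooth_on_linear_fd[OF Q_smooth base_in[OF z]]]
    by (simp add: d\<Phi>[OF z] Q_leaf[OF z] base_axis[OF i])
  \<comment> \<open>The vector \<open>base v\<close> has no \<open>I\<close>-part, while the
    \<open>I\<close>-part of \<open>Q 0 *v v\<close> is that of \<open>v\<close>. Hence the
    \<open>x\<close>-part of a kernel vector vanishes, and then its \<open>y\<close>-part.\<close>
  have d\<Phi>0: "v = 0" if v: "fd \<Phi> 0 v = 0" for v
  proof -
    have "base 0 = 0" by (simp add: base_def linear_0[OF linear_coord_proj])
    then have e: "base v + Q 0 *v v = 0" using v d\<Phi>[of 0 v] \<rho>0 by simp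
    have "coord_proj I (base v) = 0"
      by (auto simp: base_def coord_proj_def vec_eq_iff)
    moreover have "coord_proj I (Q 0 *v v) = coord_proj I v"
      using PQ[OF U(2)] by (simp add: coord_mat_vector[symmetric] matrix_vector_mul_assoc)
    ultimately have pv: "coord_proj I v = 0"
      using arg_cong[OF e, of "coord_proj I"] linear_add[OF linear_coord_proj, of I "base v"]
      by (simp add: linear_0[OF linear_coord_proj])
    have "Q 0 *v v = (Q 0 ** ?P) *v v" using QP[OF U(2)] by simp
    also have "\<dots> = 0" using pv by (simp add: coord_mat_vector matrix_vector_mul_assoc[symmetric])
    finally show ?thesis using e pv by (simp add: base_def)
  qed
  have \<Phi>0: "\<Phi> 0 = 0" by (simp add: \<Phi>_def base_def linear_0[OF linear_coord_proj])
  have zero_in: "(0 :: real ^ 'n) \<in> ball 0 \<rho>0" using \<rho>0 by simp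
  obtain U' V' \<Psi> where U': "U' \<subseteq> ball 0 \<rho>0" "0 \<in> U'" "diffeo U' V' \<Phi> \<Psi>"
    by (rule smooth_inverse_function[OF \<Phi>_smooth open_ball zero_in d\<Phi>0])
  have "open U'" using U'(3) by (simp add: diffeo_def)
  \<comment> \<open>The Poincare lemma is stated on a ball about 0, so the parameter domain is
    shrunk to one.\<close>
  then obtain \<rho> where \<rho>: "\<rho> > 0" "ball 0 \<rho> \<subseteq> U'" using U'(2) openE by blast
  let ?B = "ball (0 :: real ^ 'n) \<rho>"
  define V where "V = \<Phi> ` ?B"
  have dif: "diffeo ?B V \<Phi> \<Psi>"
    unfolding V_def by (rule diffeo_restrict[OF U'(3) open_ball \<rho>(2)])
  have B0: "z \<in> ball 0 \<rho>0" if "z \<in> ?B" for z using that \<rho>(2) U'(1) by blast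
  have VU: "V \<subseteq> U" using \<Phi>_in B0 by (auto simp: V_def)
  have V: "open V" and \<Psi>: "\<And>u. u \<in> V \<Longrightarrow> \<Psi> u \<in> ?B \<and> \<Phi> (\<Psi> u) = u"
    using dif by (auto simp: diffeo_def)
  have E: "fd \<Phi> (\<Psi> u) (axis i 1) = Q u *v axis i 1" if "u \<in> V" "i \<in> I" for u i
    using d\<Phi>_axis[OF B0 that(2)] \<Psi>[OF that(1)] by auto
  have parallel: "fd (\<lambda>u. fd \<Phi> (\<Psi> u) (axis j 1)) u (fd \<Phi> (\<Psi> u) (axis i 1)) = 0"
    if u: "u \<in> V" and ij: "i \<in> I" "j \<in> I" for u i j
  proof -
    have uU: "u \<in> U" using u VU by blast
    have "fd (\<lambda>u. fd \<Phi> (\<Psi> u) (axis j 1)) u = fd (\<lambda>u. Q u *v axis j 1) u"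
      by (rule fd_cong_open[OF V u]) (rule E[OF _ ij(2)])
    then show ?thesis
      using fd_matrix_vector_mult_const[OF smooth_on_differentiable[OF Q_smooth uU]] dQ[OF uU] E[OF u ij(1)]
      by simp
  qed
  \<comment> \<open>From \<open>Q h = h\<close> and symmetry, \<open>h = Q h Q\<^sup>T\<close>. The
    columns of \<open>Q\<close> outside \<open>I\<close> are zero and those in \<open>I\<close> are
    the \<open>x\<close>-fields, so the coefficients are exactly the \<open>I\<close>-entries of
    \<open>h\<close>.\<close>
  have expand: "h u $ k $ l =
       (\<Sum>i\<in>I. \<Sum>j\<in>I. h u $ i $ j * (fd \<Phi> (\<Psi> u) (axis i 1) $ k * fd \<Phi> (\<Psi> u) (axis j 1) $ l))"
    if u: "u \<in> V" for u k l
  proof -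
    have uU: "u \<in> U" using u VU by blast
    have Q_axis: "(Q u *v axis i 1) $ k = Q u $ k $ i" for i k
      by (simp add: matrix_vector_mult_basis column_def)
    have Q_out: "Q u $ k $ i = 0" if "i \<notin> I" for i k
      using mult_coord_mat_nth[of "Q u" I k i] QP[OF uU] that by simp
    have hQ: "h u ** transpose (Q u) = h u"
      using arg_cong[OF Qh[OF uU], of transpose] symU[OF uU] by (simp add: matrix_transpose_mul)
    have "h u = Q u ** (h u ** transpose (Q u))" using hQ Qh[OF uU] by simp
    then have "h u $ k $ l = (Q u ** (h u ** transpose (Q u))) $ k $ l" by simp
    also have "\<dots> = (\<Sum>i\<in>UNIV. \<Sum>j\<in>UNIV. Q u $ k $ i * (h u $ i $ j * Q u $ l $ j))"
      by (simp add: matrix_matrix_mult_def transpose_def sum_distrib_left)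
    also have "\<dots> = (\<Sum>i\<in>I. \<Sum>j\<in>UNIV. Q u $ k $ i * (h u $ i $ j * Q u $ l $ j))"
      by (rule sum.mono_neutral_right) (auto simp: Q_out)
    also have "\<dots> = (\<Sum>i\<in>I. \<Sum>j\<in>I. Q u $ k $ i * (h u $ i $ j * Q u $ l $ j))"
      by (intro sum.cong refl sum.mono_neutral_right) (auto simp: Q_out)
    also have "\<dots> = (\<Sum>i\<in>I. \<Sum>j\<in>I. h u $ i $ j * (fd \<Phi> (\<Psi> u) (axis i 1) $ k * fd \<Phi> (\<Psi> u) (axis j 1) $ l))"
      by (intro sum.cong refl) (simp add: E[OF u] Q_axis)
    finally show ?thesis .
  qed
  \<comment> \<open>By \<open>dK\<close>, the left side is minus the totally symmetric tensor
    evaluated on the columns \<open>\<kappa> l\<close>, \<open>\<kappa> j\<close>,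
    \<open>\<kappa> k\<close>: the direction \<open>Q u *v axis l 1\<close> is
    \<open>h u *v \<kappa> l\<close>.\<close>
  have dKsym: "fd K u (Q u *v axis l 1) $ j $ k = fd K u (Q u *v axis j 1) $ l $ k" if u: "u \<in> U" for u l j k
  proof -
    define \<kappa> where "\<kappa> i = K u *v axis i 1" for i
    have cod: "transpose (fd h u w) = fd h u w"
        "fd h u (h u *v a) *v b = fd h u (h u *v b) *v a" for w a b
      using codazzi_derivative[OF hU U(1) u symU codU[OF u]] by auto
    have nth: "(K u ** (T ** K u)) $ j $ k = \<kappa> j \<bullet> (T *v \<kappa> k)" for T j k
    proof -
      have "(K u ** (T ** K u)) $ j $ k = axis j 1 \<bullet> ((K u ** (T ** K u)) *v axis k 1)"
        by (simp add: matrix_vector_mult_basis column_def inner_axis')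
      also have "\<dots> = axis j 1 \<bullet> (K u *v (T *v \<kappa> k))"
        by (simp add: \<kappa>_def matrix_vector_mul_assoc matrix_mul_assoc)
      also have "\<dots> = \<kappa> j \<bullet> (T *v \<kappa> k)"
        unfolding \<kappa>_def by (rule inner_symmetric_matrix[OF alg(5)[OF u]])
      finally show ?thesis .
    qed
    have d: "fd K u (Q u *v axis l 1) $ j $ k = - (\<kappa> j \<bullet> (fd h u (h u *v \<kappa> l) *v \<kappa> k))" for l j k
    proof -
      have "Q u *v axis l 1 = h u *v \<kappa> l" by (simp add: \<kappa>_def Q_def matrix_vector_mul_assoc)
      then show ?thesis using dK[OF u] nth by simp
    qed
    have "\<kappa> j \<bullet> (fd h u (h u *v \<kappa> l) *v \<kappa> k) = \<kappa> j \<bullet> (fd h u (h u *v \<kappa> k) *v \<kappa> l)"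
      by (simp add: cod(2)[of "\<kappa> l"])
    also have "\<dots> = (fd h u (h u *v \<kappa> k) *v \<kappa> j) \<bullet> \<kappa> l" by (rule inner_symmetric_matrix[OF cod(1)])
    also have "\<dots> = \<kappa> l \<bullet> (fd h u (h u *v \<kappa> j) *v \<kappa> k)"
      by (simp add: cod(2)[of "\<kappa> k"] inner_commute)
    finally show ?thesis by (simp add: d)
  qed
  define g where "g j k z = K (\<Phi> z) $ j $ k" for j k z
  have g_smooth: "smooth_on ?B (g j k)" for j k
    unfolding g_def[abs_def]
    by (intro smooth_intros open_ball smooth_on_compose[OF K_smooth] smooth_on_subset[OF \<Phi>_smooth])
       (use \<Phi>_in B0 in auto)
  have g_sym: "g j k z = g k j z" if "z \<in> ?B" for j k z
    using arg_cong[OF alg(5)[OF \<Phi>_in[OF B0[OF that]]], of "\<lambda>A. A $ k $ j"]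
    by (simp add: g_def transpose_def)
  have dg: "fd (g j k) z (axis l 1) = fd (g l k) z (axis j 1)" if z: "z \<in> ?B" and jl: "j \<in> I" "l \<in> I" for j k l z
  proof -
    have "fd (g j k) z (axis l 1) = fd K (\<Phi> z) (Q (\<Phi> z) *v axis l 1) $ j $ k" if "l \<in> I" for j l
    proof -
      have d: "((\<lambda>z. K (\<Phi> z)) has_derivative (\<lambda>v. fd K (\<Phi> z) (fd \<Phi> z v))) (at z)"
        by (rule has_derivative_compose[OF smooth_on_has_derivative[OF \<Phi>_smooth B0[OF z]]
              smooth_on_has_derivative[OF K_smooth \<Phi>_in[OF B0[OF z]]]])
      then have "(\<lambda>z. K (\<Phi> z)) differentiable at z" by (rule differentiableI)
      then have "fd (g j k) z (axis l 1) = fd (\<lambda>z. K (\<Phi> z)) z (axis l 1) $ j $ k"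
        unfolding g_def[abs_def] by (simp add: fd_nth differentiable_nth)
      then show ?thesis using fd_eq[OF d] d\<Phi>_axis[OF B0[OF z] that] by simp
    qed
    then show ?thesis using dKsym[OF \<Phi>_in[OF B0[OF z]]] jl by simp
  qed
  \<comment> \<open>For fixed \<open>k\<close>, the entries \<open>g j k\<close> form a closed
    one-form along the leaves with potential \<open>F k\<close>. The symmetry of \<open>K\<close>
    makes the \<open>F k\<close> the components of another closed form; its potential
    \<open>f\<close> has Hessian \<open>K\<close> in the \<open>x\<close>-directions.\<close>
  have "\<exists>F. smooth_on ?B F \<and> (\<forall>j\<in>I. \<forall>z\<in>?B. fd F z (axis j 1) = g j k z)" for k
    by (rule partial_poincare[of I \<rho> "\<lambda>j. g j k"]) (use g_smooth dg in auto)
  then obtain F where F: "\<And>k. smooth_on ?B (F k)"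
      "\<And>k j z. j \<in> I \<Longrightarrow> z \<in> ?B \<Longrightarrow> fd (F k) z (axis j 1) = g j k z" by metis
  obtain f where f: "smooth_on ?B f" "\<And>j z. j \<in> I \<Longrightarrow> z \<in> ?B \<Longrightarrow> fd f z (axis j 1) = F j z"
  proof (rule partial_poincare[of I \<rho> F])
    show "fd (F i) z (axis j 1) = fd (F j) z (axis i 1)" if "i \<in> I" "j \<in> I" "z \<in> ?B" for i j z
      using F(2) that g_sym by simp
  qed (use F in auto)
  have hess: "fd (\<lambda>z. fd f z (axis j 1)) z (axis i 1) = K (\<Phi> z) $ i $ j"
    if z: "z \<in> ?B" and ij: "i \<in> I" "j \<in> I" for z i j
  proof -
    have "fd (\<lambda>z. fd f z (axis j 1)) z = fd (F j) z"
      by (rule fd_cong_open[OF open_ball z]) (rule f(2)[OF ij(2)])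
    then show ?thesis using F(2)[OF ij(1) z] by (simp add: g_def)
  qed
  have inv: "inverse_matrices I (\<lambda>i j. h (\<Phi> z) $ i $ j)
       (\<lambda>i j. fd (\<lambda>z. fd f z (axis j 1)) z (axis i 1))" if z: "z \<in> ?B" for z
    unfolding inverse_matrices_def
  proof (intro ballI conjI)
    fix i j assume ij: "i \<in> I" "j \<in> I"
    have u: "\<Phi> z \<in> U" using \<Phi>_in[OF B0[OF z]] .
    let ?h = "h (\<Phi> z)" and ?K = "K (\<Phi> z)"
    have P_ij: "?P $ i $ j = (if i = j then 1 else 0)" using ij by (simp add: coord_mat_def)
    have "(?P ** (?h ** ?K)) $ i $ j = (\<Sum>k\<in>UNIV. ?h $ i $ k * (?P ** ?K) $ k $ j)"
      using ij alg(1)[OF u] by (simp add: coord_mat_mult_nth) (simp add: matrix_matrix_mult_def)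
    also have "\<dots> = (\<Sum>k\<in>I. ?h $ i $ k * ?K $ k $ j)"
      by (rule sum.mono_neutral_cong_right) (auto simp: coord_mat_mult_nth)
    finally show "(\<Sum>k\<in>I. ?h $ i $ k * fd (\<lambda>z. fd f z (axis j 1)) z (axis k 1)) = (if i = j then 1 else 0)"
      using alg(4)[OF u] P_ij ij hess[OF z] by simp
    have "(?K ** (?h ** ?P)) $ i $ j = (\<Sum>k\<in>UNIV. (?K ** ?P) $ i $ k * ?h $ k $ j)"
      using ij alg(2)[OF u] by (simp add: matrix_mul_assoc mult_coord_mat_nth) (simp add: matrix_matrix_mult_def)
    also have "\<dots> = (\<Sum>k\<in>I. ?K $ i $ k * ?h $ k $ j)"
      by (rule sum.mono_neutral_cong_right) (auto simp: mult_coord_mat_nth)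
    finally show "(\<Sum>k\<in>I. fd (\<lambda>z. fd f z (axis k 1)) z (axis i 1) * ?h $ k $ j) = (if i = j then 1 else 0)"
      using alg(3)[OF u] P_ij ij hess[OF z] by simp
  qed
  show thesis
    by (rule that[OF _ \<rho>(1) dif _ \<Phi>0 f(1) parallel expand inv])
       (use I(1) rank[OF S(2)] VU U(3) in auto)
qed

section \<open>Charts and tensor fields\<close>

locale smooth_mfd =
  fixes X :: "'m topology" and A :: "('m, 'n::finite) chart set"
  assumes smooth_manifold: "smooth_manifold X A"
begin

lemma is_chart: "c \<in> A \<Longrightarrow> is_chart X c"
  and compatible: "c \<in> A \<Longrightarrow> d \<in> A \<Longrightarrow> compatible c d"
  and charts_cover: "(\<Union>c\<in>A. fst c) = topspace X"
  and maximal: "is_chart X c \<Longrightarrow> (\<And>d. d \<in> A \<Longrightarrow> compatible c d) \<Longrightarrow> c \<in> A"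
  and hausdorff: "Hausdorff_space X"
  using smooth_manifold unfolding smooth_manifold_def by blast+

lemma open_dom: "c \<in> A \<Longrightarrow> openin X (fst c)"
  using is_chart unfolding is_chart_def by blast

lemma dom_subset: "c \<in> A \<Longrightarrow> fst c \<subseteq> topspace X"
  using open_dom openin_subset by blast

lemma chart_homeo: "c \<in> A \<Longrightarrow> homeomorphic_map (subtopology X (fst c)) (top_of_set (snd c ` fst c)) (snd c)"
  using is_chart unfolding is_chart_def by blast

lemma chart_inj: "c \<in> A \<Longrightarrow> inj_on (snd c) (fst c)"
  using homeomorphic_imp_injective_map[OF chart_homeo, of c] dom_subset[of c]
  by (simp add: Int_absorb1)

lemma cinv_chart [simp]: "c \<in> A \<Longrightarrow> p \<in> fst c \<Longrightarrow> cinv c (snd c p) = p"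
  unfolding cinv_def by (intro inv_into_f_f chart_inj)

lemma cimageI: "p \<in> fst c \<Longrightarrow> p \<in> W \<Longrightarrow> snd c p \<in> cimage c W"
  by (auto simp: cimage_def)

lemma cimageD:
  assumes "c \<in> A" "u \<in> cimage c W"
  shows "cinv c u \<in> fst c" "cinv c u \<in> W" "snd c (cinv c u) = u"
  using assms by (auto simp: cimage_def)

lemma cimage_self: "cimage c (fst c) = snd c ` fst c"
  by (simp add: cimage_def)

lemma cimage_mono: "W \<subseteq> W' \<Longrightarrow> cimage c W \<subseteq> cimage c W'"
  by (auto simp: cimage_def)

lemma open_cimage:
  assumes "c \<in> A" "openin X W"
  shows "open (cimage c W)"
proof -
  have "openin (subtopology X (fst c)) (fst c \<inter> W)"
    using assms(2) by (auto simp: openin_subtopology Int_commute)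
  then have "openin (top_of_set (snd c ` fst c)) (snd c ` (fst c \<inter> W))"
    using homeomorphic_imp_open_map[OF chart_homeo[OF assms(1)]] by (simp add: open_map_def)
  moreover have "open (snd c ` fst c)" using is_chart[OF assms(1)] by (simp add: is_chart_def)
  ultimately show ?thesis unfolding cimage_def using openin_open_trans by blast
qed

lemma open_image: "c \<in> A \<Longrightarrow> open (snd c ` fst c)"
  using is_chart by (simp add: is_chart_def)

lemma transition_eq: "transition c d u = snd d (cinv c u)"
  by (simp add: transition_def)

lemma transition_smooth: "c \<in> A \<Longrightarrow> d \<in> A \<Longrightarrow> smooth_on (cimage c (fst d)) (transition c d)"
  using compatible unfolding compatible_def by blast

lemma transition_chart [simp]: "c \<in> A \<Longrightarrow> p \<in> fst c \<Longrightarrow> transition c d (snd c p) = snd d p"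
  by (simp add: transition_eq)

lemma has_derivative_transition:
  assumes "c \<in> A" "d \<in> A" "p \<in> fst c" "p \<in> fst d"
  shows "(transition c d has_derivative dtransition c d p) (at (snd c p))"
  unfolding dtransition_def
  by (rule smooth_on_has_derivative[OF transition_smooth[OF assms(1,2)] cimageI[OF assms(3,4)]])

lemma linear_dtransition:
  assumes "c \<in> A" "d \<in> A" "p \<in> fst c" "p \<in> fst d"
  shows "linear (dtransition c d p)"
  by (rule has_derivative_linear[OF has_derivative_transition[OF assms]])

lemma dtransition_self [simp]:
  assumes "c \<in> A" "p \<in> fst c"
  shows "dtransition c c p = (\<lambda>v. v)"
proof -
  have "fd (transition c c) (snd c p) = fd (\<lambda>u. u) (snd c p)"
    by (rule fd_cong_open[OF open_cimage[OF assms(1) open_dom[OF assms(1)]] cimageI[OF assms(2,2)]])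
       (use assms cimageD in \<open>auto simp: transition_eq\<close>)
  then show ?thesis by (simp add: dtransition_def)
qed

lemma dtransition_chain:
  assumes "c \<in> A" "d \<in> A" "e \<in> A" "p \<in> fst c" "p \<in> fst d" "p \<in> fst e"
  shows "dtransition d e p (dtransition c d p v) = dtransition c e p v"
proof -
  let ?W = "cimage c (fst d \<inter> fst e)"
  have op: "open ?W" by (intro open_cimage openin_Int open_dom assms)
  have "((\<lambda>u. transition d e (transition c d u)) has_derivative
      (\<lambda>v. dtransition d e p (dtransition c d p v))) (at (snd c p))"
    by (rule has_derivative_compose[OF has_derivative_transition])
       (use assms has_derivative_transition[of d e p] in auto)
  then have "fd (\<lambda>u. transition d e (transition c d u)) (snd c p) = (\<lambda>v. dtransition d e p (dtransition c d p v))"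
    by (rule fd_eq)
  moreover have "fd (\<lambda>u. transition d e (transition c d u)) (snd c p) = fd (transition c e) (snd c p)"
  proof (rule fd_cong_open[OF op])
    show "snd c p \<in> ?W" using assms by (intro cimageI) auto
    show "transition d e (transition c d u) = transition c e u" if "u \<in> ?W" for u
      using cimageD[OF assms(1) that] assms by (simp add: transition_eq)
  qed
  ultimately show ?thesis by (simp add: dtransition_def)
qed

lemma dtransition_inverse:
  assumes "c \<in> A" "d \<in> A" "p \<in> fst c" "p \<in> fst d"
  shows "dtransition d c p (dtransition c d p v) = v"
  using dtransition_chain[OF assms(1,2,1) assms(3,4,3)] assms by simp

lemma some_chart:
  assumes "p \<in> topspace X"
  shows "some_chart A p \<in> A" "p \<in> fst (some_chart A p)"
proof -
  have "\<exists>c. c \<in> A \<and> p \<in> fst c" using assms charts_cover by blast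
  then have "some_chart A p \<in> A \<and> p \<in> fst (some_chart A p)"
    unfolding some_chart_def by (rule someI_ex)
  then show "some_chart A p \<in> A" "p \<in> fst (some_chart A p)" by auto
qed

section \<open>Independence of the chart\<close>

lemma smooth_on_change_chart:
  fixes g :: "'m \<Rightarrow> 'b::real_normed_vector"
  assumes c: "c \<in> A" and d: "d \<in> A" and W: "openin X W" "W \<subseteq> fst c"
    and g: "smooth_on (cimage c W) (\<lambda>u. g (cinv c u))"
  shows "smooth_on (cimage d W) (\<lambda>u. g (cinv d u))"
proof (rule smooth_on_cong[OF open_cimage[OF d W(1)]])
  have sub: "cimage d W \<subseteq> cimage d (fst c)" by (rule cimage_mono[OF W(2)])
  show "smooth_on (cimage d W) (\<lambda>u. g (cinv c (transition d c u)))"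
    by (rule smooth_on_compose[OF g open_cimage[OF d W(1)] smooth_on_subset[OF transition_smooth[OF d c] sub]])
       (use cimageD[OF d] W(2) in \<open>auto simp: transition_eq intro!: cimageI\<close>)
  show "g (cinv c (transition d c u)) = g (cinv d u)" if "u \<in> cimage d W" for u
    using cimageD[OF d that] W(2) c by (simp add: transition_eq subset_iff)
qed

lemma smooth_funI:
  assumes "c \<in> A" "openin X W" "W \<subseteq> fst c" "smooth_on (cimage c W) (\<lambda>u. g (cinv c u))"
  shows "smooth_fun A W g"
  unfolding smooth_fun_def o_def using smooth_on_change_chart assms by blast

lemma fd_change_chart:
  fixes g :: "'m \<Rightarrow> 'b::real_normed_vector"
  assumes "c \<in> A" "d \<in> A" "p \<in> fst c" "p \<in> fst d"
    and "(\<lambda>u. g (cinv d u)) differentiable at (snd d p)"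
  shows "fd (\<lambda>u. g (cinv c u)) (snd c p) v = fd (\<lambda>u. g (cinv d u)) (snd d p) (dtransition c d p v)"
proof -
  have "((\<lambda>u. g (cinv d (transition c d u))) has_derivative
      (\<lambda>v. fd (\<lambda>u. g (cinv d u)) (snd d p) (dtransition c d p v))) (at (snd c p))"
    by (rule has_derivative_compose[OF has_derivative_transition[OF assms(1-4)]])
       (use assms differentiable_fd in simp)
  from fd_eq[OF this] have "fd (\<lambda>u. g (cinv d (transition c d u))) (snd c p) v =
      fd (\<lambda>u. g (cinv d u)) (snd d p) (dtransition c d p v)" by simp
  moreover have "fd (\<lambda>u. g (cinv d (transition c d u))) (snd c p) = fd (\<lambda>u. g (cinv c u)) (snd c p)"
    by (rule fd_cong_open[OF open_cimage[OF assms(1) open_dom[OF assms(2)]] cimageI[OF assms(3,4)]])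
       (use assms(2) cimageD[OF assms(1)] in \<open>auto simp: transition_eq\<close>)
  ultimately show ?thesis by simp
qed

text \<open>The transformation law at a single point, apart from smoothness and from any open set,
  is all that evaluating a scalar at that point in another chart requires.\<close>

definition vector_law :: "('m, 'n) vfield \<Rightarrow> 'm \<Rightarrow> bool" where
  "vector_law V p \<longleftrightarrow> (\<forall>c\<in>A. \<forall>d\<in>A. p \<in> fst c \<longrightarrow> p \<in> fst d \<longrightarrow> V d p = dtransition c d p (V c p))"

definition form_law :: "('m, 'n) form \<Rightarrow> 'm \<Rightarrow> bool" where
  "form_law \<alpha> p \<longleftrightarrow> (\<forall>c\<in>A. \<forall>d\<in>A. p \<in> fst c \<longrightarrow> p \<in> fst d \<longrightarrow>
     (\<forall>v. \<alpha> c p \<bullet> v = \<alpha> d p \<bullet> dtransition c d p v))"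

definition bivector_law :: "('m, 'n) bifield \<Rightarrow> 'm \<Rightarrow> bool" where
  "bivector_law h p \<longleftrightarrow> (\<forall>c\<in>A. \<forall>d\<in>A. p \<in> fst c \<longrightarrow> p \<in> fst d \<longrightarrow>
     h d p = matrix (dtransition c d p) ** h c p ** transpose (matrix (dtransition c d p)))"

lemma vector_field_on_iff:
  "vector_field_on A W V \<longleftrightarrow> smooth_components A W V \<and> (\<forall>p\<in>W. vector_law V p)"
  unfolding vector_field_on_def vector_law_def by blast

lemma one_form_on_iff:
  "one_form_on A W \<alpha> \<longleftrightarrow> smooth_components A W \<alpha> \<and> (\<forall>p\<in>W. form_law \<alpha> p)"
  unfolding one_form_on_def form_law_def by blast

lemma bivector_field_on_iff:
  "bivector_field_on A W h \<longleftrightarrow> smooth_components A W h \<and> (\<forall>p\<in>W. bivector_law h p)"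
  unfolding bivector_field_on_def bivector_law_def by blast

text \<open>The definition evaluates in the chart picked by \<open>some_chart\<close>. The two laws
  allow any chart containing the point, which is what computations near a point require, since the
  picked chart may vary with the point.\<close>

lemma pairing_chart:
  assumes "c \<in> A" "p \<in> fst c" "form_law \<alpha> p" "vector_law V p"
  shows "pairing A \<alpha> V p = \<alpha> c p \<bullet> V c p"
proof -
  have s: "some_chart A p \<in> A" "p \<in> fst (some_chart A p)"
    using some_chart dom_subset[OF assms(1)] assms(2) by auto
  then have "V c p = dtransition (some_chart A p) c p (V (some_chart A p) p)"
    using assms unfolding vector_law_def by blast
  moreover have "\<alpha> (some_chart A p) p \<bullet> V (some_chart A p) p =
      \<alpha> c p \<bullet> dtransition (some_chart A p) c p (V (some_chart A p) p)"
    using s assms unfolding form_law_def by blast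
  ultimately show ?thesis by (simp add: pairing_def)
qed

lemma dir_deriv_chart:
  assumes "c \<in> A" "p \<in> fst c" "vector_law V p" "(\<lambda>u. g (cinv c u)) differentiable at (snd c p)"
  shows "dir_deriv A V g p = fd (\<lambda>u. g (cinv c u)) (snd c p) (V c p)"
proof -
  have s: "some_chart A p \<in> A" "p \<in> fst (some_chart A p)"
    using some_chart dom_subset[OF assms(1)] assms(2) by auto
  then have V: "V c p = dtransition (some_chart A p) c p (V (some_chart A p) p)"
    using assms(1-3) unfolding vector_law_def by blast
  show ?thesis
    unfolding dir_deriv_def Let_def o_def V
    by (rule fd_change_chart[OF s(1) assms(1) s(2) assms(2,4)])
qed

lemma bieval_eq: "bieval A h \<alpha> \<beta> p =
    \<alpha> (some_chart A p) p \<bullet> (h (some_chart A p) p *v \<beta> (some_chart A p) p)"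
  by (simp add: bieval_def Let_def inner_vec_def matrix_vector_mult_def sum_distrib_left mult_ac)

text \<open>Stated for single covectors related by the transposed derivative rather than for
  one-forms, so that it also applies to values of \<open>covd_form\<close>, which are known only
  through their pairings with vectors.\<close>

lemma bivector_law_eval:
  assumes "bivector_law h p" "c \<in> A" "d \<in> A" "p \<in> fst c" "p \<in> fst d"
    and a: "\<And>v. a \<bullet> v = a' \<bullet> dtransition c d p v" and b: "\<And>v. b \<bullet> v = b' \<bullet> dtransition c d p v"
  shows "a' \<bullet> (h d p *v b') = a \<bullet> (h c p *v b)"
proof -
  let ?T = "matrix (dtransition c d p)"
  have T: "?T *v v = dtransition c d p v" for v
    by (rule matrix_works_linear[OF linear_dtransition[OF assms(2-5)]])
  have pull: "x = x' v* ?T" if "\<And>v. x \<bullet> v = x' \<bullet> dtransition c d p v" for x x'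
  proof -
    have "x \<bullet> v = (x' v* ?T) \<bullet> v" for v using that by (simp add: dot_lmul_matrix T)
    then show ?thesis by (rule vector_eq_rdot[THEN iffD1, rule_format])
  qed
  have "h d p = ?T ** h c p ** transpose ?T" using assms unfolding bivector_law_def by blast
  then have "a' \<bullet> (h d p *v b') = a' \<bullet> (?T *v (h c p *v (transpose ?T *v b')))"
    by (simp only: matrix_vector_mul_assoc matrix_mul_assoc)
  also have "\<dots> = (a' v* ?T) \<bullet> (h c p *v (b' v* ?T))"
    by (simp add: dot_lmul_matrix)
  finally show ?thesis using pull[OF a] pull[OF b] by simp
qed

lemma bieval_chart:
  assumes "c \<in> A" "p \<in> fst c" "bivector_law h p" "form_law \<alpha> p" "form_law \<beta> p"
  shows "bieval A h \<alpha> \<beta> p = \<alpha> c p \<bullet> (h c p *v \<beta> c p)"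
proof -
  have s: "some_chart A p \<in> A" "p \<in> fst (some_chart A p)"
    using some_chart dom_subset[OF assms(1)] assms(2) by auto
  have "\<alpha> c p \<bullet> v = \<alpha> (some_chart A p) p \<bullet> dtransition c (some_chart A p) p v"
    "\<beta> c p \<bullet> v = \<beta> (some_chart A p) p \<bullet> dtransition c (some_chart A p) p v" for v
    using assms(1,2,4,5) s unfolding form_law_def by blast+
  then show ?thesis unfolding bieval_eq
    by (rule bivector_law_eval[OF assms(3,1) s(1) assms(2) s(2)])
qed

lemma smooth_components_subset:
  "smooth_components A W T \<Longrightarrow> W' \<subseteq> W \<Longrightarrow> smooth_components A W' T"
  unfolding smooth_components_def using smooth_on_subset[OF _ cimage_mono] by blast

lemma vector_field_on_subset: "vector_field_on A W V \<Longrightarrow> W' \<subseteq> W \<Longrightarrow> vector_field_on A W' V"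
  unfolding vector_field_on_iff using smooth_components_subset by blast

lemma vector_law_coord_field: "c \<in> A \<Longrightarrow> p \<in> fst c \<Longrightarrow> vector_law (coord_field c i) p"
  unfolding vector_law_def coord_field_def by (simp add: dtransition_chain)

lemma coord_field_self: "c \<in> A \<Longrightarrow> p \<in> fst c \<Longrightarrow> coord_field c i c p = axis i 1"
  by (simp add: coord_field_def)

lemma vector_field_coord_field:
  assumes "c \<in> A"
  shows "vector_field_on A (fst c) (coord_field c i)"
  unfolding vector_field_on_iff smooth_components_def
proof (intro conjI ballI)
  fix d assume d: "d \<in> A"
  have "smooth_on (cimage d (fst c)) (\<lambda>u. fd (transition c d) (transition d c u) (axis i 1))"
    by (intro smooth_on_fd[OF _ transition_smooth[OF assms d]] open_cimage open_dom assms d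
        transition_smooth smooth_on_const)
       (use cimageD[OF d] in \<open>auto simp: transition_eq intro: cimageI\<close>)
  then show "smooth_on (cimage d (fst c)) (\<lambda>u. coord_field c i d (cinv d u))"
    by (simp add: coord_field_def dtransition_def transition_eq)
qed (use vector_law_coord_field assms in auto)

lemma vector_law_cong:
  assumes "field_eq_on A W V V'" "p \<in> W"
  shows "vector_law V p \<longleftrightarrow> vector_law V' p"
  using assms unfolding vector_law_def field_eq_on_def by auto

lemma vector_field_on_cong:
  assumes "openin X W" "field_eq_on A W V V'" "vector_field_on A W V"
  shows "vector_field_on A W V'"
  unfolding vector_field_on_iff
proof
  show "\<forall>p\<in>W. vector_law V' p"
    using assms(2,3) vector_law_cong unfolding vector_field_on_iff by blast
  show "smooth_components A W V'"
    unfolding smooth_components_def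
  proof
    fix c assume c: "c \<in> A"
    have "smooth_on (cimage c W) (\<lambda>u. V c (cinv c u))"
      using assms(3) c unfolding vector_field_on_iff smooth_components_def by blast
    then show "smooth_on (cimage c W) (\<lambda>u. V' c (cinv c u))"
      by (rule smooth_on_cong[OF open_cimage[OF c assms(1)], rotated])
         (use assms(2) c cimageD[OF c] in \<open>auto simp: field_eq_on_def\<close>)
  qed
qed

lemma vector_field_on_scale:
  assumes "openin X W" "smooth_fun A W g" "vector_field_on A W V"
  shows "vector_field_on A W (\<lambda>c p. g p *\<^sub>R V c p)"
  unfolding vector_field_on_iff smooth_components_def
proof (intro conjI ballI)
  show "smooth_on (cimage c W) (\<lambda>u. g (cinv c u) *\<^sub>R V c (cinv c u))" if "c \<in> A" for c
    using assms that unfolding vector_field_on_iff smooth_components_def smooth_fun_def o_def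
    by (intro smooth_intros open_cimage) auto
  show "vector_law (\<lambda>c p. g p *\<^sub>R V c p) p" if "p \<in> W" for p
    unfolding vector_law_def
  proof (intro ballI impI)
    fix c d assume cd: "c \<in> A" "d \<in> A" "p \<in> fst c" "p \<in> fst d"
    have "V d p = dtransition c d p (V c p)"
      using assms(3) \<open>p \<in> W\<close> cd unfolding vector_field_on_iff vector_law_def by blast
    then show "g p *\<^sub>R V d p = dtransition c d p (g p *\<^sub>R V c p)"
      by (simp add: linear_scale[OF linear_dtransition[OF cd]])
  qed
qed

lemma vector_field_on_sum:
  assumes "openin X W" "\<And>i. i \<in> I \<Longrightarrow> vector_field_on A W (V i)"
  shows "vector_field_on A W (\<lambda>c p. \<Sum>i\<in>I. V i c p)"
  unfolding vector_field_on_iff smooth_components_def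
proof (intro conjI ballI)
  show "smooth_on (cimage c W) (\<lambda>u. \<Sum>i\<in>I. V i c (cinv c u))" if "c \<in> A" for c
    using assms that unfolding vector_field_on_iff smooth_components_def
    by (intro smooth_intros open_cimage) auto
  show "vector_law (\<lambda>c p. \<Sum>i\<in>I. V i c p) p" if "p \<in> W" for p
    unfolding vector_law_def
  proof (intro ballI impI)
    fix c d assume cd: "c \<in> A" "d \<in> A" "p \<in> fst c" "p \<in> fst d"
    have "V i d p = dtransition c d p (V i c p)" if "i \<in> I" for i
      using assms(2)[OF that] \<open>p \<in> W\<close> cd unfolding vector_field_on_iff vector_law_def by blast
    then show "(\<Sum>i\<in>I. V i d p) = dtransition c d p (\<Sum>i\<in>I. V i c p)"
      by (simp add: linear_sum[OF linear_dtransition[OF cd]])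
  qed
qed

lemma vector_field_on_zero: "openin X W \<Longrightarrow> vector_field_on A W (\<lambda>c p. 0)"
  using vector_field_on_sum[of W "{}"] by simp

end

section \<open>Flat connections in a chart\<close>

locale flat_mfd = smooth_mfd X A
  for X :: "'m topology" and A :: "('m, 'n::finite) chart set" +
  fixes nabla :: "('m, 'n) vfield \<Rightarrow> ('m, 'n) vfield \<Rightarrow> ('m, 'n) vfield"
  assumes connection: "linear_connection X A nabla"
    and torsion: "torsion_free X A nabla" and flat: "flat X A nabla"
begin

lemma
  assumes "openin X W"
  shows nabla_field: "vector_field_on A W V \<Longrightarrow> vector_field_on A W Y \<Longrightarrow> vector_field_on A W (nabla V Y)"
    and nabla_cong: "vector_field_on A W V \<Longrightarrow> vector_field_on A W V' \<Longrightarrow> vector_field_on A W Y \<Longrightarrow>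
      vector_field_on A W Y' \<Longrightarrow> field_eq_on A W V V' \<Longrightarrow> field_eq_on A W Y Y' \<Longrightarrow>
      field_eq_on A W (nabla V Y) (nabla V' Y')"
    and nabla_add_left: "vector_field_on A W V \<Longrightarrow> vector_field_on A W V' \<Longrightarrow> vector_field_on A W Y \<Longrightarrow>
      field_eq_on A W (nabla (\<lambda>c p. V c p + V' c p) Y) (\<lambda>c p. nabla V Y c p + nabla V' Y c p)"
    and nabla_add_right: "vector_field_on A W V \<Longrightarrow> vector_field_on A W Y \<Longrightarrow> vector_field_on A W Y' \<Longrightarrow>
      field_eq_on A W (nabla V (\<lambda>c p. Y c p + Y' c p)) (\<lambda>c p. nabla V Y c p + nabla V Y' c p)"
    and nabla_scale_left: "smooth_fun A W g \<Longrightarrow> vector_field_on A W V \<Longrightarrow> vector_field_on A W Y \<Longrightarrow>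
      field_eq_on A W (nabla (\<lambda>c p. g p *\<^sub>R V c p) Y) (\<lambda>c p. g p *\<^sub>R nabla V Y c p)"
    and nabla_scale_right: "smooth_fun A W g \<Longrightarrow> vector_field_on A W V \<Longrightarrow> vector_field_on A W Y \<Longrightarrow>
      field_eq_on A W (nabla V (\<lambda>c p. g p *\<^sub>R Y c p))
        (\<lambda>c p. dir_deriv A V g p *\<^sub>R Y c p + g p *\<^sub>R nabla V Y c p)"
  using connection assms unfolding linear_connection_def by (metis (no_types, lifting))+

lemma vector_field_smooth: "vector_field_on A W V \<Longrightarrow> c \<in> A \<Longrightarrow> smooth_on (cimage c W) (\<lambda>u. V c (cinv c u))"
  unfolding vector_field_on_iff smooth_components_def by blast

lemma field_eq_onD: "field_eq_on A W V Y \<Longrightarrow> c \<in> A \<Longrightarrow> p \<in> fst c \<Longrightarrow> p \<in> W \<Longrightarrow> V c p = Y c p"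
  unfolding field_eq_on_def by blast

lemma field_eq_on_refl: "field_eq_on A W V V"
  unfolding field_eq_on_def by simp

lemma smooth_fun_const: "smooth_fun A W (\<lambda>_. k)"
  by (simp add: smooth_fun_def o_def smooth_on_const)

lemma nabla_zero_left:
  assumes W: "openin X W" and Y: "vector_field_on A W Y"
  shows "field_eq_on A W (nabla (\<lambda>c p. 0) Y) (\<lambda>c p. 0)"
  using nabla_scale_left[OF W smooth_fun_const[of W 0] vector_field_on_zero[OF W] Y] by simp

lemma nabla_zero_right:
  assumes W: "openin X W" and V: "vector_field_on A W V"
  shows "field_eq_on A W (nabla V (\<lambda>c p. 0)) (\<lambda>c p. 0)"
  using nabla_scale_right[OF W smooth_fun_const[of W 0] V vector_field_on_zero[OF W]] by simp

lemma nabla_sum_left: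
  assumes W: "openin X W" and Y: "vector_field_on A W Y"
    and V: "\<And>i. i \<in> I \<Longrightarrow> vector_field_on A W (V i)" and "finite I"
  shows "field_eq_on A W (nabla (\<lambda>c p. \<Sum>i\<in>I. V i c p) Y) (\<lambda>c p. \<Sum>i\<in>I. nabla (V i) Y c p)"
  using \<open>finite I\<close> V
proof (induction I)
  case empty
  then show ?case using nabla_zero_left[OF W Y] by simp
next
  case (insert i I)
  have "field_eq_on A W (nabla (\<lambda>c p. V i c p + (\<Sum>i\<in>I. V i c p)) Y)
      (\<lambda>c p. nabla (V i) Y c p + nabla (\<lambda>c p. \<Sum>i\<in>I. V i c p) Y c p)"
    by (rule nabla_add_left[OF W _ vector_field_on_sum[OF W] Y]) (use insert.prems in auto)
  then show ?case using insert unfolding field_eq_on_def by simp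
qed

lemma nabla_sum_right:
  assumes W: "openin X W" and V: "vector_field_on A W V"
    and Y: "\<And>i. i \<in> I \<Longrightarrow> vector_field_on A W (Y i)" and "finite I"
  shows "field_eq_on A W (nabla V (\<lambda>c p. \<Sum>i\<in>I. Y i c p)) (\<lambda>c p. \<Sum>i\<in>I. nabla V (Y i) c p)"
  using \<open>finite I\<close> Y
proof (induction I)
  case empty
  then show ?case using nabla_zero_right[OF W V] by simp
next
  case (insert i I)
  have "field_eq_on A W (nabla V (\<lambda>c p. Y i c p + (\<Sum>i\<in>I. Y i c p)))
      (\<lambda>c p. nabla V (Y i) c p + nabla V (\<lambda>c p. \<Sum>i\<in>I. Y i c p) c p)"
    by (rule nabla_add_right[OF W V _ vector_field_on_sum[OF W]]) (use insert.prems in auto)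
  then show ?case using insert unfolding field_eq_on_def by simp
qed

lemma vector_field_expand:
  assumes c: "c \<in> A" "W \<subseteq> fst c" and V: "vector_field_on A W V"
  shows "field_eq_on A W V (\<lambda>d p. \<Sum>i\<in>UNIV. V c p $ i *\<^sub>R coord_field c i d p)"
  unfolding field_eq_on_def
proof (intro ballI)
  fix d p assume d: "d \<in> A" "p \<in> fst d \<inter> W"
  then have p: "p \<in> fst c" "p \<in> fst d" "p \<in> W" using c by auto
  have "V d p = dtransition c d p (V c p)"
    using V p c(1) d(1) unfolding vector_field_on_iff vector_law_def by blast
  also have "dtransition c d p (V c p) = (\<Sum>i\<in>UNIV. V c p $ i *\<^sub>R coord_field c i d p)"
    unfolding coord_field_def
    by (rule linear_eq_sum_axis) (rule linear_dtransition[OF c(1) _ p(1,2)], use d in simp)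
  finally show "V d p = (\<Sum>i\<in>UNIV. V c p $ i *\<^sub>R coord_field c i d p)" .
qed

definition christoffel :: "('m, 'n) chart \<Rightarrow> 'n \<Rightarrow> 'n \<Rightarrow> real ^ 'n \<Rightarrow> real ^ 'n" where
  "christoffel c i j u = nabla (coord_field c i) (coord_field c j) c (cinv c u)"

lemma christoffel_smooth:
  assumes "c \<in> A"
  shows "smooth_on (snd c ` fst c) (christoffel c i j)"
proof -
  have "vector_field_on A (fst c) (nabla (coord_field c i) (coord_field c j))"
    by (intro nabla_field open_dom vector_field_coord_field assms)
  from vector_field_smooth[OF this assms] show ?thesis
    by (simp add: christoffel_def[abs_def] cimage_self)
qed

text \<open>Both fields are expanded in the coordinate fields of \<open>c\<close> over
  \<open>W\<close>. Linearity over functions in the first argument and the Leibniz rule in the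
  second leave the derivative of the components of \<open>Y\<close> and the Christoffel
  term.\<close>

lemma nabla_chart:
  assumes c: "c \<in> A" and W: "openin X W" "W \<subseteq> fst c" and p: "p \<in> W"
    and V: "vector_field_on A W V" and Y: "vector_field_on A W Y"
  shows "nabla V Y c p = fd (\<lambda>u. Y c (cinv c u)) (snd c p) (V c p) +
    bil (\<lambda>i j. christoffel c i j (snd c p)) (V c p) (Y c p)"
proof -
  have pc: "p \<in> fst c" using p W by auto
  have E: "vector_field_on A W (coord_field c i)" for i
    by (rule vector_field_on_subset[OF vector_field_coord_field[OF c] W(2)])
  have comp: "smooth_on (cimage c W) (\<lambda>u. T c (cinv c u) $ i)" if "vector_field_on A W T" for T i
    by (intro smooth_intros open_cimage c W vector_field_smooth that)
  have sfun: "smooth_fun A W (\<lambda>p. T c p $ i)" if "vector_field_on A W T" for T i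
    by (rule smooth_funI[OF c W comp[OF that]])
  have sV: "vector_field_on A W (\<lambda>d p. V c p $ i *\<^sub>R coord_field c i d p)" for i
    by (rule vector_field_on_scale[OF W(1) sfun[OF V] E])
  have sY: "vector_field_on A W (\<lambda>d p. Y c p $ j *\<^sub>R coord_field c j d p)" for j
    by (rule vector_field_on_scale[OF W(1) sfun[OF Y] E])
  note vV = vector_field_on_sum[OF W(1), of UNIV, OF sV] and vY = vector_field_on_sum[OF W(1), of UNIV, OF sY]
  have "nabla V Y c p = nabla (\<lambda>d p. \<Sum>i\<in>UNIV. V c p $ i *\<^sub>R coord_field c i d p) Y c p"
    by (rule field_eq_onD[OF nabla_cong[OF W(1) V vV Y Y vector_field_expand[OF c W(2) V] field_eq_on_refl] c pc p])
  also have "\<dots> = (\<Sum>i\<in>UNIV. nabla (\<lambda>d p. V c p $ i *\<^sub>R coord_field c i d p) Y c p)"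
    by (rule field_eq_onD[OF nabla_sum_left[OF W(1) Y sV finite] c pc p])
  also have "\<dots> = (\<Sum>i\<in>UNIV. V c p $ i *\<^sub>R nabla (coord_field c i) Y c p)"
    by (intro sum.cong refl field_eq_onD[OF nabla_scale_left[OF W(1) sfun[OF V] E Y] c pc p])
  also have "\<dots> = (\<Sum>i\<in>UNIV. V c p $ i *\<^sub>R (fd (\<lambda>u. Y c (cinv c u)) (snd c p) (axis i 1) +
      (\<Sum>j\<in>UNIV. Y c p $ j *\<^sub>R christoffel c i j (snd c p))))"
  proof (intro sum.cong refl arg_cong[where f = "scaleR _"])
    fix i
    have "nabla (coord_field c i) Y c p =
        nabla (coord_field c i) (\<lambda>d p. \<Sum>j\<in>UNIV. Y c p $ j *\<^sub>R coord_field c j d p) c p"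
      by (rule field_eq_onD[OF nabla_cong[OF W(1) E E Y vY field_eq_on_refl vector_field_expand[OF c W(2) Y]] c pc p])
    also have "\<dots> = (\<Sum>j\<in>UNIV. nabla (coord_field c i) (\<lambda>d p. Y c p $ j *\<^sub>R coord_field c j d p) c p)"
      by (rule field_eq_onD[OF nabla_sum_right[OF W(1) E sY finite] c pc p])
    also have "\<dots> = (\<Sum>j\<in>UNIV. dir_deriv A (coord_field c i) (\<lambda>p. Y c p $ j) p *\<^sub>R coord_field c j c p +
        Y c p $ j *\<^sub>R nabla (coord_field c i) (coord_field c j) c p)"
      by (intro sum.cong refl field_eq_onD[OF nabla_scale_right[OF W(1) sfun[OF Y] E E] c pc p])
    also have "\<dots> = (\<Sum>j\<in>UNIV. fd (\<lambda>u. Y c (cinv c u)) (snd c p) (axis i 1) $ j *\<^sub>R axis j 1 +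
        Y c p $ j *\<^sub>R christoffel c i j (snd c p))"
    proof (intro sum.cong refl arg_cong2[where f = "(+)"] arg_cong2[where f = scaleR])
      fix j
      have pim: "snd c p \<in> cimage c W" by (rule cimageI[OF pc p])
      have "dir_deriv A (coord_field c i) (\<lambda>p. Y c p $ j) p =
          fd (\<lambda>u. Y c (cinv c u) $ j) (snd c p) (coord_field c i c p)"
        by (rule dir_deriv_chart[OF c pc vector_law_coord_field[OF c pc]
              smooth_on_differentiable[OF comp[OF Y] pim]])
      also have "\<dots> = fd (\<lambda>u. Y c (cinv c u)) (snd c p) (axis i 1) $ j"
        using fd_nth[OF smooth_on_differentiable[OF vector_field_smooth[OF Y c] pim]] c pc
        by (simp add: coord_field_self)
      finally show "dir_deriv A (coord_field c i) (\<lambda>p. Y c p $ j) p =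
          fd (\<lambda>u. Y c (cinv c u)) (snd c p) (axis i 1) $ j" .
      show "coord_field c j c p = axis j 1" by (rule coord_field_self[OF c pc])
      show "nabla (coord_field c i) (coord_field c j) c p = christoffel c i j (snd c p)"
        by (simp add: christoffel_def cinv_chart[OF c pc])
    qed
    also have "\<dots> = fd (\<lambda>u. Y c (cinv c u)) (snd c p) (axis i 1) +
        (\<Sum>j\<in>UNIV. Y c p $ j *\<^sub>R christoffel c i j (snd c p))"
      unfolding sum.distrib vec_eq_sum_axis_real[symmetric] ..
    finally show "nabla (coord_field c i) Y c p = fd (\<lambda>u. Y c (cinv c u)) (snd c p) (axis i 1) +
        (\<Sum>j\<in>UNIV. Y c p $ j *\<^sub>R christoffel c i j (snd c p))" .
  qed
  also have "\<dots> = fd (\<lambda>u. Y c (cinv c u)) (snd c p) (V c p) +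
    bil (\<lambda>i j. christoffel c i j (snd c p)) (V c p) (Y c p)"
  proof -
    have "linear (fd (\<lambda>u. Y c (cinv c u)) (snd c p))"
      by (rule smooth_on_linear_fd[OF vector_field_smooth[OF Y c] cimageI[OF pc p]])
    from linear_eq_sum_axis[OF this, of "V c p"] show ?thesis
      by (simp add: bil_def scaleR_add_right sum.distrib scaleR_sum_right)
  qed
  finally show ?thesis .
qed

lemma fd_coord_field_self:
  assumes "c \<in> A" "p \<in> fst c"
  shows "fd (\<lambda>u. coord_field c i c (cinv c u)) (snd c p) v = 0"
proof -
  have "fd (\<lambda>u. coord_field c i c (cinv c u)) (snd c p) = fd (\<lambda>u. axis i 1) (snd c p)"
    by (rule fd_cong_open[OF open_image]) (use assms in \<open>auto simp: coord_field_self\<close>)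
  then show ?thesis by simp
qed

lemma lie_bracket_coord_field_self:
  "c \<in> A \<Longrightarrow> p \<in> fst c \<Longrightarrow> lie_bracket (coord_field c i) (coord_field c j) c p = 0"
  by (simp add: lie_bracket_def fd_coord_field_self)

lemma christoffel_sym:
  assumes "c \<in> A" "u \<in> snd c ` fst c"
  shows "christoffel c i j u = christoffel c j i u"
proof -
  obtain p where p: "p \<in> fst c" "u = snd c p" using assms by auto
  have "field_eq_on A (fst c) (\<lambda>d p. nabla (coord_field c i) (coord_field c j) d p -
      nabla (coord_field c j) (coord_field c i) d p) (lie_bracket (coord_field c i) (coord_field c j))"
    using torsion open_dom[OF assms(1)] vector_field_coord_field[OF assms(1)]
    unfolding torsion_free_def by blast
  from field_eq_onD[OF this assms(1) p(1,1)] show ?thesis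
    using lie_bracket_coord_field_self[OF assms(1) p(1)] p assms(1) by (simp add: christoffel_def)
qed

text \<open>\<open>lie_bracket\<close> is defined by a formula in each chart separately.
  Torsion-freeness identifies it with a difference of two vector fields, so its vanishing in the
  chart \<open>c\<close> carries over to every chart \<open>d\<close>.\<close>

lemma lie_bracket_coord_field:
  assumes "c \<in> A"
  shows "field_eq_on A (fst c) (lie_bracket (coord_field c i) (coord_field c j)) (\<lambda>d p. 0)"
  unfolding field_eq_on_def
proof (intro ballI)
  fix d p assume d: "d \<in> A" "p \<in> fst d \<inter> fst c"
  let ?N = "\<lambda>i j. nabla (coord_field c i) (coord_field c j)"
  have T: "field_eq_on A (fst c) (\<lambda>d p. ?N i j d p - ?N j i d p) (lie_bracket (coord_field c i) (coord_field c j))"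
    using torsion open_dom[OF assms] vector_field_coord_field[OF assms] unfolding torsion_free_def by blast
  have "vector_law (?N i j) p" for i j
    using nabla_field[OF open_dom[OF assms] vector_field_coord_field[OF assms] vector_field_coord_field[OF assms]] d
    unfolding vector_field_on_iff by blast
  then have "?N i j d p = dtransition c d p (?N i j c p)" for i j
    using assms d unfolding vector_law_def by blast
  moreover have "?N i j c p = ?N j i c p"
    using christoffel_sym[OF assms, of "snd c p" i j] d assms by (simp add: christoffel_def)
  ultimately show "lie_bracket (coord_field c i) (coord_field c j) d p = 0"
    using field_eq_onD[OF T d(1), of p] d by (metis IntD1 IntD2 diff_self)
qed

lemma christoffel_flat:
  assumes c: "c \<in> A" and u: "u \<in> snd c ` fst c"
  shows "fd (christoffel c j k) u (axis i 1) +
      bil (\<lambda>i j. christoffel c i j u) (axis i 1) (christoffel c j k u) =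
    fd (christoffel c i k) u (axis j 1) +
      bil (\<lambda>i j. christoffel c i j u) (axis j 1) (christoffel c i k u)"
proof -
  obtain p where p: "p \<in> fst c" "u = snd c p" using u by auto
  let ?E = "coord_field c" and ?W = "fst c"
  note W = open_dom[OF c] and E = vector_field_coord_field[OF c]
  have N: "vector_field_on A ?W (nabla (?E i) (?E j))" for i j by (rule nabla_field[OF W E E])
  have NN: "nabla (?E i) (nabla (?E j) (?E k)) c p = fd (christoffel c j k) u (axis i 1) +
      bil (\<lambda>i j. christoffel c i j u) (axis i 1) (christoffel c j k u)" for i j
    using nabla_chart[OF c W order_refl p(1) E N] p c
    by (simp add: coord_field_self christoffel_def[abs_def])
  \<comment> \<open>\<open>nabla_cong\<close> requires the bracket to be a vector field; this
    follows from its being zero in all charts.\<close>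
  have zero: "vector_field_on A ?W (lie_bracket (?E i) (?E j))"
  proof (rule vector_field_on_cong[OF W _ vector_field_on_zero[OF W]])
    show "field_eq_on A ?W (\<lambda>c p. 0) (lie_bracket (?E i) (?E j))"
      using lie_bracket_coord_field[OF c] unfolding field_eq_on_def by simp
  qed
  have "nabla (lie_bracket (?E i) (?E j)) (?E k) c p = nabla (\<lambda>c p. 0) (?E k) c p"
    by (rule field_eq_onD[OF nabla_cong[OF W zero vector_field_on_zero[OF W] E E
          lie_bracket_coord_field[OF c] field_eq_on_refl] c p(1,1)])
  also have "\<dots> = 0" by (rule field_eq_onD[OF nabla_zero_left[OF W E] c p(1,1)])
  finally have L: "nabla (lie_bracket (?E i) (?E j)) (?E k) c p = 0" .
  have "field_eq_on A ?W (\<lambda>c p. nabla (?E i) (nabla (?E j) (?E k)) c p -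
      nabla (?E j) (nabla (?E i) (?E k)) c p - nabla (lie_bracket (?E i) (?E j)) (?E k) c p) (\<lambda>c p. 0)"
    using flat W E unfolding flat_def by blast
  from field_eq_onD[OF this c p(1,1)] show ?thesis using L NN by simp
qed

end

context smooth_mfd
begin

text \<open>The manifold being Hausdorff, a compactly supported local form extends by zero.\<close>

lemma exists_one_form:
  assumes c: "c \<in> A" and p: "p \<in> fst c"
  obtains \<alpha> where "one_form_on A (topspace X) \<alpha>" "\<alpha> c p = a"
proof -
  obtain \<phi> :: "real ^ 'n \<Rightarrow> real" and K where \<phi>: "smooth_on UNIV \<phi>" "compact K" "K \<subseteq> snd c ` fst c"
      "\<phi> (snd c p) = 1" "\<And>z. z \<notin> K \<Longrightarrow> \<phi> z = 0"
    using smooth_bump[OF open_image[OF c], of "snd c p"] p by blast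
  \<comment> \<open>The constant covector \<open>a\<close> of the chart \<open>c\<close>, cut off by
    \<open>\<phi>\<close> and pulled back to each chart \<open>d\<close> by the transition
    derivative.\<close>
  define \<alpha> :: "('m, 'n) form" where
    "\<alpha> d q = (if q \<in> fst c then \<phi> (snd c q) *\<^sub>R (\<chi> i. a \<bullet> dtransition d c q (axis i 1)) else 0)" for d q
  have \<alpha>_eval: "\<alpha> d q \<bullet> v = \<phi> (snd c q) * (a \<bullet> dtransition d c q v)"
    if "d \<in> A" "q \<in> fst c" "q \<in> fst d" for d q v
  proof -
    have "a \<bullet> dtransition d c q v = (\<Sum>i\<in>UNIV. v $ i * (a \<bullet> dtransition d c q (axis i 1)))"
      by (subst linear_eq_sum_axis[OF linear_dtransition[OF that(1) c that(3,2)]]) (simp add: inner_sum_right)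
    moreover have "(\<chi> i. a \<bullet> dtransition d c q (axis i 1)) \<bullet> v =
        (\<Sum>i\<in>UNIV. v $ i * (a \<bullet> dtransition d c q (axis i 1)))"
      by (simp add: inner_vec_def[of "vec_lambda _"] mult.commute)
    ultimately show ?thesis using that by (simp add: \<alpha>_def)
  qed
  \<comment> \<open>The support is carried to \<open>X\<close> by the inverse chart. Compact sets in
    a Hausdorff space are closed, so its complement \<open>N\<close> is open and, together with the
    domain of \<open>c\<close>, covers the manifold.\<close>
  have "compactin (top_of_set (snd c ` fst c)) K"
    using \<phi>(2,3) by (simp add: compactin_subtopology)
  moreover have "homeomorphic_map (top_of_set (snd c ` fst c)) (subtopology X (fst c)) (cinv c)"
  proof -
    obtain g where g: "homeomorphic_maps (subtopology X (fst c)) (top_of_set (snd c ` fst c)) (snd c) g"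
      using chart_homeo[OF c] homeomorphic_map_maps by blast
    then have "homeomorphic_map (top_of_set (snd c ` fst c)) (subtopology X (fst c)) g"
      using homeomorphic_maps_map by blast
    moreover have "g u = cinv c u" if "u \<in> snd c ` fst c" for u
      using g that c dom_subset[OF c] by (auto simp: homeomorphic_maps_def)
    ultimately show ?thesis by (rule homeomorphic_map_eq) auto
  qed
  ultimately have "compactin (subtopology X (fst c)) (cinv c ` K)"
    using homeomorphic_imp_continuous_map image_compactin by blast
  then have "compactin X (cinv c ` K)" by (simp add: compactin_subtopology)
  then have closed: "closedin X (cinv c ` K)" by (rule compactin_imp_closedin[OF hausdorff])
  define N where "N = topspace X - cinv c ` K"
  have N: "openin X N" unfolding N_def using closed by (simp add: closedin_def)
  have \<alpha>_zero: "\<alpha> d q = 0" if "q \<in> N" for d q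
  proof (cases "q \<in> fst c")
    case True
    have "snd c q \<notin> K" using that cinv_chart[OF c True] unfolding N_def by (metis DiffD2 imageI)
    then show ?thesis by (simp add: \<alpha>_def \<phi>(5))
  qed (simp add: \<alpha>_def)
  have "smooth_components A (topspace X) \<alpha>"
    unfolding smooth_components_def
  proof (intro ballI smooth_on_local)
    fix d u assume d: "d \<in> A" and u: "u \<in> cimage d (topspace X)"
    have op: "open (cimage d (fst c))" "open (cimage d N)"
      using open_cimage[OF d] open_dom[OF c] N by auto
    show "\<exists>T. open T \<and> u \<in> T \<and> smooth_on T (\<lambda>u. \<alpha> d (cinv d u))"
    proof (cases "cinv d u \<in> fst c")
      case True
      have "smooth_on (cimage d (fst c)) (\<lambda>u. \<phi> (transition d c u) *\<^sub>R
          (\<chi> i. a \<bullet> fd (transition d c) u (axis i 1)))"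
        by (intro smooth_intros op smooth_on_compose[OF \<phi>(1)] transition_smooth smooth_on_fd_dir d c) auto
      then have "smooth_on (cimage d (fst c)) (\<lambda>u. \<alpha> d (cinv d u))"
        by (rule smooth_on_cong[OF op(1), rotated])
           (use cimageD[OF d] in \<open>simp add: \<alpha>_def transition_eq dtransition_def\<close>)
      moreover have "u \<in> cimage d (fst c)"
        using cimageI[of "cinv d u" d "fst c"] cimageD[OF d u] True by simp
      ultimately show ?thesis using op by blast
    next
      case False
      have "smooth_on (cimage d N) (\<lambda>u. \<alpha> d (cinv d u))"
        by (rule smooth_on_cong[OF op(2) _ smooth_on_const[of _ 0]]) (use cimageD[OF d] \<alpha>_zero in simp)
      moreover have "cinv d u \<in> N"
        using False cimageD[OF d u] \<phi>(3) c unfolding N_def by (auto simp: subset_iff image_iff)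
      then have "u \<in> cimage d N"
        using cimageI[of "cinv d u" d N] cimageD[OF d u] by simp
      ultimately show ?thesis using op by blast
    qed
  qed
  moreover have "form_law \<alpha> q" for q
    unfolding form_law_def
  proof (intro ballI impI allI)
    fix d e v assume de: "d \<in> A" "e \<in> A" "q \<in> fst d" "q \<in> fst e"
    show "\<alpha> d q \<bullet> v = \<alpha> e q \<bullet> dtransition d e q v"
    proof (cases "q \<in> fst c")
      case True
      then show ?thesis using de c by (simp add: \<alpha>_eval dtransition_chain)
    qed (simp add: \<alpha>_def)
  qed
  ultimately have "one_form_on A (topspace X) \<alpha>" by (simp add: one_form_on_iff)
  moreover have "\<alpha> c p = a" using p c \<phi>(4) by (simp add: \<alpha>_def inner_axis)
  ultimately show thesis by (rule that)
qed

end

section \<open>Changes of chart and the Codazzi condition\<close>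

definition recoord :: "('m, 'n::finite) chart \<Rightarrow> (real ^ 'n) set \<Rightarrow> (real ^ 'n \<Rightarrow> real ^ 'n) \<Rightarrow> ('m, 'n) chart" where
  "recoord c U f = ({q \<in> fst c. snd c q \<in> U}, \<lambda>q. f (snd c q))"

context smooth_mfd
begin

context
  fixes c U V f g
  assumes c: "c \<in> A" and diffeo: "diffeo U V f g" and U: "U \<subseteq> snd c ` fst c"
begin

lemma recoord_image: "snd (recoord c U f) ` fst (recoord c U f) = V"
  using diffeo U by (auto simp: recoord_def diffeo_def image_iff subset_iff)

lemma recoord_cinv: "z \<in> V \<Longrightarrow> cinv (recoord c U f) z = cinv c (g z)"
  unfolding cinv_def
proof (rule inv_into_f_eq)
  show "inj_on (snd (recoord c U f)) (fst (recoord c U f))"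
  proof (rule inj_onI)
    fix p q assume pq: "p \<in> fst (recoord c U f)" "q \<in> fst (recoord c U f)"
      "snd (recoord c U f) p = snd (recoord c U f) q"
    then have "snd c p = snd c q"
      using diffeo unfolding diffeo_def recoord_def by (metis (no_types, lifting) fst_conv mem_Collect_eq snd_conv)
    then show "p = q" using chart_inj[OF c] pq by (auto simp: recoord_def inj_on_def)
  qed
  assume z: "z \<in> V"
  then have gz: "g z \<in> U" "f (g z) = z" using diffeo by (auto simp: diffeo_def)
  then show "inv_into (fst c) (snd c) (g z) \<in> fst (recoord c U f)"
    using U by (auto simp: recoord_def subset_iff intro: inv_into_into simp: f_inv_into_f)
  show "snd (recoord c U f) (inv_into (fst c) (snd c) (g z)) = z"
    using gz U by (simp add: recoord_def subset_iff f_inv_into_f)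
qed

lemma recoord_dom_open: "openin X (fst (recoord c U f))"
proof -
  have "fst (recoord c U f) = {q \<in> topspace (subtopology X (fst c)). snd c q \<in> U}"
    using dom_subset[OF c] by (auto simp: recoord_def)
  moreover have "openin (top_of_set (snd c ` fst c)) U"
    using diffeo U by (simp add: diffeo_def open_subset)
  ultimately have "openin (subtopology X (fst c)) (fst (recoord c U f))"
    using openin_continuous_map_preimage[OF homeomorphic_imp_continuous_map[OF chart_homeo[OF c]]] by simp
  then show ?thesis using open_dom[OF c] openin_trans_full by blast
qed

lemma recoord_is_chart: "is_chart X (recoord c U f)"
proof -
  let ?W = "fst (recoord c U f)"
  have "homeomorphic_map (subtopology (subtopology X (fst c)) ?W) (subtopology (top_of_set (snd c ` fst c)) U) (snd c)"
    by (rule homeomorphic_map_subtopologies[OF chart_homeo[OF c]])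
       (use U dom_subset[OF c] in \<open>auto simp: recoord_def subset_iff\<close>)
  moreover have "fst c \<inter> ?W = ?W" by (auto simp: recoord_def)
  ultimately have 1: "homeomorphic_map (subtopology X ?W) (top_of_set U) (snd c)"
    using U by (simp add: subtopology_subtopology Int_absorb1)
  have "homeomorphic_maps (top_of_set U) (top_of_set V) f g"
    using diffeo smooth_on_continuous unfolding diffeo_def homeomorphic_maps_def
    by (auto simp: continuous_map_in_subtopology)
  then have "homeomorphic_map (top_of_set U) (top_of_set V) f" by (rule homeomorphic_maps_imp_map)
  from homeomorphic_map_compose[OF 1 this]
  have "homeomorphic_map (subtopology X ?W) (top_of_set V) (snd (recoord c U f))"
    by (simp add: recoord_def o_def)
  then show ?thesis
    using recoord_dom_open diffeo recoord_image unfolding is_chart_def diffeo_def by simp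
qed

text \<open>Maximality of the atlas reduces this to compatibility, and the transition maps are those
  of \<open>c\<close> composed with \<open>g\<close> or \<open>f\<close>.\<close>

lemma recoord_in_atlas: "recoord c U f \<in> A"
proof (rule maximal[OF recoord_is_chart])
  fix d assume d: "d \<in> A"
  let ?r = "recoord c U f"
  have sm: "smooth_on U f" "smooth_on V g" "open V" "open U" using diffeo by (auto simp: diffeo_def)
  have "cimage ?r (fst d) = V \<inter> g -` cimage c (fst d)"
  proof
    show "cimage ?r (fst d) \<subseteq> V \<inter> g -` cimage c (fst d)"
      using diffeo by (auto simp: cimage_def recoord_def diffeo_def)
    show "V \<inter> g -` cimage c (fst d) \<subseteq> cimage ?r (fst d)"
    proof
      fix z assume z: "z \<in> V \<inter> g -` cimage c (fst d)"
      then have gz: "g z \<in> U" "f (g z) = z" "g z \<in> cimage c (fst d)" using diffeo by (auto simp: diffeo_def)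
      then obtain q where "q \<in> fst c" "q \<in> fst d" "g z = snd c q" by (auto simp: cimage_def)
      then show "z \<in> cimage ?r (fst d)" using gz by (auto simp: cimage_def recoord_def intro!: image_eqI[of _ _ q])
    qed
  qed
  moreover have "open (V \<inter> g -` cimage c (fst d))"
    by (intro continuous_open_preimage smooth_on_continuous sm open_cimage c open_dom d)
  moreover have "smooth_on (V \<inter> g -` cimage c (fst d)) (\<lambda>z. transition c d (g z))"
    by (rule smooth_on_compose[OF transition_smooth[OF c d] calculation(2) smooth_on_subset[OF sm(2)]]) auto
  ultimately have 1: "smooth_on (cimage ?r (fst d)) (transition ?r d)"
    by (auto simp: transition_eq recoord_cinv intro: smooth_on_cong)
  have op: "open (cimage d (fst ?r))" by (intro open_cimage d recoord_dom_open)
  have sub: "cimage d (fst ?r) \<subseteq> cimage d (fst c)" by (rule cimage_mono) (auto simp: recoord_def)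
  have "smooth_on (cimage d (fst ?r)) (\<lambda>u. f (transition d c u))"
    by (rule smooth_on_compose[OF sm(1) op smooth_on_subset[OF transition_smooth[OF d c] sub]])
       (use cimageD[OF d] in \<open>auto simp: transition_eq recoord_def\<close>)
  then have 2: "smooth_on (cimage d (fst ?r)) (transition d ?r)"
    by (simp add: transition_def recoord_def o_def)
  show "compatible ?r d" unfolding compatible_def using 1 2 by blast
qed

lemma recoord_dom: "q \<in> fst (recoord c U f) \<longleftrightarrow> q \<in> fst c \<and> snd c q \<in> U"
  and recoord_snd: "snd (recoord c U f) q = f (snd c q)"
  by (simp_all add: recoord_def)

lemma dtransition_from_recoord:
  assumes "q \<in> fst (recoord c U f)"
  shows "dtransition (recoord c U f) c q = fd g (f (snd c q))"
proof -
  have "f (snd c q) \<in> V" "open V" using assms diffeo by (auto simp: recoord_def diffeo_def)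
  moreover have "transition (recoord c U f) c z = g z" if "z \<in> V" for z
    using that recoord_cinv[OF that] diffeo U
    unfolding transition_eq diffeo_def cinv_def by (metis f_inv_into_f imageI subsetD)
  ultimately show ?thesis
    unfolding dtransition_def recoord_snd by (intro fd_cong_open[of V]) auto
qed

lemma dtransition_to_recoord:
  assumes "q \<in> fst (recoord c U f)"
  shows "dtransition c (recoord c U f) q = fd f (snd c q)"
proof -
  have "snd c q \<in> U" "open U" using assms diffeo by (auto simp: recoord_def diffeo_def)
  moreover have "transition c (recoord c U f) u = f u" if "u \<in> U" for u
    using that U unfolding transition_eq recoord_snd cinv_def by (metis f_inv_into_f subsetD)
  ultimately show ?thesis
    unfolding dtransition_def by (intro fd_cong_open[of U]) auto
qed

end

text \<open>A change of chart acts on \<open>h\<close> by congruence with an invertible matrix, so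
  the range changes by a linear isomorphism. Symmetry converts the row products of
  \<open>sharp\<close> into the column products of \<open>rank\<close>.\<close>

lemma sharp_rank_chart:
  assumes c: "c \<in> A" and p: "p \<in> fst c" and h: "bivector_law h p" "transpose (h c p) = h c p"
  shows "rank (h c p) = sharp_rank A h p"
proof -
  define s where "s = some_chart A p"
  have s: "s \<in> A" "p \<in> fst s" unfolding s_def using some_chart dom_subset[OF c] p by auto
  let ?T = "matrix (dtransition c s p)"
  note linT = linear_dtransition[OF c s(1) p s(2)]
  have T: "?T *v v = dtransition c s p v" for v by (rule matrix_works_linear[OF linT])
  have inj: "inj (dtransition c s p)"
    using dtransition_inverse[OF c s(1) p s(2)] by (metis injI)
  have surj: "surj (\<lambda>a. a v* ?T)"
  proof -
    have "det ?T \<noteq> 0" using det_nz_iff_inj[OF linT] inj by simp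
    then have "(a v* matrix_inv ?T) v* ?T = a" for a
      by (simp add: vector_matrix_mul_assoc matrix_inv_eq)
    then show ?thesis by (metis surjI)
  qed
  have "h s p = ?T ** h c p ** transpose ?T" using h(1) c s p unfolding bivector_law_def by blast
  then have "a v* h s p = dtransition c s p (h c p *v (a v* ?T))" for a
    using h(2) by (simp add: T[symmetric] vector_matrix_mul_assoc[symmetric])
      (metis vector_transpose_matrix)
  then have "range (\<lambda>a. a v* h s p) = dtransition c s p ` (*v) (h c p) ` range (\<lambda>a. a v* ?T)"
    by (auto simp: image_image)
  also have "\<dots> = dtransition c s p ` range ((*v) (h c p))" using surj by simp
  finally have "dim (range (\<lambda>a. a v* h s p)) = dim (range ((*v) (h c p)))"
    using dim_image_eq[OF linT inj_on_subset[OF inj]] by simp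
  then show ?thesis by (simp add: rank_dim_range sharp_rank_def s_def)
qed

lemma vector_field_sharp:
  assumes "openin X W" "bivector_field_on A W h" "one_form_on A W \<alpha>"
  shows "vector_field_on A W (sharp h \<alpha>)"
  unfolding vector_field_on_iff smooth_components_def
proof (intro conjI ballI)
  fix c assume c: "c \<in> A"
  have sm: "smooth_on (cimage c W) (\<lambda>u. h c (cinv c u))" "smooth_on (cimage c W) (\<lambda>u. \<alpha> c (cinv c u))"
    using assms c unfolding bivector_field_on_iff one_form_on_iff smooth_components_def by auto
  show "smooth_on (cimage c W) (\<lambda>u. sharp h \<alpha> c (cinv c u))"
    unfolding sharp_def vector_matrix_mult_def
    by (intro smooth_intros open_cimage c assms(1) sm)
next
  fix p assume p: "p \<in> W"
  show "vector_law (sharp h \<alpha>) p"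
    unfolding vector_law_def
  proof (intro ballI impI)
    fix c d assume cd: "c \<in> A" "d \<in> A" "p \<in> fst c" "p \<in> fst d"
    let ?T = "matrix (dtransition c d p)"
    have T: "?T *v v = dtransition c d p v" for v
      by (rule matrix_works_linear[OF linear_dtransition[OF cd]])
    have h: "h d p = ?T ** h c p ** transpose ?T"
      using assms(2) p cd unfolding bivector_field_on_iff bivector_law_def by blast
    have "\<alpha> c p \<bullet> v = \<alpha> d p \<bullet> dtransition c d p v" for v
      using assms(3) p cd unfolding one_form_on_iff form_law_def by blast
    then have "\<alpha> c p \<bullet> v = (\<alpha> d p v* ?T) \<bullet> v" for v by (simp add: dot_lmul_matrix T)
    then have "\<alpha> c p = \<alpha> d p v* ?T" by (rule vector_eq_rdot[THEN iffD1, rule_format])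
    then show "sharp h \<alpha> d p = dtransition c d p (sharp h \<alpha> c p)"
      by (simp add: sharp_def h T[symmetric] vector_matrix_mul_assoc[symmetric])
  qed
qed

end

context flat_mfd
begin

text \<open>The chart is changed twice: by a translation and restriction that put \<open>x\<close>
  at the origin inside \<open>N\<close>, then by the affine coordinates \<open>\<phi>\<close> of the
  first chart. That the Christoffel symbols vanish is checked in the intermediate chart
  \<open>b\<close>, where the new coordinate fields \<open>Y\<close> satisfy
  \<open>d\<phi>(Y) = e\<^sub>j\<close>.\<close>

lemma exists_affine_chart:
  assumes N: "openin X N" "x \<in> N"
  obtains c where "c \<in> A" "x \<in> fst c" "fst c \<subseteq> N" "snd c x = 0"
    "\<And>i j u. u \<in> snd c ` fst c \<Longrightarrow> christoffel c i j u = 0"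
proof -
  obtain c0 where c0: "c0 \<in> A" "x \<in> fst c0" using N openin_subset charts_cover by blast
  define U0 f0 where "U0 = cimage c0 N" and "f0 u = u - snd c0 x" for u
  have "smooth_on S f0" if "open S" for S unfolding f0_def[abs_def] using that by (intro smooth_intros)
  moreover have "open U0" unfolding U0_def by (rule open_cimage[OF c0(1) N(1)])
  moreover have "open (f0 ` U0)" unfolding f0_def[abs_def] using open_translation_subtract \<open>open U0\<close> by blast
  moreover have "smooth_on (f0 ` U0) (\<lambda>u. u + snd c0 x)" using calculation by (intro smooth_intros)
  ultimately have d0: "diffeo U0 (f0 ` U0) f0 (\<lambda>u. u + snd c0 x)"
    by (auto simp: diffeo_def f0_def image_image)
  have U0: "U0 \<subseteq> snd c0 ` fst c0" by (auto simp: U0_def cimage_def)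
  define b where "b = recoord c0 U0 f0"
  have b: "b \<in> A" unfolding b_def by (rule recoord_in_atlas[OF c0(1) d0 U0])
  have xb: "x \<in> fst b" "snd b x = 0" unfolding b_def
    using c0 N cimageI[OF c0(2) N(2)] by (auto simp: recoord_def U0_def f0_def)
  have bN: "fst b \<subseteq> N"
    using cinv_chart[OF c0(1)] cimageD[OF c0(1)] unfolding b_def recoord_def U0_def by fastforce
  have zero: "0 \<in> snd b ` fst b" using xb by force
  obtain U V \<phi> \<psi> where \<phi>: "diffeo U V \<phi> \<psi>" "0 \<in> U" "U \<subseteq> snd b ` fst b" "\<phi> 0 = 0"
    "\<And>u v. u \<in> U \<Longrightarrow> fd \<phi> u v = 0 \<Longrightarrow> v = 0"
    "\<And>u i j. u \<in> U \<Longrightarrow> fd (\<lambda>u. fd \<phi> u (axis j 1)) u (axis i 1) = fd \<phi> u (christoffel b i j u)"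
    by (rule affine_coordinates[of "snd b ` fst b" "christoffel b", OF christoffel_smooth[OF b] open_image[OF b]
          zero christoffel_sym[OF b] christoffel_flat[OF b]]) (assumption | rule that)+
  define c where "c = recoord b U \<phi>"
  note rc = b \<phi>(1,3)
  have c: "c \<in> A" unfolding c_def by (rule recoord_in_atlas[OF rc])
  have dom: "q \<in> fst c \<longleftrightarrow> q \<in> fst b \<and> snd b q \<in> U" for q
    unfolding c_def by (rule recoord_dom[OF rc])
  have sub: "fst c \<subseteq> fst b" using dom by blast
  have smU: "smooth_on U \<phi>" "open U" using \<phi>(1) by (auto simp: diffeo_def)
  have "christoffel c i j u = 0" if u: "u \<in> snd c ` fst c" for i j u
  proof -
    obtain q where q: "q \<in> fst c" "u = snd c q" using u by blast
    have qb: "q \<in> fst b" using q sub by blast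
    let ?W = "fst c" and ?u = "snd b q"
    have uU: "?u \<in> U" using q dom by blast
    define Y where "Y u = coord_field c j b (cinv b u)" for u
    have E: "vector_field_on A ?W (coord_field c i)" for i by (rule vector_field_coord_field[OF c])
    have img: "cimage b ?W = U"
      using \<phi>(3) dom by (auto simp: cimage_def subset_iff image_iff)
    have Ysm: "smooth_on U Y" unfolding Y_def[abs_def] using vector_field_smooth[OF E b] img by metis
    have Y1: "fd \<phi> u (Y u) = axis j 1" if "u \<in> U" for u
    proof -
      have cu: "cinv b u \<in> fst c" "cinv b u \<in> fst b" "snd b (cinv b u) = u"
        using cimageD[OF b, of u ?W] that img by auto
      have "fd \<phi> u (Y u) = dtransition b c (cinv b u) (coord_field c j b (cinv b u))"
        using dtransition_to_recoord[OF rc, folded c_def, OF cu(1)] cu(3) by (simp add: Y_def)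
      then show ?thesis using dtransition_inverse[OF c b cu(1,2)] by (simp add: coord_field_def)
    qed
    define w where "w = coord_field c i b q"
    have linu: "linear (fd \<phi> ?u)" by (rule smooth_on_linear_fd[OF smU(1) uU])
    have expand: "fd \<phi> u (Y u) = (\<Sum>k\<in>UNIV. Y u $ k *\<^sub>R fd \<phi> u (axis k 1))" if "u \<in> U" for u
      by (rule linear_eq_sum_axis[OF smooth_on_linear_fd[OF smU(1) that]])
    \<comment> \<open>Differentiating the constant \<open>d\<phi>(Y)\<close> along \<open>w\<close>
      gives a second-derivative term, equal to \<open>d\<phi>(\<Gamma>(w, Y))\<close> by the choice
      of \<open>\<phi>\<close>, plus \<open>d\<phi>(dY(w))\<close>. Their sum is
      \<open>d\<phi>\<close> of the covariant derivative, and \<open>d\<phi>\<close> is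
      injective.\<close>
    have "((\<lambda>u. \<Sum>k\<in>UNIV. Y u $ k *\<^sub>R fd \<phi> u (axis k 1)) has_derivative
        (\<lambda>v. \<Sum>k\<in>UNIV. Y ?u $ k *\<^sub>R fd (\<lambda>u. fd \<phi> u (axis k 1)) ?u v + fd Y ?u v $ k *\<^sub>R fd \<phi> ?u (axis k 1))) (at ?u)"
      by (intro has_derivative_sum has_derivative_scaleR bounded_linear.has_derivative[OF bounded_linear_vec_nth]
            smooth_on_has_derivative[OF smooth_on_fd_dir[OF smU(1)]] smooth_on_has_derivative[OF Ysm] uU)
    from fd_eq[OF this]
    have "(\<Sum>k\<in>UNIV. Y ?u $ k *\<^sub>R fd (\<lambda>u. fd \<phi> u (axis k 1)) ?u w + fd Y ?u w $ k *\<^sub>R fd \<phi> ?u (axis k 1)) =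
        fd (\<lambda>u. \<Sum>k\<in>UNIV. Y u $ k *\<^sub>R fd \<phi> u (axis k 1)) ?u w" by simp
    also have "\<dots> = fd (\<lambda>u. axis j 1) ?u w"
      by (subst fd_cong_open[OF smU(2) uU, of _ "\<lambda>u. axis j 1"]) (use Y1 expand in auto)
    finally have "(\<Sum>k\<in>UNIV. Y ?u $ k *\<^sub>R fd (\<lambda>u. fd \<phi> u (axis k 1)) ?u w) +
        (\<Sum>k\<in>UNIV. fd Y ?u w $ k *\<^sub>R fd \<phi> ?u (axis k 1)) = 0"
      by (simp add: sum.distrib)
    moreover have "(\<Sum>k\<in>UNIV. fd Y ?u w $ k *\<^sub>R fd \<phi> ?u (axis k 1)) = fd \<phi> ?u (fd Y ?u w)"
      by (rule linear_eq_sum_axis[OF linu, symmetric])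
    moreover have "(\<Sum>k\<in>UNIV. Y ?u $ k *\<^sub>R fd (\<lambda>u. fd \<phi> u (axis k 1)) ?u w) =
        fd \<phi> ?u (bil (\<lambda>i k. christoffel b i k ?u) w (Y ?u))"
    proof -
      have "fd (\<lambda>u. fd \<phi> u (axis k 1)) ?u w = (\<Sum>i\<in>UNIV. w $ i *\<^sub>R fd \<phi> ?u (christoffel b i k ?u))" for k
        using linear_eq_sum_axis[OF smooth_on_linear_fd[OF smooth_on_fd_dir[OF smU(1)] uU], of "axis k 1" w]
        by (simp add: \<phi>(6)[OF uU])
      then show ?thesis
        unfolding bil_def
        by (simp add: linear_sum[OF linu] linear_scale[OF linu] scaleR_sum_right mult.commute)
           (rule sum.swap)
    qed
    ultimately have "fd \<phi> ?u (fd Y ?u w + bil (\<lambda>i k. christoffel b i k ?u) w (Y ?u)) = 0"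
      by (simp add: linear_add[OF linu] add.commute)
    then have "fd Y ?u w + bil (\<lambda>i k. christoffel b i k ?u) w (Y ?u) = 0" by (rule \<phi>(5)[OF uU])
    then have "nabla (coord_field c i) (coord_field c j) b q = 0"
      using nabla_chart[OF b open_dom[OF c] sub q(1) E E, of i j] qb b unfolding Y_def w_def by simp
    moreover have "vector_law (nabla (coord_field c i) (coord_field c j)) q"
      using nabla_field[OF open_dom[OF c] E E] q(1) unfolding vector_field_on_iff by blast
    then have "nabla (coord_field c i) (coord_field c j) c q =
        dtransition b c q (nabla (coord_field c i) (coord_field c j) b q)"
      using b c q(1) qb unfolding vector_law_def by blast
    ultimately show ?thesis
      using linear_0[OF linear_dtransition[OF b c qb q(1)]] q c by (simp add: christoffel_def)
  qed
  moreover have "x \<in> fst c" "snd c x = 0" "fst c \<subseteq> N"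
    using dom xb \<phi>(2,4) sub bN by (auto simp: c_def recoord_snd[OF rc])
  ultimately show thesis using that c by blast
qed

section \<open>Covariant derivatives in an affine chart\<close>

context
  fixes c
  assumes c: "c \<in> A" and affine: "\<And>i j u. u \<in> snd c ` fst c \<Longrightarrow> christoffel c i j u = 0"
begin

lemma nabla_affine_chart:
  assumes "openin X W" "W \<subseteq> fst c" "p \<in> W" "vector_field_on A W V" "vector_field_on A W Y"
  shows "nabla V Y c p = fd (\<lambda>u. Y c (cinv c u)) (snd c p) (V c p)"
proof -
  have "snd c p \<in> snd c ` fst c" using assms by blast
  then show ?thesis using nabla_chart[OF c assms] affine by (simp add: bil_def)
qed

text \<open>In an affine chart a form is differentiated componentwise: the derivative of the
  coordinate field of \<open>s\<close> occurs both in the derivative of the pairing and in the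
  pairing with \<open>nabla\<close>, and cancels. The chart \<open>s\<close> stays arbitrary because
  \<open>bieval\<close> reads the components in the chart picked by
  \<open>some_chart\<close>.\<close>

lemma covd_form_affine_chart:
  assumes s: "s \<in> A" "p \<in> fst s" and p: "p \<in> fst c"
    and V: "vector_field_on A (topspace X) V" and \<beta>: "one_form_on A (topspace X) \<beta>"
  shows "covd_form A nabla V \<beta> s p \<bullet> v =
    fd (\<lambda>u. \<beta> c (cinv c u)) (snd c p) (V c p) \<bullet> dtransition s c p v"
proof -
  define W where "W = fst c \<inter> fst s"
  have W: "openin X W" "W \<subseteq> fst c" "W \<subseteq> topspace X" "p \<in> W"
    using open_dom[OF c] open_dom[OF s(1)] dom_subset[OF c] p s by (auto simp: W_def)
  have pW: "snd c p \<in> cimage c W" by (rule cimageI[OF p W(4)])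
  note opW = open_cimage[OF c W(1)]
  note VW = vector_field_on_subset[OF V W(3)]
  have vl: "vector_law V p" using V W unfolding vector_field_on_iff by blast
  have fl: "form_law \<beta> q" if "q \<in> W" for q using \<beta> W that unfolding one_form_on_iff by blast
  have \<beta>d: "((\<lambda>u. \<beta> c (cinv c u)) has_derivative fd (\<lambda>u. \<beta> c (cinv c u)) (snd c p)) (at (snd c p))"
    using \<beta> c subsetD[OF cimage_mono[OF W(3)] pW] unfolding one_form_on_iff smooth_components_def
    by (intro smooth_on_has_derivative[of "cimage c (topspace X)"]) auto
  have comp: "covd_form A nabla V \<beta> s p $ i =
      fd (\<lambda>u. \<beta> c (cinv c u)) (snd c p) (V c p) \<bullet> dtransition s c p (axis i 1)" for i
  proof -
    let ?E = "coord_field s i"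
    have EW: "vector_field_on A W ?E"
      by (rule vector_field_on_subset[OF vector_field_coord_field[OF s(1)]]) (simp add: W_def)
    have El: "vector_law ?E q" if "q \<in> W" for q using EW that unfolding vector_field_on_iff by blast
    have pair: "pairing A \<beta> ?E (cinv c u) = \<beta> c (cinv c u) \<bullet> ?E c (cinv c u)" if "u \<in> cimage c W" for u
      using cimageD[OF c that] by (intro pairing_chart c fl El) auto
    have Ed: "((\<lambda>u. ?E c (cinv c u)) has_derivative fd (\<lambda>u. ?E c (cinv c u)) (snd c p)) (at (snd c p))"
      by (rule smooth_on_has_derivative[OF vector_field_smooth[OF EW c] pW])
    have "((\<lambda>u. \<beta> c (cinv c u) \<bullet> ?E c (cinv c u)) has_derivative
        (\<lambda>v. \<beta> c p \<bullet> fd (\<lambda>u. ?E c (cinv c u)) (snd c p) v + fd (\<lambda>u. \<beta> c (cinv c u)) (snd c p) v \<bullet> ?E c p)) (at (snd c p))"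
      using has_derivative_inner[OF \<beta>d Ed] cinv_chart[OF c p] by simp
    then have pd: "((\<lambda>u. pairing A \<beta> ?E (cinv c u)) has_derivative
        (\<lambda>v. \<beta> c p \<bullet> fd (\<lambda>u. ?E c (cinv c u)) (snd c p) v + fd (\<lambda>u. \<beta> c (cinv c u)) (snd c p) v \<bullet> ?E c p)) (at (snd c p))"
      by (rule has_derivative_transform_within_open[OF _ opW pW]) (simp add: pair)
    have "dir_deriv A V (pairing A \<beta> ?E) p = \<beta> c p \<bullet> fd (\<lambda>u. ?E c (cinv c u)) (snd c p) (V c p)
        + fd (\<lambda>u. \<beta> c (cinv c u)) (snd c p) (V c p) \<bullet> ?E c p"
      using dir_deriv_chart[OF c p vl differentiableI[OF pd]] fd_eq[OF pd] by simp
    moreover have "vector_law (nabla V ?E) p"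
      using nabla_field[OF W(1) VW EW] W(4) unfolding vector_field_on_iff by blast
    then have "pairing A \<beta> (nabla V ?E) p = \<beta> c p \<bullet> nabla V ?E c p"
      by (intro pairing_chart c p fl W)
    ultimately show ?thesis
      using nabla_affine_chart[OF W(1,2,4) VW EW] by (simp add: covd_form_def coord_field_def)
  qed
  have "fd (\<lambda>u. \<beta> c (cinv c u)) (snd c p) (V c p) \<bullet> dtransition s c p v =
      (\<Sum>i\<in>UNIV. v $ i * covd_form A nabla V \<beta> s p $ i)"
    unfolding comp
    by (subst linear_eq_sum_axis[OF linear_dtransition[OF s(1) c s(2) p]]) (simp add: inner_sum_right)
  then show ?thesis by (simp add: inner_vec_def[of "covd_form A nabla V \<beta> s p"] mult.commute)
qed

text \<open>Of the three terms in the product rule for \<open>h(\<beta>, \<gamma>)\<close>, the two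
  that differentiate \<open>\<beta>\<close> and \<open>\<gamma>\<close> are exactly those subtracted
  in the definition.\<close>

lemma covd_bivector_affine_chart:
  assumes p: "p \<in> fst c" and V: "vector_field_on A (topspace X) V"
    and h: "bivector_field_on A (topspace X) h"
    and \<beta>: "one_form_on A (topspace X) \<beta>" and \<gamma>: "one_form_on A (topspace X) \<gamma>"
  shows "covd_bivector A nabla V h \<beta> \<gamma> p =
    \<beta> c p \<bullet> (fd (\<lambda>u. h c (cinv c u)) (snd c p) (V c p) *v \<gamma> c p)"
proof -
  have pX: "p \<in> topspace X" using p dom_subset[OF c] by blast
  define s where "s = some_chart A p"
  have s: "s \<in> A" "p \<in> fst s" unfolding s_def using some_chart[OF pX] by auto
  let ?T = "cimage c (topspace X)"
  have pT: "snd c p \<in> ?T" by (rule cimageI[OF p pX])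
  have opT: "open ?T" by (rule open_cimage[OF c openin_topspace])
  let ?h = "\<lambda>u. h c (cinv c u)" and ?b = "\<lambda>u. \<beta> c (cinv c u)" and ?g = "\<lambda>u. \<gamma> c (cinv c u)"
  let ?w = "V c p" and ?u = "snd c p"
  have d: "(?h has_derivative fd ?h ?u) (at ?u)" "(?b has_derivative fd ?b ?u) (at ?u)"
      "(?g has_derivative fd ?g ?u) (at ?u)"
    using h \<beta> \<gamma> c unfolding one_form_on_iff bivector_field_on_iff smooth_components_def
    by (auto intro!: smooth_on_has_derivative[OF _ pT])
  have laws: "bivector_law h q" "form_law \<beta> q" "form_law \<gamma> q" if "q \<in> topspace X" for q
    using that h \<beta> \<gamma> unfolding one_form_on_iff bivector_field_on_iff by auto
  have "((\<lambda>u. ?b u \<bullet> (?h u *v ?g u)) has_derivative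
      (\<lambda>v. ?b ?u \<bullet> (?h ?u *v fd ?g ?u v + fd ?h ?u v *v ?g ?u) + fd ?b ?u v \<bullet> (?h ?u *v ?g ?u))) (at ?u)"
    by (intro has_derivative_inner d bounded_bilinear.FDERIV[OF bounded_bilinear_matrix_vector_mult])
  then have D: "((\<lambda>u. ?b u \<bullet> (?h u *v ?g u)) has_derivative
      (\<lambda>v. \<beta> c p \<bullet> (h c p *v fd ?g ?u v + fd ?h ?u v *v \<gamma> c p) + fd ?b ?u v \<bullet> (h c p *v \<gamma> c p))) (at ?u)"
    by (simp only: cinv_chart[OF c p])
  have ev: "((\<lambda>u. bieval A h \<beta> \<gamma> (cinv c u)) has_derivative
      (\<lambda>v. \<beta> c p \<bullet> (h c p *v fd ?g ?u v + fd ?h ?u v *v \<gamma> c p) + fd ?b ?u v \<bullet> (h c p *v \<gamma> c p))) (at ?u)"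
  proof (rule has_derivative_transform_within_open[OF D opT pT])
    show "?b u \<bullet> (?h u *v ?g u) = bieval A h \<beta> \<gamma> (cinv c u)" if "u \<in> ?T" for u
      using bieval_chart[OF c cimageD(1)[OF c that] laws[OF cimageD(2)[OF c that]]] by simp
  qed
  have vl: "vector_law V p" using V pX unfolding vector_field_on_iff by blast
  have "dir_deriv A V (bieval A h \<beta> \<gamma>) p =
      \<beta> c p \<bullet> (h c p *v fd ?g ?u ?w + fd ?h ?u ?w *v \<gamma> c p) + fd ?b ?u ?w \<bullet> (h c p *v \<gamma> c p)"
    using dir_deriv_chart[OF c p vl differentiableI[OF ev]] fd_eq[OF ev] by simp
  moreover have covd: "fd (\<lambda>u. \<zeta> c (cinv c u)) ?u ?w \<bullet> v = covd_form A nabla V \<zeta> s p \<bullet> dtransition c s p v"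
    if "one_form_on A (topspace X) \<zeta>" for \<zeta> v
    using covd_form_affine_chart[OF s p V that] dtransition_inverse[OF c s(1) p s(2)] by simp
  have form: "\<zeta> c p \<bullet> v = \<zeta> s p \<bullet> dtransition c s p v" if "form_law \<zeta> p" for \<zeta> v
    using that c s p unfolding form_law_def by blast
  have "bieval A h (covd_form A nabla V \<beta>) \<gamma> p = fd ?b ?u ?w \<bullet> (h c p *v \<gamma> c p)"
    unfolding bieval_eq s_def[symmetric]
    by (rule bivector_law_eval[OF laws(1)[OF pX] c s(1) p s(2) covd[OF \<beta>] form[OF laws(3)[OF pX]]])
  moreover have "bieval A h \<beta> (covd_form A nabla V \<gamma>) p = \<beta> c p \<bullet> (h c p *v fd ?g ?u ?w)"
    unfolding bieval_eq s_def[symmetric]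
    by (rule bivector_law_eval[OF laws(1)[OF pX] c s(1) p s(2) form[OF laws(2)[OF pX]] covd[OF \<gamma>]])
  ultimately show ?thesis by (simp add: covd_bivector_def inner_add_right)
qed

text \<open>The identity is pointwise, so it is tested on global forms whose values at
  \<open>p\<close> are coordinate covectors; \<open>sharp\<close> then picks out rows of
  \<open>h\<close>.\<close>

lemma codazzi_affine_chart:
  assumes h: "bivector_field_on A (topspace X) h"
    and cod: "\<And>\<alpha> \<beta> \<gamma> p. one_form_on A (topspace X) \<alpha> \<Longrightarrow> one_form_on A (topspace X) \<beta> \<Longrightarrow>
        one_form_on A (topspace X) \<gamma> \<Longrightarrow> p \<in> topspace X \<Longrightarrow>
        covd_bivector A nabla (sharp h \<alpha>) h \<beta> \<gamma> p = covd_bivector A nabla (sharp h \<beta>) h \<alpha> \<gamma> p"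
    and p: "p \<in> fst c"
  shows "fd (\<lambda>u. h c (cinv c u)) (snd c p) (h c p $ i) $ j $ k =
    fd (\<lambda>u. h c (cinv c u)) (snd c p) (h c p $ j) $ i $ k"
proof -
  obtain \<alpha> where \<alpha>: "one_form_on A (topspace X) \<alpha>" "\<alpha> c p = axis i 1" using exists_one_form[OF c p] .
  obtain \<beta> where \<beta>: "one_form_on A (topspace X) \<beta>" "\<beta> c p = axis j 1" using exists_one_form[OF c p] .
  obtain \<gamma> where \<gamma>: "one_form_on A (topspace X) \<gamma>" "\<gamma> c p = axis k 1" using exists_one_form[OF c p] .
  have pX: "p \<in> topspace X" using p dom_subset[OF c] by blast
  have row: "axis a 1 v* B = B $ a" for a and B :: "real ^ 'n ^ 'n"
    by (simp add: vec_eq_iff vector_matrix_mult_def axis_def if_distrib[of "\<lambda>x. x * _"] cong: if_cong)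
  have entry: "axis a 1 \<bullet> (B *v axis b 1) = B $ a $ b" for a b and B :: "real ^ 'n ^ 'n"
    by (simp add: matrix_vector_mult_basis column_def inner_axis')
  have e: "covd_bivector A nabla (sharp h \<zeta>) h \<eta> \<gamma> p =
      \<eta> c p \<bullet> (fd (\<lambda>u. h c (cinv c u)) (snd c p) (\<zeta> c p v* h c p) *v axis k 1)"
    if "one_form_on A (topspace X) \<zeta>" "one_form_on A (topspace X) \<eta>" for \<zeta> \<eta>
    using covd_bivector_affine_chart[OF p vector_field_sharp[OF openin_topspace h that(1)] h that(2) \<gamma>(1)] \<gamma>(2)
    by (simp add: sharp_def)
  show ?thesis
    using cod[OF \<alpha>(1) \<beta>(1) \<gamma>(1) pX] e[OF \<alpha>(1) \<beta>(1)] e[OF \<beta>(1) \<alpha>(1)]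
    by (simp add: \<alpha>(2) \<beta>(2) row entry)
qed

end

end

section \<open>Transport of the leaf coordinates to the manifold\<close>

theorem theorem6p3:
  fixes X :: "'m topology"
    and A :: "('m, 'n::finite) chart set"
    and nabla :: "('m, 'n) vfield \<Rightarrow> ('m, 'n) vfield \<Rightarrow> ('m, 'n) vfield"
    and h :: "('m, 'n) bifield"
    and x :: 'm and N :: "'m set" and r :: nat
  assumes "generalized_pseudo_Hessian X A nabla h"
    and "openin X N" and "x \<in> N"
    and "\<forall>p\<in>N. sharp_rank A h p = r"
  shows "\<exists>c\<in>A. \<exists>(I :: 'n set) (H :: 'n \<Rightarrow> 'n \<Rightarrow> 'm \<Rightarrow> real) (f :: 'm \<Rightarrow> real).
           x \<in> fst c \<and> card I = r \<and> smooth_fun A (fst c) f \<and>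
           field_eq_on A (fst c) h
             (\<lambda>d p. \<Sum>i\<in>I. \<Sum>j\<in>I. H i j p *\<^sub>R tensor (coord_field c i) (coord_field c j) d p) \<and>
           (\<forall>i\<in>I. \<forall>j\<in>I.
              field_eq_on A (fst c) (nabla (coord_field c i) (coord_field c j)) (\<lambda>d p. 0)) \<and>
           (\<forall>p\<in>fst c.
              inverse_matrices I (\<lambda>i j. H i j p)
                (\<lambda>i j. coord_deriv c i (coord_deriv c j f) p))"
proof -
  have G: "smooth_manifold X A" "linear_connection X A nabla" "torsion_free X A nabla" "flat X A nabla"
      "bivector_field_on A (topspace X) h" "symmetric_on A (topspace X) h"
    and cod: "\<And>\<alpha> \<beta> \<gamma> p. one_form_on A (topspace X) \<alpha> \<Longrightarrow> one_form_on A (topspace X) \<beta> \<Longrightarrow>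
        one_form_on A (topspace X) \<gamma> \<Longrightarrow> p \<in> topspace X \<Longrightarrow>
        covd_bivector A nabla (sharp h \<alpha>) h \<beta> \<gamma> p = covd_bivector A nabla (sharp h \<beta>) h \<alpha> \<gamma> p"
    using assms(1) unfolding generalized_pseudo_Hessian_def by blast+
  interpret flat_mfd X A nabla by unfold_locales (fact G)+
  obtain b where b: "b \<in> A" "x \<in> fst b" "fst b \<subseteq> N" "snd b x = 0"
    and affine: "\<And>i j u. u \<in> snd b ` fst b \<Longrightarrow> christoffel b i j u = 0"
    by (rule exists_affine_chart[OF assms(2,3)]) (rule that)
  let ?S = "snd b ` fst b"
  let ?h = "\<lambda>u. h b (cinv b u)"
  have sub: "fst b \<subseteq> topspace X" by (rule dom_subset[OF b(1)])
  have law: "bivector_law h p" if "p \<in> topspace X" for p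
    using G(5) that unfolding bivector_field_on_iff by blast
  have sym: "transpose (h b p) = h b p" if "p \<in> fst b" for p
    using G(6) that b(1) sub unfolding symmetric_on_def by blast
  have cinvS: "cinv b u \<in> fst b \<and> snd b (cinv b u) = u" if "u \<in> ?S" for u
    using that b(1) by auto
  have "smooth_on (cimage b (topspace X)) ?h"
    using G(5) b(1) unfolding bivector_field_on_iff smooth_components_def by blast
  then have hS: "smooth_on ?S ?h"
    by (rule smooth_on_subset) (use sub in \<open>auto simp: cimage_def\<close>)
  have "0 \<in> ?S" using b by force
  then obtain I \<rho> V \<Phi> \<Psi> f where L: "card I = r" "\<rho> > 0" "diffeo (ball 0 \<rho>) V \<Phi> \<Psi>" "V \<subseteq> ?S" "\<Phi> 0 = 0"
    "smooth_on (ball 0 \<rho>) f"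
    and parallel: "\<And>u i j. u \<in> V \<Longrightarrow> i \<in> I \<Longrightarrow> j \<in> I \<Longrightarrow>
       fd (\<lambda>u. fd \<Phi> (\<Psi> u) (axis j 1)) u (fd \<Phi> (\<Psi> u) (axis i 1)) = 0"
    and expand: "\<And>u k l. u \<in> V \<Longrightarrow> ?h u $ k $ l =
       (\<Sum>i\<in>I. \<Sum>j\<in>I. ?h u $ i $ j * (fd \<Phi> (\<Psi> u) (axis i 1) $ k * fd \<Phi> (\<Psi> u) (axis j 1) $ l))"
    and inverse: "\<And>z. z \<in> ball 0 \<rho> \<Longrightarrow> inverse_matrices I (\<lambda>i j. ?h (\<Phi> z) $ i $ j)
       (\<lambda>i j. fd (\<lambda>z. fd f z (axis j 1)) z (axis i 1))"
  proof (rule hessian_leaf_coordinates[of ?S ?h r, OF hS open_image[OF b(1)]])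
    fix u i j k assume u: "u \<in> ?S"
    show "transpose (?h u) = ?h u" using sym cinvS[OF u] by blast
    show "rank (?h u) = r"
      using sharp_rank_chart[OF b(1) _ law sym] cinvS[OF u] sub assms(4) b(3) by (simp add: subset_iff)
    show "fd ?h u (?h u $ i) $ j $ k = fd ?h u (?h u $ j) $ i $ k"
      using codazzi_affine_chart[OF b(1) affine G(5) cod, of "cinv b u" i j k] cinvS[OF u] by simp
  qed (assumption | rule that)+
  note dif = diffeo_sym[OF L(3)]
  \<comment> \<open>\<open>\<Phi>\<close> parametrizes affine coordinates by leaf coordinates, so
    the new chart is the affine chart followed by the inverse \<open>\<Psi>\<close>. Its coordinate
    fields, read in \<open>b\<close>, are the columns of the derivative of
    \<open>\<Phi>\<close>.\<close>
  define c where "c = recoord b V \<Psi>"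
  note rc = b(1) dif L(4)
  have c: "c \<in> A" unfolding c_def by (rule recoord_in_atlas[OF rc])
  have dom: "q \<in> fst c \<longleftrightarrow> q \<in> fst b \<and> snd b q \<in> V" for q
    unfolding c_def by (rule recoord_dom[OF rc])
  have snd_c: "snd c q = \<Psi> (snd b q)" for q unfolding c_def by (rule recoord_snd[OF rc])
  have image: "snd c ` fst c = ball 0 \<rho>" unfolding c_def by (rule recoord_image[OF rc])
  have \<Phi>\<Psi>: "\<Phi> (\<Psi> u) = u" "\<Psi> u \<in> ball 0 \<rho>" if "u \<in> V" for u using L(3) that by (auto simp: diffeo_def)
  have E: "coord_field c i b q = fd \<Phi> (\<Psi> (snd b q)) (axis i 1)" if "q \<in> fst c" for q i
    using dtransition_from_recoord[OF rc] that by (simp add: coord_field_def c_def)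
  have x: "x \<in> fst c"
  proof -
    have "\<Phi> 0 \<in> V" using L(2,3) unfolding diffeo_def by (metis centre_in_ball imageI)
    then show ?thesis using b L(5) dom by simp
  qed
  \<comment> \<open>The coefficients are entries of \<open>h\<close> in the affine chart
    \<open>b\<close>; \<open>expand\<close> shows that they are also the coefficients with respect
    to the \<open>x\<close>-fields of \<open>c\<close>.\<close>
  define H where "H i j p = h b p $ i $ j" for i j p
  define F where "F q = f (snd c q)" for q
  have F_c: "F (cinv c z) = f z" if "z \<in> ball 0 \<rho>" for z
    using that cimageD[OF c, of z "fst c"] unfolding cimage_self image by (simp add: F_def)
  have "smooth_fun A (fst c) F"
  proof (rule smooth_funI[OF c open_dom[OF c] order_refl])
    show "smooth_on (cimage c (fst c)) (\<lambda>u. F (cinv c u))"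
      unfolding cimage_self image by (rule smooth_on_cong[OF open_ball _ L(6)]) (simp add: F_c)
  qed
  moreover have "field_eq_on A (fst c) h
      (\<lambda>d p. \<Sum>i\<in>I. \<Sum>j\<in>I. H i j p *\<^sub>R tensor (coord_field c i) (coord_field c j) d p)"
    unfolding field_eq_on_def
  proof (intro ballI)
    fix d p assume d: "d \<in> A" "p \<in> fst d \<inter> fst c"
    then have p: "p \<in> fst c" "p \<in> fst b" "p \<in> fst d" "snd b p \<in> V" using dom by auto
    let ?T = "matrix (dtransition b d p)"
    have T: "?T *v v = dtransition b d p v" for v
      by (rule matrix_works_linear[OF linear_dtransition[OF b(1) d(1) p(2,3)]])
    \<comment> \<open>Both sides of the expansion transform by the same congruence, so it is enough
      to verify it in the chart \<open>b\<close>.\<close>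
    have tens: "?T ** tensor Y Z b p ** transpose ?T = tensor Y Z d p"
      if "vector_law Y p" "vector_law Z p" for Y Z
    proof -
      have YZ: "Y d p = ?T *v Y b p" "Z d p = ?T *v Z b p"
        using that b(1) d(1) p unfolding vector_law_def T by blast+
      show ?thesis
        by (simp add: vec_eq_iff matrix_matrix_mult_def tensor_def YZ transpose_def matrix_vector_mult_nth
            sum_distrib_left sum_distrib_right mult_ac)
    qed
    have "h b p = (\<Sum>i\<in>I. \<Sum>j\<in>I. H i j p *\<^sub>R tensor (coord_field c i) (coord_field c j) b p)"
    proof -
      have "h b p $ k $ l = (\<Sum>i\<in>I. \<Sum>j\<in>I. H i j p * (coord_field c i b p $ k * coord_field c j b p $ l))" for k l
        using expand[OF p(4), of k l] unfolding cinv_chart[OF b(1) p(2)] H_def E[OF p(1)] .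
      then show ?thesis by (simp add: vec_eq_iff tensor_def)
    qed
    moreover have "h d p = ?T ** h b p ** transpose ?T"
      using law p b(1) d(1) sub unfolding bivector_law_def by blast
    ultimately have "h d p = (\<Sum>i\<in>I. \<Sum>j\<in>I. H i j p *\<^sub>R
        (?T ** tensor (coord_field c i) (coord_field c j) b p ** transpose ?T))"
      by (simp add: bounded_bilinear.sum_left[OF bounded_bilinear_matrix_matrix_mult]
          bounded_bilinear.sum_right[OF bounded_bilinear_matrix_matrix_mult]
          bounded_bilinear.scaleR_left[OF bounded_bilinear_matrix_matrix_mult]
          bounded_bilinear.scaleR_right[OF bounded_bilinear_matrix_matrix_mult])
    then show "h d p = (\<Sum>i\<in>I. \<Sum>j\<in>I. H i j p *\<^sub>R tensor (coord_field c i) (coord_field c j) d p)"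
      by (simp add: tens vector_law_coord_field[OF c p(1)])
  qed
  moreover have "field_eq_on A (fst c) (nabla (coord_field c i) (coord_field c j)) (\<lambda>d p. 0)"
    if ij: "i \<in> I" "j \<in> I" for i j
    unfolding field_eq_on_def
  proof (intro ballI)
    fix d p assume d: "d \<in> A" "p \<in> fst d \<inter> fst c"
    then have p: "p \<in> fst c" "p \<in> fst b" "p \<in> fst d" "snd b p \<in> V" using dom by auto
    have sub_b: "fst c \<subseteq> fst b" using dom by blast
    note Ef = vector_field_coord_field[OF c]
    \<comment> \<open>In \<open>b\<close> the connection is componentwise differentiation, so the
      covariant derivative of the \<open>j\<close>-th field along the \<open>i\<close>-th is the
      expression that \<open>parallel\<close> makes zero.\<close>
    have "fd (\<lambda>u. coord_field c j b (cinv b u)) (snd b p) = fd (\<lambda>u. fd \<Phi> (\<Psi> u) (axis j 1)) (snd b p)"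
    proof (rule fd_cong_open[OF _ p(4)])
      show "open V" using L(3) by (simp add: diffeo_def)
      show "coord_field c j b (cinv b u) = fd \<Phi> (\<Psi> u) (axis j 1)" if "u \<in> V" for u
        using E[of "cinv b u"] cinvS[of u] that L(4) dom by (auto simp: subset_iff)
    qed
    then have "nabla (coord_field c i) (coord_field c j) b p = 0"
      using nabla_affine_chart[OF b(1) affine open_dom[OF c] sub_b p(1) Ef Ef] parallel[OF p(4) ij] E[OF p(1)]
      by simp
    moreover have "vector_law (nabla (coord_field c i) (coord_field c j)) p"
      using nabla_field[OF open_dom[OF c] Ef Ef] p(1) unfolding vector_field_on_iff by blast
    then have "nabla (coord_field c i) (coord_field c j) d p =
        dtransition b d p (nabla (coord_field c i) (coord_field c j) b p)"
      using b(1) d(1) p unfolding vector_law_def by blast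
    ultimately show "nabla (coord_field c i) (coord_field c j) d p = 0"
      using linear_0[OF linear_dtransition[OF b(1) d(1) p(2,3)]] by simp
  qed
  moreover have "inverse_matrices I (\<lambda>i j. H i j p) (\<lambda>i j. coord_deriv c i (coord_deriv c j F) p)"
    if p: "p \<in> fst c" for p
  proof -
    have pV: "p \<in> fst b" "snd b p \<in> V" using p dom by auto
    have pB: "snd c p \<in> ball 0 \<rho>" using \<Phi>\<Psi>[OF pV(2)] snd_c by simp
    \<comment> \<open>This holds on the whole ball, not just at \<open>p\<close>, so that the first
      derivative can be differentiated once more.\<close>
    have F1: "coord_deriv c j F q = fd f (snd c q) (axis j 1)" if "snd c q \<in> ball 0 \<rho>" for j q
      unfolding coord_deriv_def o_def
      by (subst fd_cong_open[OF open_ball that, of _ f]) (auto simp: F_c)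
    have "coord_deriv c i (coord_deriv c j F) p = fd (\<lambda>z. fd f z (axis j 1)) (snd c p) (axis i 1)" for i j
      unfolding coord_deriv_def[of c i] o_def
    proof (subst fd_cong_open[OF open_ball pB, of _ "\<lambda>z. fd f z (axis j 1)"])
      show "coord_deriv c j F (cinv c z) = fd f z (axis j 1)" if "z \<in> ball 0 \<rho>" for z
        using F1[of "cinv c z"] that cimageD[OF c, of z "fst c"] unfolding cimage_self image by simp
    qed simp
    then show ?thesis
      using inverse[OF pB] \<Phi>\<Psi>(1)[OF pV(2)] b(1) pV(1) by (simp add: H_def snd_c)
  qed
  ultimately show ?thesis using c x L(1) by blast
qed

end
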